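(* Let $D\in\mathbb{N}$ and let $\omega\in\{\mathbf 0,\mathbf 1,\mathbf 2\}^\infty$ be a string satisfying Assumption $(\mathrm{Fr}(D))$. For any $\epsilon>0$ there exist a constant $C=C(D,\epsilon)>0$ and a non-degenerate symmetric probability measure $\mu$ on $G_\omega$ of finite entropy and non-trivial Poisson boundary with tail decay $$\mu\left(B(id,L_n^\omega)^c\right)\le C\,(2^{n})^{-1+\epsilon}\qquad\text{for all } n\ge 1.$$ As a consequence, there exists a constant $c=c(\omega,\epsilon)>0$ such that for all $n\ge 1$, $$v_{G_\omega,S}(L_n^\omega)\ge\exp\left(c\,(2^{n})^{1-\epsilon}\right).$$
   Context: Grigorchuk groups: the rooted binary tree has the finite words over $\{0,1\}$ as vertices. Its automorphism group acts from the right. An automorphism is written $g=(g_0,g_1)\tau$ with $\tau$ a permutation of $\{0,1\}$, meaning $(iw)\cdot g=(i\cdot\tau)(w\cdot g_i)$. Let $\varepsilon$ be the transposition of $0,1$ and $a=(id,id)\varepsilon$. Let $\{id,b,c,d\}$ be the Klein four-group. The letters $\mathbf{0},\mathbf{1},\mathbf{2}$ denote the three non-trivial homomorphisms $\{id,b,c,d\}\to\{id,a\}\cong\mathbb{Z}/2\mathbb{Z}$, with $\mathbf{0},\mathbf{1},\mathbf{2}$ vanishing on $d,c,b$ respectively. For $\omega=\omega_0\omega_1\ldots$ let $\mathfrak{s}\omega=\omega_1\omega_2\ldots$. The automorphisms $b_\omega,c_\omega,d_\omega$ are defined recursively by $x_\omega=(\omega_0(x),x_{\mathfrak{s}\omega})$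 for $x\in\{b,c,d\}$. The Grigorchuk group $G_\omega$ is generated by $S=\{a,b_\omega,c_\omega,d_\omega\}$. $B(id,r)$ is the ball of radius $r$ around the identity for the word length of $(G_\omega,S)$, and $v_{G_\omega,S}(r)$ is its cardinality. Assumption $(\mathrm{Fr}(D))$: for every integer $k\ge 0$, the string $\omega_{kD}\omega_{kD+1}\ldots\omega_{kD+D-1}$ contains at least one of $\mathbf{201}$, $\mathbf{211}$ as a substring (of consecutive letters). Define $$M_{\mathbf 0}=\begin{pmatrix}2&0&1\\0&2&1\\0&0&1\end{pmatrix},\quad M_{\mathbf 1}=\begin{pmatrix}2&1&0\\0&1&0\\0&1&2\end{pmatrix},\quad M_{\mathbf 2}=\begin{pmatrix}1&0&0\\1&2&0\\1&0&2\end{pmatrix},$$ and $L_n^\omega=(1\ 1\ 1)\,M_{\omega_0}\cdots M_{\omega_{n-1}}\,(1\ 1\ 1)^{T}$. A probability measure $\mu$ on a countable group $\Gamma$ is non-degenerate if its support generates $\Gamma$ as a semigroup, and symmetric if $\mu(g)=\mu(g^{-1})$. Its entropy is $-\sum_g\mu(g)\log\mu(g)$. The Poisson boundary of $(\Gamma,\mu)$ is non-trivial if there is a non-constant bounded $f:\Gamma\to\mathbb{R}$ with $f(x)=\sum_y f(xy)\mu(y)$ for all $x$. *)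

theory Defs
  imports
    "HOL-Analysis.Analysis"
    "HOL-Probability.Probability_Mass_Function"
    "HOL-Algebra.Generated_Groups"
    "HOL-Library.Sublist"
begin

section \<open>Automorphisms of the rooted binary tree\<close>

text \<open>Vertices are words over \<open>{0,1}\<close>, with \<open>False\<close> for the digit 0 and \<open>True\<close> for the digit 1;
  the root is the empty word.\<close>

type_synonym vertex = "bool list"

definition tree_adj :: "vertex \<Rightarrow> vertex \<Rightarrow> bool" where
  "tree_adj u v \<longleftrightarrow> (\<exists>i. v = u @ [i]) \<or> (\<exists>i. u = v @ [i])"

definition tree_automorphism :: "(vertex \<Rightarrow> vertex) \<Rightarrow> bool" where
  "tree_automorphism g \<longleftrightarrow>
     bij g \<and> g [] = [] \<and> (\<forall>u v. tree_adj (g u) (g v) \<longleftrightarrow> tree_adj u v)"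

text \<open>The group acts from the right, so the product \<open>g h\<close> applies \<open>g\<close> first and then \<open>h\<close>.\<close>

definition tree_Aut :: "(vertex \<Rightarrow> vertex) monoid" where
  "tree_Aut = \<lparr>carrier = Collect tree_automorphism, mult = (\<lambda>g h. h \<circ> g), one = id\<rparr>"

text \<open>\<open>wreath g\<^sub>0 g\<^sub>1 \<tau>\<close> is \<open>(g\<^sub>0, g\<^sub>1)\<tau>\<close>, that is
  \<open>(iw)\<cdot>g = (i\<cdot>\<tau>)(w\<cdot>g\<^sub>i)\<close>.\<close>

fun wreath :: "(vertex \<Rightarrow> vertex) \<Rightarrow> (vertex \<Rightarrow> vertex) \<Rightarrow> (bool \<Rightarrow> bool) \<Rightarrow> vertex \<Rightarrow> vertex" where
  "wreath g0 g1 \<tau> [] = []"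
| "wreath g0 g1 \<tau> (i # w) = \<tau> i # (if i then g1 w else g0 w)"

definition tree_a :: "vertex \<Rightarrow> vertex" where
  "tree_a = wreath id id Not"

lemma group_tree_Aut: "group tree_Aut"
proof (rule groupI)
  fix g assume "g \<in> carrier tree_Aut"
  then have g: "bij g" "g [] = []" "\<And>u v. tree_adj (g u) (g v) \<longleftrightarrow> tree_adj u v"
    by (auto simp: tree_Aut_def tree_automorphism_def)
  have "tree_adj (inv_into UNIV g u) (inv_into UNIV g v) \<longleftrightarrow> tree_adj u v" for u v
    using g(3)[of "inv_into UNIV g u" "inv_into UNIV g v"] g(1) by (simp add: bij_is_surj surj_f_inv_f)
  moreover have "inv_into UNIV g [] = []"
    using g(1,2) by (metis bij_is_inj inv_f_f)
  ultimately have "inv_into UNIV g \<in> carrier tree_Aut"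
    using g(1) by (auto simp: tree_Aut_def tree_automorphism_def bij_imp_bij_inv)
  moreover have "inv_into UNIV g \<otimes>\<^bsub>tree_Aut\<^esub> g = \<one>\<^bsub>tree_Aut\<^esub>"
    using g(1) by (auto simp: tree_Aut_def fun_eq_iff bij_is_surj surj_f_inv_f)
  ultimately show "\<exists>h\<in>carrier tree_Aut. h \<otimes>\<^bsub>tree_Aut\<^esub> g = \<one>\<^bsub>tree_Aut\<^esub>" by blast
qed (auto simp: tree_Aut_def tree_automorphism_def bij_comp)

section \<open>The letters as homomorphisms on the Klein four-group\<close>

datatype klein = Kid | Kb | Kc | Kd

fun klein_mult :: "klein \<Rightarrow> klein \<Rightarrow> klein" where
  "klein_mult Kid y = y"
| "klein_mult x Kid = x"
| "klein_mult Kb Kb = Kid" | "klein_mult Kb Kc = Kd" | "klein_mult Kb Kd = Kc"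
| "klein_mult Kc Kb = Kd" | "klein_mult Kc Kc = Kid" | "klein_mult Kc Kd = Kb"
| "klein_mult Kd Kb = Kc" | "klein_mult Kd Kc = Kb" | "klein_mult Kd Kd = Kid"

definition klein_four :: "klein monoid" where
  "klein_four = \<lparr>carrier = UNIV, mult = klein_mult, one = Kid\<rparr>"

lemma group_klein_four: "group klein_four"
proof (rule groupI)
  fix x y z :: klein
  show "x \<otimes>\<^bsub>klein_four\<^esub> y \<otimes>\<^bsub>klein_four\<^esub> z = x \<otimes>\<^bsub>klein_four\<^esub> (y \<otimes>\<^bsub>klein_four\<^esub> z)"
    by (cases x; cases y; cases z; simp add: klein_four_def)
  have "klein_mult x x = Kid" by (cases x) auto
  then show "\<exists>y\<in>carrier klein_four. y \<otimes>\<^bsub>klein_four\<^esub> x = \<one>\<^bsub>klein_four\<^esub>"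
    by (auto simp: klein_four_def)
qed (auto simp: klein_four_def)

datatype letter = L0 | L1 | L2

fun vanishing :: "letter \<Rightarrow> klein" where
  "vanishing L0 = Kd" | "vanishing L1 = Kc" | "vanishing L2 = Kb"

definition letter_hom :: "letter \<Rightarrow> klein \<Rightarrow> vertex \<Rightarrow> vertex" where
  "letter_hom l x = (if x = Kid \<or> x = vanishing l then id else tree_a)"

lemma tree_a_involution [simp]: "tree_a (tree_a w) = w"
  by (cases w) (auto simp: tree_a_def)

lemma tree_a_snoc: "\<exists>j. tree_a (w @ [i]) = tree_a w @ [j]"
  by (cases w) (auto simp: tree_a_def)

lemma tree_automorphismI:
  assumes root: "g [] = []" and invol: "\<And>w. g (g w) = w"
    and snoc: "\<And>w i. \<exists>j. g (w @ [i]) = g w @ [j]"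
  shows "tree_automorphism g"
proof -
  have adj: "tree_adj (g u) (g v)" if "tree_adj u v" for u v
    using that snoc unfolding tree_adj_def by blast
  have "tree_adj (g u) (g v) \<longleftrightarrow> tree_adj u v" for u v
    using adj[of u v] adj[of "g u" "g v"] by (auto simp: invol)
  moreover have "bij g" using invol by (intro o_bij[of g g]) (auto simp: fun_eq_iff)
  ultimately show ?thesis using root by (auto simp: tree_automorphism_def)
qed

lemma tree_automorphism_a: "tree_automorphism tree_a"
  by (rule tree_automorphismI) (auto simp: tree_a_snoc, simp add: tree_a_def)

text \<open>The three letters are exactly the non-trivial homomorphisms to \<open>{id, a}\<close>.\<close>

lemma letter_hom_characterization:
  "range letter_hom =
     {f \<in> hom klein_four (tree_Aut\<lparr>carrier := {id, tree_a}\<rparr>). f \<noteq> (\<lambda>_. id)}"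
proof -
  have aa: "tree_a \<circ> tree_a = id" by (auto simp: fun_eq_iff)
  have "tree_a [True] = [False]" by (simp add: tree_a_def)
  then have "tree_a \<noteq> id" by force
  note na = this this[symmetric]
  have 1: "letter_hom l \<in> hom klein_four (tree_Aut\<lparr>carrier := {id, tree_a}\<rparr>)" for l
  proof (rule homI)
    fix x y
    show "letter_hom l (x \<otimes>\<^bsub>klein_four\<^esub> y) =
        letter_hom l x \<otimes>\<^bsub>tree_Aut\<lparr>carrier := {id, tree_a}\<rparr>\<^esub> letter_hom l y"
      by (cases l; cases x; cases y; simp add: letter_hom_def klein_four_def tree_Aut_def aa)
  qed (auto simp: letter_hom_def)
  have 2: "letter_hom l \<noteq> (\<lambda>_. id)" for l
  proof
    assume "letter_hom l = (\<lambda>_. id)"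
    then have "letter_hom l Kb = id" "letter_hom l Kc = id" by simp_all
    then show False using na by (cases l) (auto simp: letter_hom_def)
  qed
  have 3: "f \<in> range letter_hom"
    if f: "f \<in> hom klein_four (tree_Aut\<lparr>carrier := {id, tree_a}\<rparr>)" "f \<noteq> (\<lambda>_. id)" for f
  proof -
    have m: "f (klein_mult x y) = f y \<circ> f x" for x y
      using hom_mult[OF f(1), of x y] by (simp add: klein_four_def tree_Aut_def)
    have c: "f x = id \<or> f x = tree_a" for x
      using hom_in_carrier[OF f(1), of x] by (auto simp: klein_four_def)
    have "f Kid = f Kid \<circ> f Kid" using m[of Kid Kid] by (simp only: klein_mult.simps)
    then have k: "f Kid = id" using c[of Kid] aa by metis
    have d: "f Kd = f Kc \<circ> f Kb" using m[of Kb Kc] by simp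
    have ext: "g = h" if "g Kid = h Kid" "g Kb = h Kb" "g Kc = h Kc" "g Kd = h Kd"
      for g h :: "klein \<Rightarrow> vertex \<Rightarrow> vertex"
    proof
      fix x show "g x = h x" using that by (cases x) auto
    qed
    consider "f Kb = id" "f Kc = id" | "f Kb = id" "f Kc = tree_a"
      | "f Kb = tree_a" "f Kc = id" | "f Kb = tree_a" "f Kc = tree_a"
      using c[of Kb] c[of Kc] by argo
    then show ?thesis
    proof cases
      case 1
      then have "f = (\<lambda>_. id)" by (intro ext) (auto simp: k d)
      with f(2) show ?thesis by simp
    next
      case 2
      then have "f = letter_hom L2" by (intro ext) (auto simp: k d letter_hom_def)
      then show ?thesis by blast
    next
      case 3
      then have "f = letter_hom L1" by (intro ext) (auto simp: k d letter_hom_def)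
      then show ?thesis by blast
    next
      case 4
      then have "f = letter_hom L0" by (intro ext) (auto simp: k d aa letter_hom_def)
      then show ?thesis by blast
    qed
  qed
  show ?thesis
  proof (intro equalityI subsetI)
    fix f assume "f \<in> range letter_hom"
    then obtain l where "f = letter_hom l" by (rule rangeE)
    then show "f \<in> {f \<in> hom klein_four (tree_Aut\<lparr>carrier := {id, tree_a}\<rparr>). f \<noteq> (\<lambda>_. id)}"
      using 1[of l] 2[of l] by (simp only: mem_Collect_eq not_False_eq_True simp_thms)
  qed (use 3 in simp)
qed

section \<open>Grigorchuk groups\<close>

definition shift :: "(nat \<Rightarrow> 'a) \<Rightarrow> nat \<Rightarrow> 'a" where
  "shift \<omega> = (\<lambda>n. \<omega> (Suc n))"

text \<open>\<open>spinal x \<omega>\<close> is \<open>x\<^sub>\<omega>\<close>; the recursion on words unfolds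
  \<open>x\<^sub>\<omega> = (\<omega>\<^sub>0(x), x\<^bsub>\<s>\<omega>\<^esub>)\<close>, see \<open>spinal_wreath\<close> below.\<close>

fun spinal :: "klein \<Rightarrow> (nat \<Rightarrow> letter) \<Rightarrow> vertex \<Rightarrow> vertex" where
  "spinal x \<omega> [] = []"
| "spinal x \<omega> (False # w) = False # letter_hom (\<omega> 0) x w"
| "spinal x \<omega> (True # w) = True # spinal x (shift \<omega>) w"

lemma spinal_wreath:
  "spinal x \<omega> = wreath (letter_hom (\<omega> 0) x) (spinal x (shift \<omega>)) id"
proof
  fix w show "spinal x \<omega> w = wreath (letter_hom (\<omega> 0) x) (spinal x (shift \<omega>)) id w"
  proof (cases w)
    case (Cons i u) then show ?thesis by (cases i) auto
  qed simp
qed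

definition grig_gens :: "(nat \<Rightarrow> letter) \<Rightarrow> (vertex \<Rightarrow> vertex) set" where
  "grig_gens \<omega> = {tree_a, spinal Kb \<omega>, spinal Kc \<omega>, spinal Kd \<omega>}"

definition grigorchuk :: "(nat \<Rightarrow> letter) \<Rightarrow> (vertex \<Rightarrow> vertex) monoid" where
  "grigorchuk \<omega> = subgroup_generated tree_Aut (grig_gens \<omega>)"

lemma tree_automorphism_spinal: "tree_automorphism (spinal x \<omega>)"
proof (rule tree_automorphismI)
  show "spinal x \<omega> (spinal x \<omega> w) = w" for w
    by (induction x \<omega> w rule: spinal.induct) (auto simp: letter_hom_def)
  show "\<exists>j. spinal x \<omega> (w @ [i]) = spinal x \<omega> w @ [j]" for w i
  proof (induction x \<omega> w rule: spinal.induct)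
    case (1 x \<omega>) then show ?case by (cases i) (auto simp: letter_hom_def tree_a_def)
  qed (auto simp: letter_hom_def tree_a_snoc)
qed simp

text \<open>\<^const>\<open>subgroup_generated\<close> only uses generators lying in the ambient group; here all do.\<close>

lemma grig_gens_subset: "grig_gens \<omega> \<subseteq> carrier tree_Aut"
  by (auto simp: grig_gens_def tree_Aut_def tree_automorphism_a tree_automorphism_spinal)

lemma carrier_grigorchuk: "carrier (grigorchuk \<omega>) = generate tree_Aut (grig_gens \<omega>)"
  using grig_gens_subset[of \<omega>]
  by (simp add: grigorchuk_def carrier_subgroup_generated Int_absorb1)

lemma group_grigorchuk: "group (grigorchuk \<omega>)"
  unfolding grigorchuk_def by (rule group.group_subgroup_generated[OF group_tree_Aut])

section \<open>Word length and growth\<close>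

definition word_length :: "('a, 'b) monoid_scheme \<Rightarrow> 'a set \<Rightarrow> 'a \<Rightarrow> nat" where
  "word_length G S g =
     (LEAST n. \<exists>ws. length ws = n \<and> set ws \<subseteq> S \<union> m_inv G ` S
        \<and> foldr (\<otimes>\<^bsub>G\<^esub>) ws \<one>\<^bsub>G\<^esub> = g)"

definition word_ball :: "('a, 'b) monoid_scheme \<Rightarrow> 'a set \<Rightarrow> real \<Rightarrow> 'a set" where
  "word_ball G S r = {g \<in> carrier G. real (word_length G S g) \<le> r}"

definition growth :: "('a, 'b) monoid_scheme \<Rightarrow> 'a set \<Rightarrow> real \<Rightarrow> nat" where
  "growth G S r = card (word_ball G S r)"

section \<open>The frequency assumption and the numbers \<open>L\<^sub>n\<close>\<close>

definition Fr :: "nat \<Rightarrow> (nat \<Rightarrow> letter) \<Rightarrow> bool" where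
  "Fr D \<omega> \<longleftrightarrow>
     (\<forall>k. sublist [L2, L0, L1] (map \<omega> [k * D ..< k * D + D])
        \<or> sublist [L2, L1, L1] (map \<omega> [k * D ..< k * D + D]))"

fun letter_matrix :: "letter \<Rightarrow> real^3^3" where
  "letter_matrix L0 = vector [vector [2, 0, 1], vector [0, 2, 1], vector [0, 0, 1]]"
| "letter_matrix L1 = vector [vector [2, 1, 0], vector [0, 1, 0], vector [0, 1, 2]]"
| "letter_matrix L2 = vector [vector [1, 0, 0], vector [1, 2, 0], vector [1, 0, 2]]"

fun matrix_word :: "(nat \<Rightarrow> letter) \<Rightarrow> nat \<Rightarrow> real^3^3" where
  "matrix_word \<omega> 0 = mat 1"
| "matrix_word \<omega> (Suc n) = matrix_word \<omega> n ** letter_matrix (\<omega> n)"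

definition grig_L :: "(nat \<Rightarrow> letter) \<Rightarrow> nat \<Rightarrow> real" where
  "grig_L \<omega> n = (vector [1, 1, 1] v* matrix_word \<omega> n) \<bullet> vector [1, 1, 1]"

section \<open>Random walks on countable groups\<close>

text \<open>A probability measure on \<open>G\<close> is a \<^typ>\<open>'a pmf\<close> whose support is contained in the carrier.\<close>

inductive_set semigroup_generated :: "('a, 'b) monoid_scheme \<Rightarrow> 'a set \<Rightarrow> 'a set"
  for G and A where
  "x \<in> A \<Longrightarrow> x \<in> semigroup_generated G A"
| "x \<in> semigroup_generated G A \<Longrightarrow> y \<in> semigroup_generated G A
    \<Longrightarrow> x \<otimes>\<^bsub>G\<^esub> y \<in> semigroup_generated G A"

definition prob_on :: "('a, 'b) monoid_scheme \<Rightarrow> 'a pmf \<Rightarrow> bool" where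
  "prob_on G \<mu> \<longleftrightarrow> set_pmf \<mu> \<subseteq> carrier G"

definition nondegenerate :: "('a, 'b) monoid_scheme \<Rightarrow> 'a pmf \<Rightarrow> bool" where
  "nondegenerate G \<mu> \<longleftrightarrow> semigroup_generated G (set_pmf \<mu>) = carrier G"

definition symmetric :: "('a, 'b) monoid_scheme \<Rightarrow> 'a pmf \<Rightarrow> bool" where
  "symmetric G \<mu> \<longleftrightarrow> (\<forall>g\<in>carrier G. pmf \<mu> g = pmf \<mu> (inv\<^bsub>G\<^esub> g))"

text \<open>All terms \<open>- \<mu>(g) log \<mu>(g)\<close> are nonnegative, and \<open>0 log 0 = 0\<close>, so the entropy is finite
  iff the series is summable.\<close>

definition finite_entropy :: "('a, 'b) monoid_scheme \<Rightarrow> 'a pmf \<Rightarrow> bool" where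
  "finite_entropy G \<mu> \<longleftrightarrow> (\<lambda>g. - (pmf \<mu> g * ln (pmf \<mu> g))) summable_on carrier G"

definition harmonic :: "('a, 'b) monoid_scheme \<Rightarrow> 'a pmf \<Rightarrow> ('a \<Rightarrow> real) \<Rightarrow> bool" where
  "harmonic G \<mu> f \<longleftrightarrow>
     (\<forall>x\<in>carrier G. ((\<lambda>y. f (x \<otimes>\<^bsub>G\<^esub> y) * pmf \<mu> y) has_sum f x) (carrier G))"

definition nontrivial_Poisson_boundary :: "('a, 'b) monoid_scheme \<Rightarrow> 'a pmf \<Rightarrow> bool" where
  "nontrivial_Poisson_boundary G \<mu> \<longleftrightarrow>
     (\<exists>f. bounded (f ` carrier G) \<and> harmonic G \<mu> f \<and> \<not> f constant_on carrier G)"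

end

theory Submission
  imports Defs "HOL-Real_Asymp.Real_Asymp"
begin

text \<open>
  The witness is a random walk whose increments move points far along the orbit of the ray
  \<open>o = 1\<^sup>\<infinity>\<close>, while their local behaviour at the moved point is rarely other than \<open>id\<close> or \<open>d\<close>.

  Germs. Every \<open>g\<close> in \<open>G\<^sub>\<omega>\<close> has at each infinite word \<open>x\<close> a germ in \<open>{id, b, c, d}\<close>: the
  sections of \<open>g\<close> along \<open>x\<close> are eventually \<open>\<kappa>\<^bsub>\<s>\<^sup>k\<omega>\<^esub>\<close> for one \<open>\<kappa>\<close>. Modulo \<open>{id, d}\<close> the germ is a
  cocycle with two values; call it odd when it is \<open>b\<close> or \<open>c\<close>. For a random walk \<open>W\<^sub>N\<close> the odd germ at
  \<open>o\<close> changes at time \<open>N + 1\<close> exactly when the increment has an odd germ at the point \<open>o\<cdot>W\<^sub>N\<close>. If the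
  probabilities of these changes are summable, uniformly over the starting points, then the germ
  stabilises, and the probability that its limit is odd is a bounded harmonic function \<open>f\<close> of the
  starting element. Since \<open>b\<^sub>\<omega>\<close> fixes \<open>o\<close> and has an odd germ there, \<open>f(b\<^sub>\<omega>) = 1 - f(id)\<close>, so a constant
  \<open>f\<close> would be \<open>1/2\<close>; but far along the walk \<open>f\<close> is close to \<open>0\<close> or \<open>1\<close>. This is \<open>germ_limit\<close>.

  Flips. A substitution on words in \<open>ab, ac, ad\<close> lifts a word \<open>w\<close> over \<open>\<s>\<omega>\<close> to a word over \<open>\<omega>\<close> whose
  two sections are \<open>w\<close> and \<open>awa\<close>, when a parity condition holds; the matrices \<open>M\<^sub>0, M\<^sub>1, M\<^sub>2\<close> count the
  letters of its images. Lifting \<open>ak\<close> through \<open>i + 1\<close> levels gives an element \<open>flip i\<close> of length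
  \<open>O(L\<^bsub>i+1\<^esub>)\<close> which fixes the first \<open>i + 1\<close> digits of every word and flips the next one. The parity
  condition asks that \<open>k\<close> is not killed by \<open>\<omega>\<^sub>i\<close>. So \<open>k = d\<close> is allowed as soon as \<open>\<omega>\<^sub>i \<noteq> 0\<close>, and then
  \<open>flip i\<close> has no odd germ at all; for \<open>\<omega>\<^sub>i = 0\<close> the choice \<open>k = c\<close> costs about \<open>2\<^sup>i\<close> odd germs.

  The measure. Put \<open>\<beta> = 1 - \<epsilon>\<close>, where \<open>\<epsilon> \<le> 1/2\<close> without loss of generality.
  Choose a level \<open>n\<close> with probability proportional to \<open>2\<^bsup>-\<beta>n\<^esup>\<close>, and
  multiply the flips with \<open>i < n\<close>, each with exponent \<open>0\<close> or \<open>1\<close> by a fair coin, leaving out those with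
  \<open>\<omega>\<^sub>i = 0\<close> and \<open>i \<ge> \<lfloor>\<beta>n\<rfloor>\<close>; symmetrise. Elements of level \<open>n\<close> have length \<open>O(L\<^sub>n)\<close> and at most
  \<open>O(2\<^bsup>\<beta>n\<^esup>)\<close> odd germs. They spread each point over \<open>2\<^bsup>\<theta>n\<^esup>\<close> points, up to a constant factor, and \<open>\<theta> > \<beta>\<close>
  because the frequency assumption makes a positive proportion of the letters non-zero. One increment of
  level \<open>n\<close> spreads the whole product, and after \<open>N\<close> steps a level with \<open>2\<^bsup>\<beta>n\<^esup>\<close> nearly \<open>N\<close> has been used.
  Hence points are hit with probability at most \<open>N\<close> to a power below \<open>-1\<close>, and this gap pays for the odd
  germs: the changes are summable (\<open>limit_mu\<close>).

  Growth. The increments of the entropy \<open>H(W\<^sub>N)\<close> are averages over the first step \<open>s\<close> of relative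
  entropies between the laws of \<open>sW\<^sub>N\<close> and \<open>W\<^bsub>N+1\<^esub>\<close>. For some \<open>s\<close> the germ distinguishes these laws in the limit, so the increments stay bounded
  below and the entropy grows linearly (\<open>exponential_support\<close>). Since \<open>L\<^bsub>n+1\<^esub> \<ge> 2L\<^sub>n\<close>, a walk of
  \<open>N = c2\<^bsup>\<beta>n\<^esup>\<close> steps stays in the ball of radius \<open>L\<^sub>n\<close> with probability close to \<open>1\<close>
  (\<open>truncated_length_walk\<close>), and so the ball has at least \<open>exp(c'N)\<close> elements.
\<close>

section \<open>Discrete probability\<close>

lemma expectation_bounded_le:
  fixes f :: "'b \<Rightarrow> real"
  assumes "\<And>x. x \<in> set_pmf p \<Longrightarrow> 0 \<le> f x \<and> f x \<le> c"
  shows "measure_pmf.expectation p f \<le> c"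
proof -
  have "AE x in measure_pmf p. norm (f x) \<le> c" using assms by (force simp: AE_measure_pmf_iff)
  then have i: "integrable (measure_pmf p) f" by (intro measure_pmf.integrable_const_bound) auto
  have "measure_pmf.expectation p f \<le> measure_pmf.expectation p (\<lambda>_. c)"
    by (intro integral_mono_AE i) (use assms in \<open>auto simp: AE_measure_pmf_iff\<close>)
  then show ?thesis by simp
qed

lemma prob_bind_pmf:
  "measure_pmf.prob (bind_pmf p q) A = measure_pmf.expectation p (\<lambda>x. measure_pmf.prob (q x) A)"
proof -
  have "ennreal (measure_pmf.prob (bind_pmf p q) A) = (\<integral>\<^sup>+x. ennreal (measure_pmf.prob (q x) A) \<partial>p)"
    by (simp add: measure_pmf.emeasure_eq_measure[symmetric])
  also have "\<dots> = ennreal (measure_pmf.expectation p (\<lambda>x. measure_pmf.prob (q x) A))"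
    by (intro nn_integral_eq_integral measure_pmf.integrable_const_bound[where B = 1]) auto
  finally show ?thesis by (simp add: integral_nonneg_AE)
qed

lemma prob_pair_pmf:
  "measure_pmf.prob (pair_pmf p q) A = measure_pmf.expectation p (\<lambda>x. measure_pmf.prob q {y. (x, y) \<in> A})"
  "measure_pmf.prob (pair_pmf p q) A = measure_pmf.expectation q (\<lambda>y. measure_pmf.prob p {x. (x, y) \<in> A})"
proof -
  have 1: "pair_pmf p q = bind_pmf p (\<lambda>x. map_pmf (Pair x) q)" for p q
    unfolding pair_pmf_def map_pmf_def ..
  show *: "measure_pmf.prob (pair_pmf p q) A = measure_pmf.expectation p (\<lambda>x. measure_pmf.prob q {y. (x, y) \<in> A})" for p q A
    unfolding 1 by (simp add: prob_bind_pmf vimage_def)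
  have "measure_pmf.prob (pair_pmf p q) A = measure_pmf.prob (pair_pmf q p) {z. (snd z, fst z) \<in> A}"
    by (subst pair_commute_pmf) (simp add: vimage_def case_prod_beta)
  then show "measure_pmf.prob (pair_pmf p q) A = measure_pmf.expectation q (\<lambda>y. measure_pmf.prob p {x. (x, y) \<in> A})"
    by (simp add: *)
qed

lemma prob_cong_support:
  assumes "\<And>x. x \<in> set_pmf p \<Longrightarrow> x \<in> A \<longleftrightarrow> x \<in> B"
  shows "measure_pmf.prob p A = measure_pmf.prob p B"
  by (intro measure_pmf.finite_measure_eq_AE) (use assms in \<open>auto simp: AE_measure_pmf_iff\<close>)

lemma prob_mono_support:
  assumes "\<And>x. x \<in> set_pmf p \<Longrightarrow> x \<in> A \<Longrightarrow> x \<in> B"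
  shows "measure_pmf.prob p A \<le> measure_pmf.prob p B"
  by (intro measure_pmf.finite_measure_mono_AE) (use assms in \<open>auto simp: AE_measure_pmf_iff\<close>)

lemma prob_diff_le:
  "\<bar>measure_pmf.prob p A - measure_pmf.prob p B\<bar> \<le> measure_pmf.prob p {x. x \<in> A \<longleftrightarrow> x \<notin> B}"
proof -
  have "measure_pmf.prob p A \<le> measure_pmf.prob p (B \<union> {x. x \<in> A \<longleftrightarrow> x \<notin> B})"
    "measure_pmf.prob p B \<le> measure_pmf.prob p (A \<union> {x. x \<in> A \<longleftrightarrow> x \<notin> B})"
    by (intro measure_pmf.finite_measure_mono; auto)+
  then show ?thesis
    using measure_subadditive[of B "measure_pmf p" "{x. x \<in> A \<longleftrightarrow> x \<notin> B}"]
      measure_subadditive[of A "measure_pmf p" "{x. x \<in> A \<longleftrightarrow> x \<notin> B}"] by auto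
qed

section \<open>Shannon entropy\<close>

definition shannon :: "'b pmf \<Rightarrow> real" where
  "shannon p = measure_pmf.expectation p (\<lambda>x. - ln (pmf p x))"

lemma ln_pmf_nonpos: "ln (pmf p x) \<le> 0"
  by (cases "pmf p x = 0") (auto simp: pmf_le_1 intro!: ln_le_zero_iff[THEN iffD2])

lemma nn_integral_pmf_ratio:
  assumes "\<And>x. f x \<ge> 0"
  shows "(\<integral>\<^sup>+x. ennreal (pmf r x / pmf p x * f x) \<partial>measure_pmf p) \<le> (\<integral>\<^sup>+x. ennreal (f x) \<partial>measure_pmf r)"
proof -
  have "(\<integral>\<^sup>+x. ennreal (pmf r x / pmf p x * f x) \<partial>measure_pmf p)
      = (\<integral>\<^sup>+x. ennreal (pmf p x) * ennreal (pmf r x / pmf p x * f x) \<partial>count_space UNIV)"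
    by (rule nn_integral_measure_pmf)
  also have "\<dots> \<le> (\<integral>\<^sup>+x. ennreal (pmf r x) * ennreal (f x) \<partial>count_space UNIV)"
    by (intro nn_integral_mono) (use assms in \<open>auto simp: ennreal_mult[symmetric] intro!: ennreal_leI\<close>)
  also have "\<dots> = (\<integral>\<^sup>+x. ennreal (f x) \<partial>measure_pmf r)" by (rule nn_integral_measure_pmf[symmetric])
  finally show ?thesis .
qed

lemma
  fixes f :: "'b \<Rightarrow> real"
  assumes "\<And>x. 0 \<le> f x" "\<And>x. f x \<le> B"
  shows integrable_pmf_ratio: "integrable (measure_pmf p) (\<lambda>x. pmf r x / pmf p x * f x)"
    and expectation_pmf_ratio:
      "measure_pmf.expectation p (\<lambda>x. pmf r x / pmf p x * f x) \<le> measure_pmf.expectation r f"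
proof -
  have nn: "0 \<le> pmf r x / pmf p x * f x" for x using assms by simp
  have ir: "integrable (measure_pmf r) f"
    by (intro measure_pmf.integrable_const_bound[where B = B]) (use assms in auto)
  have le: "(\<integral>\<^sup>+x. ennreal (pmf r x / pmf p x * f x) \<partial>measure_pmf p) \<le> ennreal (measure_pmf.expectation r f)"
    using nn_integral_pmf_ratio[of f p r] assms nn_integral_eq_integral[OF ir] by auto
  show i: "integrable (measure_pmf p) (\<lambda>x. pmf r x / pmf p x * f x)"
    by (intro integrableI_nonneg) (use le nn in \<open>auto intro: le_less_trans\<close>)
  show "measure_pmf.expectation p (\<lambda>x. pmf r x / pmf p x * f x) \<le> measure_pmf.expectation r f"
    using le nn_integral_eq_integral[OF i] nn assms(1)
    by (simp add: ennreal_le_iff integral_nonneg_AE)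
qed

text \<open>A weak form of Pinsker's inequality. The summand satisfies
  \<open>ln (p/r) \<ge> F + 1 - (r/p) exp F\<close> for every function \<open>F\<close>, by \<open>ln y \<le> y - 1\<close>. Integrating this with
  \<open>F = l 1\<^sub>A\<close> leaves \<open>l p(A) - (exp l - 1) r(A)\<close>, and half the difference \<open>p(A) - r(A)\<close> is a good \<open>l\<close>.\<close>
lemma relative_entropy_ge:
  assumes int: "integrable (measure_pmf p) (\<lambda>x. ln (pmf p x) - ln (pmf r x))"
    and supp: "set_pmf p \<subseteq> set_pmf r"
  shows "measure_pmf.expectation p (\<lambda>x. ln (pmf p x) - ln (pmf r x))
      \<ge> (measure_pmf.prob p A - measure_pmf.prob r A)\<^sup>2 / 4"
proof -
  \<comment> \<open>The sign of \<open>l\<close> follows the sign of the difference, so both directions are covered.\<close>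
  define l where "l = (measure_pmf.prob p A - measure_pmf.prob r A) / 2"
  have "0 \<le> measure_pmf.prob p A" "measure_pmf.prob p A \<le> 1" "0 \<le> measure_pmf.prob r A"
    "measure_pmf.prob r A \<le> 1" by auto
  then have "\<bar>measure_pmf.prob p A - measure_pmf.prob r A\<bar> \<le> 1" unfolding abs_le_iff by linarith
  then have l1: "\<bar>l\<bar> \<le> 1 / 2" by (simp add: l_def)
  define F where "F x = exp (l * indicator A x)" for x
  have F: "0 \<le> F x" "F x \<le> exp 1" for x
    using l1 by (auto simp: F_def indicator_def)
  have F_eq: "F = (\<lambda>x. 1 + (exp l - 1) * indicator A x)" by (auto simp: F_def indicator_def)
  have ia: "integrable (measure_pmf q) (indicator A :: _ \<Rightarrow> real)" for q :: "'a pmf"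
    by (intro measure_pmf.integrable_const_bound[where B = 1]) (auto simp: indicator_def)
  have EF: "measure_pmf.expectation r F = 1 + (exp l - 1) * measure_pmf.prob r A"
    unfolding F_eq using ia[of r] by simp
  have pt: "ln (pmf p x) - ln (pmf r x) \<ge> l * indicator A x + 1 - pmf r x / pmf p x * F x"
    if "x \<in> set_pmf p" for x
  proof -
    have pos: "pmf p x > 0" "pmf r x > 0" using that supp by (auto intro: pmf_positive)
    have "ln (pmf r x / pmf p x * F x) \<le> pmf r x / pmf p x * F x - 1"
      by (intro ln_le_minus_one) (use pos in \<open>auto simp: F_def\<close>)
    moreover have "ln (pmf r x / pmf p x * F x) = ln (pmf r x) - ln (pmf p x) + l * indicator A x"
      using pos by (simp add: F_def ln_mult ln_div)
    ultimately show ?thesis by linarith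
  qed
  have "exp l \<le> 1 + l + l\<^sup>2"
  proof (cases "l \<ge> 0")
    case True then show ?thesis using exp_bound[of l] l1 by auto
  next
    case False
    have "exp l * (1 - l) \<le> exp l * exp (- l)" by (intro mult_left_mono) (use exp_ge_add_one_self[of "- l"] in auto)
    also have "\<dots> = 1" by (simp add: exp_minus)
    also have "\<dots> \<le> (1 + l + l\<^sup>2) * (1 - l)"
      using False mult_nonpos_nonneg[of l "l\<^sup>2"] by (simp add: algebra_simps power2_eq_square)
    finally show ?thesis using False by simp
  qed
  then have "(exp l - 1) * measure_pmf.prob r A \<le> (l + l\<^sup>2) * measure_pmf.prob r A"
    by (intro mult_right_mono) auto
  moreover have "l\<^sup>2 * measure_pmf.prob r A \<le> l\<^sup>2 * 1" by (intro mult_left_mono) auto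
  ultimately have "l\<^sup>2 \<le> l * measure_pmf.prob p A - (exp l - 1) * measure_pmf.prob r A"
    by (simp add: l_def field_simps power2_eq_square)
  also have "\<dots> \<le> l * measure_pmf.prob p A + 1 - measure_pmf.expectation p (\<lambda>x. pmf r x / pmf p x * F x)"
    using expectation_pmf_ratio[of F "exp 1" p r] F EF by simp
  also have "\<dots> = measure_pmf.expectation p (\<lambda>x. l * indicator A x + 1 - pmf r x / pmf p x * F x)"
    using ia[of p] integrable_pmf_ratio[of F "exp 1" p r] F by simp
  also have "\<dots> \<le> measure_pmf.expectation p (\<lambda>x. ln (pmf p x) - ln (pmf r x))"
    by (intro integral_mono_AE int)
      (use ia[of p] integrable_pmf_ratio[of F "exp 1" p r] F pt in \<open>auto simp: AE_measure_pmf_iff\<close>)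
  finally show ?thesis by (simp add: l_def power_divide)
qed

lemma integrable_ln_of_square:
  assumes "integrable (measure_pmf p) (\<lambda>x. (ln (pmf p x))\<^sup>2)"
  shows "integrable (measure_pmf p) (\<lambda>x. ln (pmf p x))"
proof (rule Bochner_Integration.integrable_bound)
  show "integrable (measure_pmf p) (\<lambda>x. 1 + (ln (pmf p x))\<^sup>2)" using assms by simp
  have "\<bar>y\<bar> \<le> 1 + y\<^sup>2" for y :: real
  proof (cases "\<bar>y\<bar> \<le> 1")
    case True then show ?thesis by (simp add: add_increasing2)
  next
    case False
    then have "\<bar>y\<bar> * 1 \<le> \<bar>y\<bar> * \<bar>y\<bar>" by (intro mult_left_mono) auto
    then show ?thesis by (simp add: power2_eq_square)
  qed
  then show "AE x in measure_pmf p. norm (ln (pmf p x)) \<le> norm (1 + (ln (pmf p x))\<^sup>2)" by simp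
qed simp

text \<open>Mass outside \<open>A\<close> could carry much entropy. The second moment of \<open>ln p\<close> controls it, through
  \<open>-y \<le> K + y\<^sup>2/K\<close>; on \<open>A\<close> the comparison with the uniform law gives \<open>ln (card A)\<close>.\<close>
lemma shannon_le_ln_card:
  assumes int: "integrable (measure_pmf p) (\<lambda>x. (ln (pmf p x))\<^sup>2)"
    and A: "finite A" "A \<noteq> {}" and K: "K > 0"
  shows "shannon p \<le> ln (card A) + 1 + K * measure_pmf.prob p (- A)
           + measure_pmf.expectation p (\<lambda>x. (ln (pmf p x))\<^sup>2) / K"
proof -
  have card: "card A \<ge> 1" using A by (simp add: Suc_le_eq card_gt_0_iff)
  have int1: "integrable (measure_pmf p) (\<lambda>x. - ln (pmf p x))"
    using integrable_ln_of_square[OF int] by simp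
  let ?u = "pmf_of_set A"
  have pt: "- ln (pmf p x) \<le> ln (card A) + pmf ?u x / pmf p x * 1 + K * indicator (- A) x + (ln (pmf p x))\<^sup>2 / K"
    if "x \<in> set_pmf p" for x
  proof (cases "x \<in> A")
    case True
    have pos: "pmf p x > 0" using that by (rule pmf_positive)
    have u: "pmf ?u x = 1 / card A" using True A by simp
    have "ln (pmf ?u x / pmf p x) \<le> pmf ?u x / pmf p x - 1"
      by (intro ln_le_minus_one) (use pos u card in simp)
    moreover have "ln (pmf ?u x / pmf p x) = - ln (card A) - ln (pmf p x)"
      using pos card by (simp add: u ln_div ln_mult)
    moreover have "(ln (pmf p x))\<^sup>2 / K \<ge> 0" using K by simp
    ultimately show ?thesis using True by simp
  next
    case False
    have "- y \<le> K + y\<^sup>2 / K" for y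
    proof -
      have "0 \<le> (K + y)\<^sup>2 + (K\<^sup>2 + y\<^sup>2)" by simp
      then have "- y * K \<le> K * K + y\<^sup>2" by (simp add: power2_eq_square algebra_simps)
      then show ?thesis using K by (simp add: field_simps)
    qed
    moreover have "0 \<le> ln (card A)" "0 \<le> pmf ?u x / pmf p x" using card by auto
    moreover have "pmf ?u x / pmf p x * 1 = pmf ?u x / pmf p x" "indicator (- A) x = (1::real)"
      using False by auto
    ultimately show ?thesis by (smt (verit) mult_cancel_left2)
  qed
  have ia: "integrable (measure_pmf p) (indicator (- A) :: _ \<Rightarrow> real)"
    by (intro measure_pmf.integrable_const_bound[where B = 1]) (auto simp: indicator_def)
  have ir: "integrable (measure_pmf p) (\<lambda>x. pmf ?u x / pmf p x * 1)"
    by (rule integrable_pmf_ratio[where B = 1]) auto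
  have "shannon p \<le> measure_pmf.expectation p
      (\<lambda>x. ln (card A) + pmf ?u x / pmf p x * 1 + K * indicator (- A) x + (ln (pmf p x))\<^sup>2 / K)"
    unfolding shannon_def by (intro integral_mono_AE int1)
      (use int ia ir pt in \<open>auto simp: AE_measure_pmf_iff\<close>)
  also have "\<dots> = ln (card A) + measure_pmf.expectation p (\<lambda>x. pmf ?u x / pmf p x * 1)
      + K * measure_pmf.prob p (- A) + measure_pmf.expectation p (\<lambda>x. (ln (pmf p x))\<^sup>2) / K"
    using int ia ir by simp
  also have "measure_pmf.expectation p (\<lambda>x. pmf ?u x / pmf p x * 1) \<le> 1"
    using expectation_pmf_ratio[of "\<lambda>_. 1" 1 p ?u] by simp
  finally show ?thesis by simp
qed

section \<open>Random walks on groups\<close>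

locale group_walk = group G for G (structure) +
  fixes \<mu> :: "'a pmf"
  assumes supp: "set_pmf \<mu> \<subseteq> carrier G"
begin

primrec walk :: "nat \<Rightarrow> 'a pmf" where
  "walk 0 = return_pmf \<one>"
| "walk (Suc n) = map_pmf (\<lambda>(s, w). s \<otimes> w) (pair_pmf \<mu> (walk n))"

lemma set_walk: "set_pmf (walk n) \<subseteq> carrier G"
  by (induction n) (use supp in auto)

lemma walk_add: "walk (m + n) = map_pmf (\<lambda>(v, w). v \<otimes> w) (pair_pmf (walk m) (walk n))"
proof (induction m)
  case 0
  have "map_pmf (\<lambda>(v, w). v \<otimes> w) (pair_pmf (walk 0) (walk n)) = map_pmf (\<lambda>w. w) (walk n)"
    unfolding walk.simps(1) pair_return_pmf1 map_pmf_comp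
    by (rule map_pmf_cong) (use set_walk[of n] in auto)
  then show ?case by simp
next
  case (Suc m)
  have 1: "pair_pmf \<mu> (map_pmf f p) = map_pmf (\<lambda>(s, z). (s, f z)) (pair_pmf \<mu> p)"
    for f :: "'z \<Rightarrow> 'a" and p
    by (simp add: pair_map_pmf2 apsnd_def map_prod_def)
  have 2: "pair_pmf (map_pmf f p) q = map_pmf (\<lambda>(z, s). (f z, s)) (pair_pmf p q)"
    for f :: "'z \<Rightarrow> 'a" and p and q :: "'a pmf"
    by (simp add: pair_map_pmf1 apfst_def map_prod_def)
  have "walk (Suc m + n) = map_pmf (\<lambda>(s, v, w). s \<otimes> (v \<otimes> w)) (pair_pmf \<mu> (pair_pmf (walk m) (walk n)))"
    unfolding add_Suc walk.simps(2)[of "m + n"] Suc 1 map_pmf_comp by (rule map_pmf_cong) auto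
  also have "\<dots> = map_pmf (\<lambda>(s, v, w). (s \<otimes> v) \<otimes> w) (pair_pmf \<mu> (pair_pmf (walk m) (walk n)))"
    by (rule map_pmf_cong) (use supp set_walk in \<open>auto simp: m_assoc subset_iff\<close>)
  also have "\<dots> = map_pmf (\<lambda>(v, w). v \<otimes> w) (pair_pmf (walk (Suc m)) (walk n))"
    unfolding walk.simps(2)[of m] 2 pair_pair_pmf map_pmf_comp by (rule map_pmf_cong) auto
  finally show ?case .
qed

lemma walk_1: "walk 1 = \<mu>"
proof -
  have "walk (Suc 0) = map_pmf (\<lambda>s. s) \<mu>"
    unfolding walk.simps pair_return_pmf2 map_pmf_comp by (rule map_pmf_cong) (use supp in auto)
  then show ?thesis by simp
qed

lemma walk_Suc_right: "walk (Suc n) = map_pmf (\<lambda>(w, s). w \<otimes> s) (pair_pmf (walk n) \<mu>)"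
  using walk_add[of n 1] walk_1 by simp

lemma prob_walk_Suc:
  "measure_pmf.prob (walk (Suc n)) A = measure_pmf.expectation \<mu> (\<lambda>s. measure_pmf.prob (walk n) {w. s \<otimes> w \<in> A})"
  by (simp add: prob_pair_pmf(1) vimage_def)

lemma pmf_walk_Suc_ge:
  "pmf \<mu> s * pmf (walk n) w \<le> pmf (walk (Suc n)) (s \<otimes> w)"
proof -
  have "pmf \<mu> s * pmf (walk n) w = measure_pmf.prob (pair_pmf \<mu> (walk n)) {(s, w)}"
    by (simp add: measure_pmf_single pmf_pair)
  also have "\<dots> \<le> measure_pmf.prob (pair_pmf \<mu> (walk n)) ((\<lambda>(s, w). s \<otimes> w) -` {s \<otimes> w})"
    by (intro measure_pmf.finite_measure_mono) auto
  finally show ?thesis by (simp add: pmf_map)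
qed

subsection \<open>Entropy of the walk\<close>

text \<open>The \<open>L\<^sup>2\<close>-norm of \<open>ln p\<close> grows at most linearly along the walk: \<open>p\<^bsub>n+1\<^esub>(sw) \<ge> \<mu>(s) p\<^sub>n(w)\<close> bounds the
  new logarithm by a sum of two old ones, and the triangle inequality is used in the squared form
  \<open>(x + y)\<^sup>2 \<le> (n + 1) x\<^sup>2 + (1 + 1/n) y\<^sup>2\<close>.\<close>
lemma ln_square_walk:
  assumes int: "integrable (measure_pmf \<mu>) (\<lambda>g. (ln (pmf \<mu> g))\<^sup>2)"
  defines "M \<equiv> measure_pmf.expectation \<mu> (\<lambda>g. (ln (pmf \<mu> g))\<^sup>2)"
  shows "integrable (measure_pmf (walk n)) (\<lambda>g. (ln (pmf (walk n) g))\<^sup>2)"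
    and "measure_pmf.expectation (walk n) (\<lambda>g. (ln (pmf (walk n) g))\<^sup>2) \<le> (real n)\<^sup>2 * M"
proof -
  let ?L = "\<lambda>p. \<integral>\<^sup>+g. ennreal ((ln (pmf p g))\<^sup>2) \<partial>measure_pmf p"
  have M0: "M \<ge> 0" by (simp add: M_def)
  have LM: "?L \<mu> = ennreal M" unfolding M_def by (rule nn_integral_eq_integral[OF int]) simp
  have bound: "?L (walk n) \<le> ennreal ((real n)\<^sup>2 * M)"
  proof (induction n)
    case 0 show ?case by simp
  next
    case (Suc n)
    \<comment> \<open>For \<open>n = 0\<close> the value \<open>b = 1\<close> from division by zero does no harm, since then \<open>ln p\<^sub>0(w) = 0\<close>.\<close>
    define a where "a = real n + 1"
    define b where "b = 1 + 1 / real n"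
    have pt: "(ln (pmf (walk (Suc n)) (s \<otimes> w)))\<^sup>2 \<le> a * (ln (pmf \<mu> s))\<^sup>2 + b * (ln (pmf (walk n) w))\<^sup>2"
      if "s \<in> set_pmf \<mu>" "w \<in> set_pmf (walk n)" for s w
    proof -
      let ?x = "ln (pmf \<mu> s)" and ?y = "ln (pmf (walk n) w)"
      have pos: "pmf \<mu> s > 0" "pmf (walk n) w > 0" using that by (auto intro: pmf_positive)
      then have "?x + ?y = ln (pmf \<mu> s * pmf (walk n) w)" by (simp add: ln_mult)
      also have "\<dots> \<le> ln (pmf (walk (Suc n)) (s \<otimes> w))"
        using pos pmf_walk_Suc_ge[of s n w] by (intro ln_mono) auto
      finally have "\<bar>ln (pmf (walk (Suc n)) (s \<otimes> w))\<bar> \<le> \<bar>?x + ?y\<bar>"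
        using ln_pmf_nonpos[of "walk (Suc n)" "s \<otimes> w"] by linarith
      then have "(ln (pmf (walk (Suc n)) (s \<otimes> w)))\<^sup>2 \<le> (?x + ?y)\<^sup>2" by (rule abs_le_square_iff[THEN iffD1])
      also have "\<dots> \<le> a * ?x\<^sup>2 + b * ?y\<^sup>2"
      proof (cases "n = 0")
        case True
        then have "w = \<one>" using that by simp
        then have "?y = 0" using True by simp
        then show ?thesis using True by (simp add: a_def)
      next
        case False
        have "0 \<le> (real n * ?x - ?y)\<^sup>2 / real n" by simp
        also have "\<dots> = a * ?x\<^sup>2 + b * ?y\<^sup>2 - (?x + ?y)\<^sup>2"
          using False by (simp add: a_def b_def field_simps power2_eq_square)
        finally show ?thesis by simp
      qed
      finally show ?thesis .
    qed
    have ab: "a \<ge> 0" "b \<ge> 0" by (auto simp: a_def b_def)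
    have "?L (walk (Suc n)) = (\<integral>\<^sup>+s. \<integral>\<^sup>+w. ennreal ((ln (pmf (walk (Suc n)) (s \<otimes> w)))\<^sup>2) \<partial>measure_pmf (walk n) \<partial>measure_pmf \<mu>)"
      by (simp only: walk.simps(2) nn_integral_map_pmf nn_integral_pair_pmf' case_prod_conv)
    also have "\<dots> \<le> (\<integral>\<^sup>+s. \<integral>\<^sup>+w. (ennreal a * ennreal ((ln (pmf \<mu> s))\<^sup>2) + ennreal b * ennreal ((ln (pmf (walk n) w))\<^sup>2))
        \<partial>measure_pmf (walk n) \<partial>measure_pmf \<mu>)"
      by (intro nn_integral_mono_AE AE_pmfI)
        (use pt ab in \<open>auto simp: ennreal_mult[symmetric] ennreal_plus[symmetric] simp del: ennreal_plus intro!: ennreal_leI\<close>)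
    also have "\<dots> = ennreal a * ?L \<mu> + ennreal b * ?L (walk n)"
      by (simp add: nn_integral_add nn_integral_cmult)
    also have "\<dots> \<le> ennreal a * ennreal M + ennreal b * ennreal ((real n)\<^sup>2 * M)"
      unfolding LM by (intro add_mono mult_left_mono Suc order_refl) auto
    also have "\<dots> = ennreal (a * M + b * ((real n)\<^sup>2 * M))"
      using ab M0 by (simp add: ennreal_mult[symmetric] ennreal_plus[symmetric] del: ennreal_plus)
    also have "a * M + b * ((real n)\<^sup>2 * M) = (real (Suc n))\<^sup>2 * M"
      by (cases "n = 0") (simp_all add: a_def b_def field_simps power2_eq_square)
    finally show ?case .
  qed
  show i: "integrable (measure_pmf (walk n)) (\<lambda>g. (ln (pmf (walk n) g))\<^sup>2)"
    by (intro integrableI_nonneg) (use bound in \<open>auto intro: le_less_trans\<close>)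
  show "measure_pmf.expectation (walk n) (\<lambda>g. (ln (pmf (walk n) g))\<^sup>2) \<le> (real n)\<^sup>2 * M"
    using bound M0 nn_integral_eq_integral[OF i] by (simp add: ennreal_le_iff)
qed

text \<open>\<open>H(W\<^bsub>n+1\<^esub>) - H(W\<^sub>n)\<close> is the mutual information between the first step \<open>s\<close> and \<open>W\<^bsub>n+1\<^esub>\<close>. It is the
  relative entropy of the joint law of \<open>(s, w)\<close>, where \<open>w\<close> is the rest of the walk, with respect to the
  law that draws \<open>s\<close> and \<open>z = W\<^bsub>n+1\<^esub>\<close> independently and sets \<open>w = s\<^sup>-\<^sup>1z\<close>. An event \<open>E\<close> on which the walk
  started with \<open>s\<^sub>0\<close> differs from the walk makes it positive.\<close>
lemma shannon_walk_increment:
  assumes int: "integrable (measure_pmf \<mu>) (\<lambda>g. (ln (pmf \<mu> g))\<^sup>2)"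
    and s0: "s0 \<in> set_pmf \<mu>"
  shows "shannon (walk (Suc n)) - shannon (walk n) \<ge>
    (pmf \<mu> s0 * (measure_pmf.prob (walk n) {w. s0 \<otimes> w \<in> E} - measure_pmf.prob (walk (Suc n)) E))\<^sup>2 / 4"
proof -
  let ?P = "pair_pmf \<mu> (walk n)"
  let ?f = "\<lambda>(s, z). (s, inv s \<otimes> z)"
  let ?R = "map_pmf ?f (pair_pmf \<mu> (walk (Suc n)))"
  have s0c: "s0 \<in> carrier G" using s0 supp by auto
  have inj: "inj_on ?f (set_pmf (pair_pmf \<mu> (walk (Suc n))))"
  proof (rule inj_onI)
    fix y z assume yz: "y \<in> set_pmf (pair_pmf \<mu> (walk (Suc n)))" "z \<in> set_pmf (pair_pmf \<mu> (walk (Suc n)))" "?f y = ?f z"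
    obtain s a where sa: "y = (s, a)" by (cases y)
    obtain t b where tb: "z = (t, b)" by (cases z)
    note st = sa tb
    have c: "s \<in> carrier G" "a \<in> carrier G" "b \<in> carrier G"
      using yz(1,2) supp set_walk[of "Suc n"] unfolding st set_pair_pmf by blast+
    have "s = t \<and> inv s \<otimes> a = inv t \<otimes> b" using yz(3) unfolding st prod.case prod.inject .
    then have "s = t" "a = b" using c by (metis Units_eq Units_l_cancel inv_closed)+
    then show "y = z" by (simp only: st)
  qed
  have R: "pmf ?R (s, w) = pmf \<mu> s * pmf (walk (Suc n)) (s \<otimes> w)"
    and Rin: "(s, w) \<in> set_pmf ?R" if "s \<in> set_pmf \<mu>" "w \<in> set_pmf (walk n)" for s w
  proof -
    have c: "s \<in> carrier G" "w \<in> carrier G" using that supp set_walk[of n] by auto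
    have m: "(s, s \<otimes> w) \<in> set_pmf (pair_pmf \<mu> (walk (Suc n)))" using that by auto
    have f: "?f (s, s \<otimes> w) = (s, w)" using c by (simp add: m_assoc[symmetric])
    show "pmf ?R (s, w) = pmf \<mu> s * pmf (walk (Suc n)) (s \<otimes> w)"
      using pmf_map_inj[OF inj m] f by (simp only: pmf_pair)
    show "(s, w) \<in> set_pmf ?R" unfolding set_map_pmf using m by (rule image_eqI[where f = ?f, OF f[symmetric]])
  qed
  have lnP: "ln (pmf ?P (s, w)) - ln (pmf ?R (s, w)) = ln (pmf (walk n) w) - ln (pmf (walk (Suc n)) (s \<otimes> w))"
    if "s \<in> set_pmf \<mu>" "w \<in> set_pmf (walk n)" for s w
  proof -
    have "pmf \<mu> s > 0" "pmf (walk n) w > 0" "pmf (walk (Suc n)) (s \<otimes> w) > 0"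
      using that by (auto intro!: pmf_positive)
    then show ?thesis by (simp add: R[OF that] pmf_pair ln_mult del: walk.simps)
  qed
  have i1: "integrable (measure_pmf ?P) (\<lambda>z. ln (pmf (walk n) (snd z)))"
    using integrable_map_pmf_eq[of snd ?P "\<lambda>w. ln (pmf (walk n) w)"]
      integrable_ln_of_square[OF ln_square_walk(1)[OF int, of n]] by (simp add: map_snd_pair_pmf)
  have i2: "integrable (measure_pmf ?P) (\<lambda>z. ln (pmf (walk (Suc n)) (fst z \<otimes> snd z)))"
    using integrable_map_pmf_eq[of "\<lambda>(s, w). s \<otimes> w" ?P "\<lambda>w. ln (pmf (walk (Suc n)) w)"]
      integrable_ln_of_square[OF ln_square_walk(1)[OF int, of "Suc n"]]
    by (simp add: case_prod_beta)
  have ae: "AE z in measure_pmf ?P. ln (pmf ?P z) - ln (pmf ?R z) = ln (pmf (walk n) (snd z)) - ln (pmf (walk (Suc n)) (fst z \<otimes> snd z))"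
    using lnP by (intro AE_pmfI) (force simp del: walk.simps)
  have e1: "measure_pmf.expectation ?P (\<lambda>z. ln (pmf (walk n) (snd z))) = - shannon (walk n)"
    using integral_map_pmf[of snd ?P "\<lambda>w. ln (pmf (walk n) w)"] by (simp add: map_snd_pair_pmf shannon_def)
  have e2: "measure_pmf.expectation ?P (\<lambda>z. ln (pmf (walk (Suc n)) (fst z \<otimes> snd z))) = - shannon (walk (Suc n))"
    using integral_map_pmf[of "\<lambda>(s, w). s \<otimes> w" ?P "\<lambda>w. ln (pmf (walk (Suc n)) w)"]
    by (simp add: shannon_def case_prod_beta)
  have "integrable (measure_pmf ?P) (\<lambda>z. ln (pmf ?P z) - ln (pmf ?R z))"
    using Bochner_Integration.integrable_diff[OF i1 i2] integrable_cong_AE[OF _ _ ae] by simp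
  then have "measure_pmf.expectation ?P (\<lambda>z. ln (pmf ?P z) - ln (pmf ?R z))
      \<ge> (measure_pmf.prob ?P A - measure_pmf.prob ?R A)\<^sup>2 / 4" for A
    by (rule relative_entropy_ge) (use Rin in auto)
  moreover have "measure_pmf.expectation ?P (\<lambda>z. ln (pmf ?P z) - ln (pmf ?R z)) = shannon (walk (Suc n)) - shannon (walk n)"
    using integral_cong_AE[OF _ _ ae] Bochner_Integration.integral_diff[OF i1 i2] e1 e2 by simp
  moreover have single: "measure_pmf.prob (pair_pmf \<mu> q) {z. fst z = s0 \<and> h z} = pmf \<mu> s0 * measure_pmf.prob q {w. h (s0, w)}"
    for q :: "'a pmf" and h
  proof -
    have "measure_pmf.prob (pair_pmf \<mu> q) {z. fst z = s0 \<and> h z}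
        = measure_pmf.expectation \<mu> (\<lambda>s. indicator {s0} s * measure_pmf.prob q {w. h (s0, w)})"
      unfolding prob_pair_pmf(1) by (intro integral_cong_AE AE_pmfI) (auto simp: indicator_def)
    then show ?thesis by (simp add: measure_pmf_single)
  qed
  define A where "A = {z. fst z = s0 \<and> s0 \<otimes> snd z \<in> E}"
  have "measure_pmf.prob ?P A = pmf \<mu> s0 * measure_pmf.prob (walk n) {w. s0 \<otimes> w \<in> E}"
    unfolding A_def by (simp add: single)
  moreover have "measure_pmf.prob ?R A = pmf \<mu> s0 * measure_pmf.prob (walk (Suc n)) E"
  proof -
    have "measure_pmf.prob ?R A = measure_pmf.prob (pair_pmf \<mu> (walk (Suc n))) {z. fst z = s0 \<and> s0 \<otimes> (inv s0 \<otimes> snd z) \<in> E}"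
      unfolding measure_map_pmf by (rule prob_cong_support) (auto simp: A_def)
    also have "\<dots> = pmf \<mu> s0 * measure_pmf.prob (walk (Suc n)) {w. s0 \<otimes> (inv s0 \<otimes> w) \<in> E}"
      by (simp only: single snd_conv)
    also have "measure_pmf.prob (walk (Suc n)) {w. s0 \<otimes> (inv s0 \<otimes> w) \<in> E} = measure_pmf.prob (walk (Suc n)) E"
    proof (rule prob_cong_support)
      fix x assume "x \<in> set_pmf (walk (Suc n))"
      then have "x \<in> carrier G" using set_walk by blast
      then have "s0 \<otimes> (inv s0 \<otimes> x) = x" using s0c by (simp add: m_assoc[symmetric])
      then show "x \<in> {w. s0 \<otimes> (inv s0 \<otimes> w) \<in> E} \<longleftrightarrow> x \<in> E" by simp
    qed
    finally show ?thesis .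
  qed
  ultimately show ?thesis by (metis (no_types, lifting) right_diff_distrib)
qed

end

section \<open>Stabilisation of a cocycle along the walk\<close>

lemma increments_limit:
  fixes a e :: "nat \<Rightarrow> real"
  assumes "summable e" "\<And>n. \<bar>a (Suc n) - a n\<bar> \<le> e n"
  shows "\<exists>l. \<forall>n. \<bar>l - a n\<bar> \<le> suminf e - sum e {..<n}"
proof -
  define d where "d n = a (Suc n) - a n" for n
  have sd: "summable d"
    by (rule summable_comparison_test[OF _ assms(1)]) (use assms(2) in \<open>auto simp: d_def\<close>)
  show ?thesis
  proof (intro exI allI)
    fix n
    have a: "a n = a 0 + sum d {..<n}" unfolding d_def by (simp add: sum_lessThan_telescope)
    have "\<bar>a 0 + suminf d - a n\<bar> = norm (suminf (\<lambda>k. d (k + n)))"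
      using suminf_split_initial_segment[OF sd, of n] a by simp
    also have "\<dots> \<le> suminf (\<lambda>k. e (k + n))"
      by (rule norm_suminf_le) (use assms in \<open>auto simp: d_def intro: summable_ignore_initial_segment\<close>)
    also have "\<dots> = suminf e - sum e {..<n}" using suminf_split_initial_segment[OF assms(1), of n] by simp
    finally show "\<bar>a 0 + suminf d - a n\<bar> \<le> suminf e - sum e {..<n}" .
  qed
qed

lemma has_sum_expectation:
  fixes F :: "'b \<Rightarrow> real"
  assumes "set_pmf p \<subseteq> C" "integrable (measure_pmf p) F"
  shows "((\<lambda>x. F x * pmf p x) has_sum measure_pmf.expectation p F) C"
proof -
  let ?f = "\<lambda>x. F x * pmf p x"
  define F' where "F' x = (if x \<in> C then F x else 0)" for x
  have "AE x in measure_pmf p. F x = F' x" using assms(1) by (intro AE_pmfI) (auto simp: F'_def)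
  then have "integrable (measure_pmf p) F'"
    using assms(2) by (rule integrable_cong_AE_imp[rotated 2]) simp
  then have "integrable (count_space UNIV) (\<lambda>x. pmf p x *\<^sub>R F' x)"
    unfolding measure_pmf_eq_density by (subst (asm) integrable_density) auto
  then have "integrable (count_space UNIV) (\<lambda>x. F' x * pmf p x)" by (simp add: mult.commute)
  moreover have F'f: "F' x * pmf p x = ?f x * indicator C x" for x by (simp add: F'_def)
  ultimately have abs: "Infinite_Set_Sum.abs_summable_on ?f C"
    unfolding Infinite_Set_Sum.abs_summable_on_altdef set_integrable_def by (simp add: mult.commute)
  have "measure_pmf.expectation p F = measure_pmf.expectation p F'"
    by (intro integral_cong_AE AE_pmfI) (use assms in \<open>auto simp: F'_def\<close>)
  also have "\<dots> = (\<integral>x. pmf p x *\<^sub>R F' x \<partial>count_space UNIV)"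
    unfolding measure_pmf_eq_density by (subst integral_density) auto
  also have "\<dots> = (\<integral>x. indicator C x *\<^sub>R ?f x \<partial>count_space UNIV)"
    by (intro Bochner_Integration.integral_cong) (auto simp: F'_def)
  also have "\<dots> = infsetsum ?f C" by (simp add: infsetsum_altdef set_lebesgue_integral_def)
  also have "\<dots> = infsum ?f C" by (rule infsetsum_infsum[OF abs])
  finally show ?thesis
    using abs abs_summable_equivalent[of ?f C] abs_summable_summable[of ?f C] by (simp add: has_sum_infsum)
qed

text \<open>Only the action on points and a two-valued cocycle over it enter the boundary argument, so it is
  stated for any group with such a pair; the action is from the right.\<close>
locale germ_walk = group_walk G \<mu> for G :: "('a, 'b) monoid_scheme" (structure) and \<mu> +
  fixes act :: "'a \<Rightarrow> 'x \<Rightarrow> 'x" and germ :: "'a \<Rightarrow> 'x \<Rightarrow> bool"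
  assumes act_one: "act \<one> x = x"
    and act_mult: "g \<in> carrier G \<Longrightarrow> h \<in> carrier G \<Longrightarrow> act (g \<otimes> h) x = act h (act g x)"
    and germ_mult: "g \<in> carrier G \<Longrightarrow> h \<in> carrier G \<Longrightarrow> germ (g \<otimes> h) x \<longleftrightarrow> germ g x \<noteq> germ h (act g x)"
begin

lemma germ_one: "\<not> germ \<one> x"
  using germ_mult[of \<one> \<one> x] by (auto simp: act_one)

lemma act_eq_iff:
  assumes "g \<in> carrier G" shows "act g x = y \<longleftrightarrow> x = act (inv g) y"
  using act_mult[of g "inv g" x] act_mult[of "inv g" g y] assms by (auto simp: act_one)

text \<open>Conditioned on all other steps, a single step of level \<open>n\<close> already spreads the product, because the
  factors before and after it act by bijections. So the only loss is the event that none of the \<open>N\<close> steps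
  has level \<open>n\<close>. The proof splits off the first step.\<close>
lemma walk_spread:
  assumes mix: "\<mu> = bind_pmf \<rho> \<nu>" and c: "c \<ge> 0"
    and spread: "\<And>x y. measure_pmf.prob (\<nu> n) {g. act g x = y} \<le> c"
  shows "measure_pmf.prob (walk N) {g. act g x = y} \<le> (1 - pmf \<rho> n) ^ N + c"
proof (induction N arbitrary: x)
  case 0 show ?case using c by (simp add: indicator_def)
next
  case (Suc N)
  define a where "a = (1 - pmf \<rho> n) ^ N + c"
  let ?P = "\<lambda>k. measure_pmf.prob (bind_pmf (\<nu> k) (\<lambda>s. map_pmf (\<lambda>w. s \<otimes> w) (walk N))) {g. act g x = y}"
  have sub: "set_pmf (\<nu> k) \<subseteq> carrier G" if "k \<in> set_pmf \<rho>" for k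
    using that supp unfolding mix by auto
  have any: "?P k \<le> a" if k: "k \<in> set_pmf \<rho>" for k
  proof -
    have "measure_pmf.prob (walk N) {w. act (s \<otimes> w) x = y} \<le> a" if s: "s \<in> set_pmf (\<nu> k)" for s
    proof -
      have "measure_pmf.prob (walk N) {w. act (s \<otimes> w) x = y} = measure_pmf.prob (walk N) {w. act w (act s x) = y}"
        by (rule prob_cong_support) (use s sub[OF k] set_walk[of N] in \<open>auto simp: act_mult subset_iff\<close>)
      then show ?thesis using Suc[of "act s x"] by (simp add: a_def)
    qed
    then show ?thesis unfolding prob_bind_pmf by (intro expectation_bounded_le) (auto simp: vimage_def)
  qed
  have step_n: "?P n \<le> c" if k: "n \<in> set_pmf \<rho>"
  proof -
    have "?P n = measure_pmf.prob (pair_pmf (\<nu> n) (walk N)) {(s, w). act (s \<otimes> w) x = y}"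
      unfolding prob_pair_pmf(1) prob_bind_pmf by (simp add: vimage_def)
    also have "\<dots> \<le> c" unfolding prob_pair_pmf(2)
    proof (intro expectation_bounded_le conjI)
      fix w assume "w \<in> set_pmf (walk N)"
      then have w: "w \<in> carrier G" using set_walk by blast
      have "measure_pmf.prob (\<nu> n) {s. act (s \<otimes> w) x = y} = measure_pmf.prob (\<nu> n) {s. act s x = act (inv w) y}"
        by (rule prob_cong_support)
          (use w sub[OF k] act_eq_iff[OF w] in \<open>auto simp: act_mult subset_iff\<close>)
      then show "measure_pmf.prob (\<nu> n) {s. (s, w) \<in> {(s, w). act (s \<otimes> w) x = y}} \<le> c"
        using spread by simp
    qed simp
    finally show ?thesis .
  qed
  have "walk (Suc N) = bind_pmf \<rho> (\<lambda>k. bind_pmf (\<nu> k) (\<lambda>s. map_pmf (\<lambda>w. s \<otimes> w) (walk N)))"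
  proof -
    have "walk (Suc N) = bind_pmf \<mu> (\<lambda>s. map_pmf (\<lambda>w. s \<otimes> w) (walk N))"
      by (simp add: pair_pmf_def map_pmf_def bind_assoc_pmf bind_return_pmf)
    moreover have "bind_pmf \<mu> F = bind_pmf \<rho> (\<lambda>k. bind_pmf (\<nu> k) F)" for F :: "'a \<Rightarrow> 'a pmf"
      by (simp only: mix bind_assoc_pmf)
    ultimately show ?thesis by simp
  qed
  then have "measure_pmf.prob (walk (Suc N)) {g. act g x = y} = measure_pmf.expectation \<rho> ?P"
    by (simp only: prob_bind_pmf[of \<rho>])
  also have "\<dots> \<le> measure_pmf.expectation \<rho> (\<lambda>k. a + (c - a) * indicator {n} k)"
  proof (intro integral_mono_AE AE_pmfI)
    show "integrable (measure_pmf \<rho>) ?P" by (intro measure_pmf.integrable_const_bound[where B = 1]) auto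
    show "integrable (measure_pmf \<rho>) (\<lambda>k. a + (c - a) * indicator {n} k)"
      by (intro measure_pmf.integrable_const_bound[where B = "\<bar>a\<bar> + \<bar>c - a\<bar>"]) (auto simp: indicator_def)
    show "?P k \<le> a + (c - a) * indicator {n} k" if "k \<in> set_pmf \<rho>" for k
      using any[OF that] step_n that by (cases "k = n") auto
  qed
  also have "\<dots> = a + (c - a) * pmf \<rho> n"
  proof -
    have "integrable (measure_pmf \<rho>) (indicator {n} :: _ \<Rightarrow> real)"
      by (intro measure_pmf.integrable_const_bound[where B = 1]) (auto simp: indicator_def)
    then show ?thesis by (simp add: measure_pmf_single)
  qed
  also have "\<dots> \<le> (1 - pmf \<rho> n) ^ Suc N + c" by (simp add: a_def algebra_simps)
  finally show ?case .
qed

text \<open>The probability that step \<open>N + 1\<close> alters the cocycle at the starting point \<open>x\<close>.\<close>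
definition change :: "nat \<Rightarrow> 'x \<Rightarrow> real" where
  "change N x = measure_pmf.prob (pair_pmf (walk N) \<mu>) {(v, s). germ s (act v x)}"

text \<open>A change requires the walk to hit one of the points where the step has non-trivial germ. The union
  bound \<open>t\<close> for this is weakened to \<open>t\<^sup>l\<close>, which is sound since a probability is also at most \<open>1\<close>. The
  exponent \<open>l < 1\<close> is what makes the number of germs integrable later.\<close>
lemma change_le:
  assumes p: "\<And>x y. measure_pmf.prob (walk N) {g. act g x = y} \<le> p" "p \<ge> 0"
    and l: "0 < l" "l \<le> 1"
    and fin: "\<And>s. s \<in> set_pmf \<mu> \<Longrightarrow> finite {x. germ s x}"
    and int: "integrable (measure_pmf \<mu>) (\<lambda>s. real (card {x. germ s x}) powr l)"
  shows "change N x \<le> p powr l * measure_pmf.expectation \<mu> (\<lambda>s. real (card {x. germ s x}) powr l)"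
proof -
  have "change N x = measure_pmf.expectation \<mu> (\<lambda>s. measure_pmf.prob (walk N) {v. germ s (act v x)})"
    unfolding change_def prob_pair_pmf(2) by simp
  also have "\<dots> \<le> measure_pmf.expectation \<mu> (\<lambda>s. p powr l * real (card {x. germ s x}) powr l)"
  proof (intro integral_mono_AE AE_pmfI)
    show "integrable (measure_pmf \<mu>) (\<lambda>s. measure_pmf.prob (walk N) {v. germ s (act v x)})"
      by (intro measure_pmf.integrable_const_bound[where B = 1]) auto
    show "integrable (measure_pmf \<mu>) (\<lambda>s. p powr l * real (card {x. germ s x}) powr l)" using int by simp
    fix s assume "s \<in> set_pmf \<mu>"
    define t where "t = p * real (card {x. germ s x})"
    have "measure_pmf.prob (walk N) {v. germ s (act v x)}
        = measure_pmf.prob (walk N) (\<Union>y\<in>{y. germ s y}. {v. act v x = y})"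
      by (rule prob_cong_support) auto
    also have "\<dots> \<le> (\<Sum>y\<in>{y. germ s y}. measure_pmf.prob (walk N) {v. act v x = y})"
      by (intro measure_pmf.finite_measure_subadditive_finite fin \<open>s \<in> set_pmf \<mu>\<close>) auto
    also have "\<dots> \<le> (\<Sum>y\<in>{y. germ s y}. p)" by (intro sum_mono p)
    also have "\<dots> = t" by (simp add: t_def)
    finally have le_t: "measure_pmf.prob (walk N) {v. germ s (act v x)} \<le> t" .
    have "t \<ge> 0" using p(2) by (simp add: t_def)
    have "measure_pmf.prob (walk N) {v. germ s (act v x)} \<le> t powr l"
    proof (cases "t \<ge> 1")
      case True
      then have "1 \<le> t powr l" using l by (simp add: ge_one_powr_ge_zero)
      then show ?thesis using measure_pmf.prob_le_1[of "walk N"] order_trans by blast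
    next
      case False
      show ?thesis
      proof (cases "t = 0")
        case False
        then have "t powr 1 \<le> t powr l" using \<open>\<not> t \<ge> 1\<close> \<open>t \<ge> 0\<close> l by (intro powr_mono') auto
        then show ?thesis using le_t \<open>t \<ge> 0\<close> by simp
      qed (use le_t in simp)
    qed
    also have "t powr l = p powr l * real (card {x. germ s x}) powr l"
      using p(2) by (simp add: t_def powr_mult)
    finally show "measure_pmf.prob (walk N) {v. germ s (act v x)} \<le> p powr l * real (card {x. germ s x}) powr l" .
  qed
  also have "\<dots> = p powr l * measure_pmf.expectation \<mu> (\<lambda>s. real (card {x. germ s x}) powr l)" by simp
  finally show ?thesis .
qed

definition germ_prob :: "'x \<Rightarrow> nat \<Rightarrow> 'a \<Rightarrow> real" where
  "germ_prob x N g = measure_pmf.prob (walk N) {w. germ (g \<otimes> w) x}"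

lemma germ_prob_bounds: "0 \<le> germ_prob x N g" "germ_prob x N g \<le> 1"
  by (simp_all add: germ_prob_def)

lemma germ_prob_step:
  assumes g: "g \<in> carrier G"
  shows "\<bar>germ_prob x (Suc N) g - germ_prob x N g\<bar> \<le> change N (act g x)"
proof -
  let ?Q = "pair_pmf (walk N) \<mu>"
  have 1: "germ_prob x (Suc N) g = measure_pmf.prob ?Q {z. germ (g \<otimes> (fst z \<otimes> snd z)) x}"
    unfolding germ_prob_def walk_Suc_right by (simp add: vimage_def case_prod_beta)
  have "germ_prob x N g = measure_pmf.prob (map_pmf fst ?Q) {w. germ (g \<otimes> w) x}"
    unfolding germ_prob_def map_fst_pair_pmf ..
  then have 2: "germ_prob x N g = measure_pmf.prob ?Q {z. germ (g \<otimes> fst z) x}" by (simp add: vimage_def)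
  have "\<bar>germ_prob x (Suc N) g - germ_prob x N g\<bar> \<le> measure_pmf.prob ?Q
      {z. z \<in> {z. germ (g \<otimes> (fst z \<otimes> snd z)) x} \<longleftrightarrow> z \<notin> {z. germ (g \<otimes> fst z) x}}"
    unfolding 1 2 by (rule prob_diff_le)
  also have "\<dots> \<le> change N (act g x)" unfolding change_def
  proof (rule prob_mono_support)
    fix z assume z: "z \<in> set_pmf ?Q"
      "z \<in> {z. z \<in> {z. germ (g \<otimes> (fst z \<otimes> snd z)) x} \<longleftrightarrow> z \<notin> {z. germ (g \<otimes> fst z) x}}"
    obtain v s where vs: "z = (v, s)" by (cases z)
    have c: "v \<in> carrier G" "s \<in> carrier G" using z(1) set_walk supp by (auto simp: vs)
    have "germ (g \<otimes> (v \<otimes> s)) x \<longleftrightarrow> germ (g \<otimes> v) x \<noteq> germ s (act v (act g x))"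
      using germ_mult[of "g \<otimes> v" s x] g c by (simp add: m_assoc act_mult)
    then show "z \<in> {(v, s). germ s (act v (act g x))}" using z(2) by (auto simp: vs)
  qed
  finally show ?thesis .
qed

lemma germ_prob_first_step:
  assumes g: "g \<in> carrier G"
  shows "germ_prob x (Suc N) g = measure_pmf.expectation \<mu> (\<lambda>s. germ_prob x N (g \<otimes> s))"
  unfolding germ_prob_def prob_walk_Suc mem_Collect_eq
proof (intro integral_cong_AE AE_pmfI)
  fix s assume "s \<in> set_pmf \<mu>"
  then show "measure_pmf.prob (walk N) {w. germ (g \<otimes> (s \<otimes> w)) x} = measure_pmf.prob (walk N) {w. germ (g \<otimes> s \<otimes> w) x}"
    using g supp set_walk[of N] by (intro prob_cong_support) (auto simp: m_assoc subset_iff)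
qed auto

text \<open>Restarting the walk at time \<open>N\<close>, the cocycle differs from its value at time \<open>N\<close> only if one of the
  next \<open>M\<close> steps changes it.\<close>
lemma change_from_walk:
  "measure_pmf.prob (pair_pmf (walk N) (walk M)) {(v, w). germ w (act v x)} \<le> (\<Sum>k<M. change (N + k) x)"
proof (induction M)
  case 0
  have "measure_pmf.prob (pair_pmf (walk N) (walk 0)) {(v, w). germ w (act v x)} = measure_pmf.prob (pair_pmf (walk N) (walk 0)) {}"
    by (rule prob_cong_support) (auto simp: germ_one)
  then show ?case by simp
next
  case (Suc M)
  let ?Q = "pair_pmf (walk N) (pair_pmf (walk M) \<mu>)"
  have "pair_pmf (walk N) (walk (Suc M)) = map_pmf (\<lambda>(v, w, s). (v, w \<otimes> s)) ?Q"
    unfolding walk_Suc_right pair_map_pmf2 by (rule map_pmf_cong) auto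
  then have "measure_pmf.prob (pair_pmf (walk N) (walk (Suc M))) {(v, w). germ w (act v x)}
      = measure_pmf.prob ?Q {(v, w, s). germ (w \<otimes> s) (act v x)}"
    by (simp only: measure_map_pmf) (rule prob_cong_support, auto)
  also have "\<dots> \<le> measure_pmf.prob ?Q ({(v, w, s). germ w (act v x)} \<union> {(v, w, s). germ s (act (v \<otimes> w) x)})"
  proof (rule prob_mono_support)
    fix z assume z: "z \<in> set_pmf ?Q" "z \<in> {(v, w, s). germ (w \<otimes> s) (act v x)}"
    obtain v w s where vs: "z = (v, w, s)" by (cases z)
    have c: "v \<in> carrier G" "w \<in> carrier G" "s \<in> carrier G" using z(1) set_walk supp by (auto simp: vs)
    show "z \<in> {(v, w, s). germ w (act v x)} \<union> {(v, w, s). germ s (act (v \<otimes> w) x)}"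
      using z(2) c by (auto simp: vs germ_mult act_mult)
  qed
  also have "\<dots> \<le> measure_pmf.prob ?Q {(v, w, s). germ w (act v x)} + measure_pmf.prob ?Q {(v, w, s). germ s (act (v \<otimes> w) x)}"
    by (rule measure_subadditive) auto
  also have "measure_pmf.prob ?Q {(v, w, s). germ w (act v x)} = measure_pmf.prob (pair_pmf (walk N) (walk M)) {(v, w). germ w (act v x)}"
  proof -
    have "pair_pmf (walk N) (walk M) = map_pmf (\<lambda>(v, w, s). (v, w)) ?Q"
    proof -
      have "pair_pmf (walk N) (walk M) = pair_pmf (walk N) (map_pmf fst (pair_pmf (walk M) \<mu>))"
        by (simp only: map_fst_pair_pmf)
      then show ?thesis unfolding pair_map_pmf2 by (simp add: apsnd_def map_prod_def case_prod_beta')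
    qed
    then show ?thesis by (simp only: measure_map_pmf) (rule prob_cong_support, auto)
  qed
  also have "measure_pmf.prob ?Q {(v, w, s). germ s (act (v \<otimes> w) x)} = change (N + M) x"
  proof -
    have "pair_pmf (walk (N + M)) \<mu> = map_pmf (\<lambda>(v, w, s). (v \<otimes> w, s)) ?Q"
      unfolding walk_add pair_map_pmf1 pair_pair_pmf map_pmf_comp by (rule map_pmf_cong) auto
    then show ?thesis unfolding change_def by (simp only: measure_map_pmf) (rule prob_cong_support, auto)
  qed
  finally show ?case using Suc by simp
qed

text \<open>The limit \<open>f\<close> exists uniformly and is harmonic because the walk may be decomposed at its first step.
  If it were constant, \<open>b\<close> would force the value \<open>1/2\<close>. But averaged over \<open>v = W\<^sub>N\<close>, the value \<open>f(v)\<close>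
  differs little from the indicator of an odd germ of \<open>v\<close>, as few changes are left after a late time \<open>N\<close>.\<close>
theorem germ_limit:
  assumes e: "summable e" "\<And>N x. change N x \<le> e N"
    and b: "b \<in> carrier G" "act b x = x" "germ b x"
  shows "\<exists>f. (\<forall>g\<in>carrier G. (\<lambda>N. germ_prob x N g) \<longlonglongrightarrow> f g) \<and> bounded (f ` carrier G)
    \<and> harmonic G \<mu> f \<and> \<not> f constant_on carrier G"
proof -
  define r where "r N = suminf e - sum e {..<N}" for N
  have r0: "r \<longlonglongrightarrow> 0"
    unfolding r_def using tendsto_diff[OF tendsto_const[of "suminf e"] summable_LIMSEQ[OF e(1)]] by simp
  have e0: "0 \<le> e N" for N
    using e(2)[of N x] by (rule order_trans[rotated]) (simp add: change_def)
  have "\<exists>l. \<forall>N. \<bar>l - germ_prob x N g\<bar> \<le> r N" if "g \<in> carrier G" for g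
    unfolding r_def using order_trans[OF germ_prob_step[OF that] e(2)] by (intro increments_limit e(1))
  then obtain f where f: "\<And>g N. g \<in> carrier G \<Longrightarrow> \<bar>f g - germ_prob x N g\<bar> \<le> r N" by metis
  have lim: "(\<lambda>N. germ_prob x N g) \<longlonglongrightarrow> f g" if "g \<in> carrier G" for g
  proof (rule LIM_zero_cancel, rule Lim_null_comparison[OF _ r0], rule always_eventually, rule allI)
    show "norm (germ_prob x N g - f g) \<le> r N" for N using f[OF that, of N] by (simp add: abs_minus_commute)
  qed
  have f01: "0 \<le> f g \<and> f g \<le> 1" if "g \<in> carrier G" for g
    using lim[OF that] germ_prob_bounds[of x _ g]
    by (meson LIMSEQ_le_const LIMSEQ_le_const2)
  have bdd: "bounded (f ` carrier G)"
    unfolding bounded_iff using f01 by (intro exI[of _ 1]) auto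
  have harm: "measure_pmf.expectation \<mu> (\<lambda>s. f (g \<otimes> s)) = f g" if g: "g \<in> carrier G" for g
  proof -
    have int: "integrable (measure_pmf \<mu>) (\<lambda>s. f (g \<otimes> s))"
      by (intro measure_pmf.integrable_const_bound[where B = 1] AE_pmfI) (use f01 g supp in \<open>auto simp: subset_iff\<close>)
    have inth: "integrable (measure_pmf \<mu>) (\<lambda>s. germ_prob x N (g \<otimes> s))" for N
      by (intro measure_pmf.integrable_const_bound[where B = 1] AE_pmfI) (auto simp: germ_prob_bounds)
    have "\<bar>measure_pmf.expectation \<mu> (\<lambda>s. f (g \<otimes> s)) - germ_prob x (Suc N) g\<bar> \<le> r N" for N
    proof -
      have "measure_pmf.expectation \<mu> (\<lambda>s. f (g \<otimes> s)) - germ_prob x (Suc N) g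
          = measure_pmf.expectation \<mu> (\<lambda>s. f (g \<otimes> s) - germ_prob x N (g \<otimes> s))"
        using germ_prob_first_step[OF g] int inth by simp
      also have "\<bar>\<dots>\<bar> \<le> measure_pmf.expectation \<mu> (\<lambda>s. \<bar>f (g \<otimes> s) - germ_prob x N (g \<otimes> s)\<bar>)"
        using integral_norm_bound[of "measure_pmf \<mu>" "\<lambda>s. f (g \<otimes> s) - germ_prob x N (g \<otimes> s)"] by simp
      also have "\<dots> \<le> r N"
        by (intro expectation_bounded_le) (use f g supp in \<open>auto simp: subset_iff\<close>)
      finally show ?thesis .
    qed
    then have "(\<lambda>N. germ_prob x (Suc N) g) \<longlonglongrightarrow> measure_pmf.expectation \<mu> (\<lambda>s. f (g \<otimes> s))"
      by (intro LIM_zero_cancel[OF Lim_null_comparison[OF _ r0]] always_eventually) (auto simp: abs_minus_commute)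
    moreover have "(\<lambda>N. germ_prob x (Suc N) g) \<longlonglongrightarrow> f g" using lim[OF g] by (rule LIMSEQ_Suc)
    ultimately show ?thesis by (rule LIMSEQ_unique)
  qed
  have "harmonic G \<mu> f"
    unfolding harmonic_def
  proof
    fix g assume g: "g \<in> carrier G"
    have "integrable (measure_pmf \<mu>) (\<lambda>s. f (g \<otimes> s))"
      by (intro measure_pmf.integrable_const_bound[where B = 1] AE_pmfI) (use f01 g supp in \<open>auto simp: subset_iff\<close>)
    from has_sum_expectation[OF supp this]
    show "((\<lambda>y. f (g \<otimes> y) * pmf \<mu> y) has_sum f g) (carrier G)" using harm[OF g] by simp
  qed
  moreover have "\<not> f constant_on carrier G"
  proof
    assume "f constant_on carrier G"
    then obtain c where c: "\<And>g. g \<in> carrier G \<Longrightarrow> f g = c" by (auto simp: constant_on_def)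
    have "germ_prob x N b = 1 - germ_prob x N \<one>" for N
    proof -
      have "germ_prob x N b = measure_pmf.prob (walk N) (- {w. germ (\<one> \<otimes> w) x})"
        unfolding germ_prob_def
        by (rule prob_cong_support) (use b set_walk[of N] in \<open>auto simp: germ_mult subset_iff\<close>)
      then show ?thesis unfolding germ_prob_def using measure_pmf.prob_compl[of "{w. germ (\<one> \<otimes> w) x}" "walk N"]
        by (simp add: Compl_eq_Diff_UNIV)
    qed
    then have "(\<lambda>N. 1 - germ_prob x N \<one>) \<longlonglongrightarrow> c" using lim[OF b(1)] c[OF b(1)] by simp
    moreover have "(\<lambda>N. 1 - germ_prob x N \<one>) \<longlonglongrightarrow> 1 - c"
      using lim[OF one_closed] c[OF one_closed] by (intro tendsto_intros) simp
    ultimately have "c = 1 - c" by (rule LIMSEQ_unique)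
    then have half: "c = 1 / 2" by simp
    \<comment> \<open>The same late time serves as starting time and as running time.\<close>
  obtain N where N: "r N < 1 / 4"
      using order_tendstoD(2)[OF r0, of "1 / 4"] by (auto simp: eventually_sequentially)
    have "1 / 2 - r N \<le> measure_pmf.prob (pair_pmf (walk N) (walk N)) {(v, w). germ w (act v x)}"
    proof -
      have "1 / 2 - r N \<le> measure_pmf.prob (walk N) {w. germ w (act v x)}" if "v \<in> set_pmf (walk N)" for v
      proof -
        have v: "v \<in> carrier G" using that set_walk by blast
        have "measure_pmf.prob (walk N) {w. germ w (act v x)} =
          (if germ v x then 1 - germ_prob x N v else germ_prob x N v)"
        proof (cases "germ v x")
          case True
          have "measure_pmf.prob (walk N) {w. germ w (act v x)} = measure_pmf.prob (walk N) (- {w. germ (v \<otimes> w) x})"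
            by (rule prob_cong_support) (use v True set_walk[of N] in \<open>auto simp: germ_mult subset_iff\<close>)
          then show ?thesis using True measure_pmf.prob_compl[of "{w. germ (v \<otimes> w) x}" "walk N"]
            by (simp add: germ_prob_def Compl_eq_Diff_UNIV)
        next
          case False
          then show ?thesis unfolding germ_prob_def
            by simp (rule prob_cong_support, use v False set_walk[of N] in \<open>auto simp: germ_mult subset_iff\<close>)
        qed
        then show ?thesis using f[OF v, of N] c[OF v] half by (auto simp: abs_le_iff split: if_splits)
      qed
      note v_ge = this
      have "measure_pmf.expectation (walk N) (\<lambda>v. 1 - measure_pmf.prob (walk N) {w. germ w (act v x)}) \<le> 1 - (1 / 2 - r N)"
      proof (intro expectation_bounded_le conjI)
        fix v assume "v \<in> set_pmf (walk N)"
        from v_ge[OF this] show "1 - measure_pmf.prob (walk N) {w. germ w (act v x)} \<le> 1 - (1 / 2 - r N)"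
          by linarith
      qed simp
      moreover have "integrable (measure_pmf (walk N)) (\<lambda>v. measure_pmf.prob (walk N) {w. germ w (act v x)})"
        by (intro measure_pmf.integrable_const_bound[where B = 1]) auto
      ultimately show ?thesis unfolding prob_pair_pmf(1) by simp
    qed
    also have "\<dots> \<le> (\<Sum>k<N. change (N + k) x)" by (rule change_from_walk)
    also have "\<dots> \<le> (\<Sum>k<N. e (k + N))" by (intro sum_mono) (simp add: e(2) add.commute)
    also have "\<dots> \<le> suminf (\<lambda>k. e (k + N))"
      by (rule sum_le_suminf) (use e(1) e0 in \<open>auto intro: summable_ignore_initial_segment\<close>)
    also have "\<dots> = r N" using suminf_split_initial_segment[OF e(1), of N] by (simp add: r_def)
    finally show False using N by simp
  qed
  ultimately show ?thesis using lim bdd by blast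
qed

text \<open>A non-constant limit has \<open>f(gs) \<noteq> f(g)\<close> for some \<open>g\<close> and some increment \<open>s\<close>, since the increments
  generate the group. The event that \<open>gz\<close> has an odd germ then separates \<open>sW\<^sub>N\<close> from \<open>W\<^bsub>N+1\<^esub>\<close> for all
  large \<open>N\<close>, the entropy grows linearly, and a set that carries almost all the mass of \<open>W\<^sub>N\<close> must be
  exponentially large.\<close>
theorem exponential_support:
  assumes int: "integrable (measure_pmf \<mu>) (\<lambda>g. (ln (pmf \<mu> g))\<^sup>2)"
    and gen: "nondegenerate G \<mu>"
    and lim: "\<And>g. g \<in> carrier G \<Longrightarrow> (\<lambda>N. germ_prob x N g) \<longlonglongrightarrow> f g"
    and nonconst: "\<not> f constant_on carrier G"
  shows "\<exists>\<eta>>0. \<exists>c>0. \<exists>C. \<forall>N A. finite A \<longrightarrow> A \<noteq> {} \<longrightarrow> measure_pmf.prob (walk N) (- A) \<le> \<eta>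
    \<longrightarrow> ln (card A) \<ge> c * real N - C"
proof -
  have "\<exists>g\<in>carrier G. \<exists>s\<in>set_pmf \<mu>. f (g \<otimes> s) \<noteq> f g"
  proof (rule ccontr)
    assume *: "\<not> (\<exists>g\<in>carrier G. \<exists>s\<in>set_pmf \<mu>. f (g \<otimes> s) \<noteq> f g)"
    have "y \<in> carrier G \<and> (\<forall>g\<in>carrier G. f (g \<otimes> y) = f g)" if "y \<in> semigroup_generated G (set_pmf \<mu>)" for y
      using that
    proof induction
      case (1 y) then show ?case using * supp by blast
    next
      case (2 y z) then show ?case by (auto simp: m_assoc[symmetric])
    qed
    then have inv: "f (\<one> \<otimes> y) = f \<one>" if "y \<in> carrier G" for y
      using that gen one_closed unfolding nondegenerate_def by blast
    have "f y = f \<one>" if "y \<in> carrier G" for y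
      using inv[OF that] that by simp
    then show False using nonconst unfolding constant_on_def by blast
  qed
  then obtain g s where gs: "g \<in> carrier G" "s \<in> set_pmf \<mu>" "f (g \<otimes> s) \<noteq> f g" by blast
  have s: "s \<in> carrier G" using gs supp by auto
  have ms: "pmf \<mu> s > 0" using gs(2) by (rule pmf_positive)
  define inc where "inc N = (pmf \<mu> s * (germ_prob x N (g \<otimes> s) - germ_prob x (Suc N) g))\<^sup>2 / 4" for N
  have inc: "shannon (walk (Suc N)) - shannon (walk N) \<ge> inc N" for N
  proof -
    have "measure_pmf.prob (walk N) {w. s \<otimes> w \<in> {z. germ (g \<otimes> z) x}} = germ_prob x N (g \<otimes> s)"
      unfolding germ_prob_def
      by (rule prob_cong_support) (use gs(1) s set_walk[of N] in \<open>auto simp: m_assoc subset_iff\<close>)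
    then show ?thesis
      using shannon_walk_increment[OF int gs(2), of N "{z. germ (g \<otimes> z) x}"] by (simp add: inc_def germ_prob_def)
  qed
  define h where "h = (pmf \<mu> s * (f (g \<otimes> s) - f g))\<^sup>2 / 8"
  have h: "h > 0" using ms gs(3) by (simp add: h_def)
  have "inc \<longlonglongrightarrow> (pmf \<mu> s * (f (g \<otimes> s) - f g))\<^sup>2 / 4"
    unfolding inc_def using gs(1) s by (intro tendsto_intros lim LIMSEQ_Suc) auto
  then have "\<forall>\<^sub>F N in sequentially. inc N > h"
    by (rule order_tendstoD) (use h in \<open>simp add: h_def\<close>)
  then obtain N0 where N0: "\<And>N. N \<ge> N0 \<Longrightarrow> inc N \<ge> h"
    unfolding eventually_sequentially by (meson less_imp_le)
  have nonneg: "shannon p \<ge> 0" for p :: "'a pmf"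
    unfolding shannon_def by (intro integral_nonneg_AE) (use ln_pmf_nonpos[of p] in auto)
  have lower: "shannon (walk N) \<ge> h * (real N - real N0)" for N
  proof (cases "N \<ge> N0")
    case True
    have "shannon (walk (N0 + k)) \<ge> h * real k" for k
    proof (induction k)
      case (Suc k)
      then show ?case using inc[of "N0 + k"] N0[of "N0 + k"] by (simp add: algebra_simps del: walk.simps)
    qed (use nonneg in simp)
    from this[of "N - N0"] show ?thesis using True by (simp add: of_nat_diff)
  next
    case False
    then have "h * (real N - real N0) \<le> 0" using h by (intro mult_nonneg_nonpos) auto
    then show ?thesis using nonneg[of "walk N"] by linarith
  qed
  define M where "M = measure_pmf.expectation \<mu> (\<lambda>g. (ln (pmf \<mu> g))\<^sup>2)"
  have M0: "M \<ge> 0" by (simp add: M_def)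
  \<comment> \<open>Truncation at \<open>T\<close> per step, and an exit probability \<open>\<eta>\<close>, each cost a quarter of the rate \<open>h\<close>.\<close>
  define T where "T = 4 * M / h + 1"
  have T: "T > 0" "M / T \<le> h / 4"
  proof -
    have "4 * M / h \<ge> 0" using M0 h by simp
    then show "T > 0" by (simp add: T_def)
    have "M * 4 \<le> h * T" using h by (simp add: T_def field_simps)
    then show "M / T \<le> h / 4" using \<open>T > 0\<close> by (simp add: field_simps)
  qed
  define \<eta> where "\<eta> = h / (4 * T)"
  have eta: "\<eta> > 0" using h T by (simp add: \<eta>_def)
  have main: "ln (card A) \<ge> h / 2 * real N - (h * real N0 + 1)"
    if A: "finite A" "A \<noteq> {}" "measure_pmf.prob (walk N) (- A) \<le> \<eta>" for N A
  proof (cases "N = 0")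
    case True
    have "card A \<ge> 1" using A by (simp add: Suc_le_eq card_gt_0_iff)
    then have "ln (card A) \<ge> 0" by simp
    moreover have "h * real N0 \<ge> 0" using h by simp
    ultimately show ?thesis using True by simp
  next
    case False
    have K: "T * real N > 0" using T False by simp
    have "shannon (walk N) \<le> ln (card A) + 1 + T * real N * measure_pmf.prob (walk N) (- A)
        + measure_pmf.expectation (walk N) (\<lambda>x. (ln (pmf (walk N) x))\<^sup>2) / (T * real N)"
      by (rule shannon_le_ln_card[OF ln_square_walk(1)[OF int] A(1,2) K])
    also have "T * real N * measure_pmf.prob (walk N) (- A) \<le> T * real N * \<eta>"
      using A(3) K by (intro mult_left_mono) auto
    also have "T * real N * \<eta> = h / 4 * real N" using T by (simp add: \<eta>_def)
    also have "measure_pmf.expectation (walk N) (\<lambda>x. (ln (pmf (walk N) x))\<^sup>2) / (T * real N)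
        \<le> (real N)\<^sup>2 * M / (T * real N)"
      unfolding M_def by (intro divide_right_mono ln_square_walk(2)[OF int]) (use K in simp)
    also have "(real N)\<^sup>2 * M / (T * real N) = M / T * real N" using False by (simp add: power2_eq_square)
    also have "M / T * real N \<le> h / 4 * real N" using T(2) by (intro mult_right_mono) auto
    finally show ?thesis using lower[of N] by (simp add: algebra_simps)
  qed
  have "\<exists>C. \<forall>N A. finite A \<longrightarrow> A \<noteq> {} \<longrightarrow> measure_pmf.prob (walk N) (- A) \<le> \<eta>
    \<longrightarrow> ln (card A) \<ge> h / 2 * real N - C" using main by (intro exI[of _ "h * real N0 + 1"] allI impI)
  with h have "h / 2 > 0 \<and> (\<exists>C. \<forall>N A. finite A \<longrightarrow> A \<noteq> {} \<longrightarrow> measure_pmf.prob (walk N) (- A) \<le> \<eta>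
    \<longrightarrow> ln (card A) \<ge> h / 2 * real N - C)" by (intro conjI) (simp, assumption)
  then have "\<exists>c>0. \<exists>C. \<forall>N A. finite A \<longrightarrow> A \<noteq> {} \<longrightarrow> measure_pmf.prob (walk N) (- A) \<le> \<eta>
    \<longrightarrow> ln (card A) \<ge> c * real N - C" by (rule exI)
  with eta have "\<eta> > 0 \<and> (\<exists>c>0. \<exists>C. \<forall>N A. finite A \<longrightarrow> A \<noteq> {} \<longrightarrow> measure_pmf.prob (walk N) (- A) \<le> \<eta>
    \<longrightarrow> ln (card A) \<ge> c * real N - C)" by (rule conjI)
  then show ?thesis by (rule exI)
qed

end

section \<open>Words in the generators\<close>

text \<open>Written from left to right, as the group acts from the right: the head of the list acts first.\<close>
definition word_prod :: "(vertex \<Rightarrow> vertex) list \<Rightarrow> vertex \<Rightarrow> vertex" where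
  "word_prod ws = foldr (\<lambda>g h. h \<circ> g) ws id"

lemma word_prod_simps [simp]: "word_prod [] = id" "word_prod (g # ws) = word_prod ws \<circ> g"
  by (simp_all add: word_prod_def)

lemma word_prod_append [simp]: "word_prod (us @ vs) = word_prod vs \<circ> word_prod us"
  by (induction us) (auto simp: comp_assoc)

lemma mult_grigorchuk [simp]: "g \<otimes>\<^bsub>grigorchuk \<omega>\<^esub> h = h \<circ> g"
  and one_grigorchuk [simp]: "\<one>\<^bsub>grigorchuk \<omega>\<^esub> = id"
  by (simp_all add: grigorchuk_def subgroup_generated_def tree_Aut_def)

lemma foldr_grigorchuk: "foldr (\<otimes>\<^bsub>grigorchuk \<omega>\<^esub>) ws \<one>\<^bsub>grigorchuk \<omega>\<^esub> = word_prod ws"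
  by (induction ws) auto

lemma spinal_involution [simp]: "spinal x \<omega> (spinal x \<omega> w) = w"
  by (induction x \<omega> w rule: spinal.induct) (auto simp: letter_hom_def)

lemma gen_involution: "s \<in> grig_gens \<omega> \<Longrightarrow> s \<circ> s = id"
  by (auto simp: grig_gens_def fun_eq_iff)

lemma gens_in_grigorchuk: "grig_gens \<omega> \<subseteq> carrier (grigorchuk \<omega>)"
  by (auto simp: carrier_grigorchuk intro: generate.incl)

lemma inv_gen: "s \<in> grig_gens \<omega> \<Longrightarrow> m_inv (grigorchuk \<omega>) s = s"
  using gens_in_grigorchuk gen_involution group_grigorchuk
  by (metis group.inv_equality mult_grigorchuk one_grigorchuk subsetD)

lemma inv_gens: "grig_gens \<omega> \<union> m_inv (grigorchuk \<omega>) ` grig_gens \<omega> = grig_gens \<omega>"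
  by (auto simp: inv_gen)

lemma word_prod_in_grigorchuk:
  assumes "set ws \<subseteq> grig_gens \<omega>" shows "word_prod ws \<in> carrier (grigorchuk \<omega>)"
  using assms
proof (induction ws)
  case Nil
  show ?case using group.is_monoid[OF group_grigorchuk, THEN monoid.one_closed]
    by (metis one_grigorchuk word_prod_simps(1))
next
  case (Cons g ws)
  then have "g \<otimes>\<^bsub>grigorchuk \<omega>\<^esub> word_prod ws \<in> carrier (grigorchuk \<omega>)"
    using gens_in_grigorchuk group.is_monoid[OF group_grigorchuk]
    by (intro monoid.m_closed) auto
  then show ?case by (simp only: mult_grigorchuk word_prod_simps)
qed

text \<open>The generators are involutions, so inverses are words as well.\<close>
lemma grigorchuk_word:
  assumes "g \<in> carrier (grigorchuk \<omega>)"
  shows "\<exists>ws. set ws \<subseteq> grig_gens \<omega> \<and> word_prod ws = g"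
proof -
  have "g \<in> generate tree_Aut (grig_gens \<omega>)" using assms by (simp add: carrier_grigorchuk)
  then show ?thesis
  proof induction
    case one
    show ?case by (rule exI[of _ "[]"]) (simp add: tree_Aut_def)
  next
    case (incl h)
    then show ?case by (intro exI[of _ "[h]"]) simp
  next
    case (inv h)
    have "h \<otimes>\<^bsub>tree_Aut\<^esub> h = \<one>\<^bsub>tree_Aut\<^esub>" "h \<in> carrier tree_Aut"
      using gen_involution[OF inv] grig_gens_subset inv by (auto simp: tree_Aut_def)
    then have "inv\<^bsub>tree_Aut\<^esub> h = h" using group.inv_equality[OF group_tree_Aut] by metis
    then show ?case using inv by (intro exI[of _ "[h]"]) simp
  next
    case (eng g h)
    then obtain us vs where "set us \<subseteq> grig_gens \<omega>" "word_prod us = g" "set vs \<subseteq> grig_gens \<omega>" "word_prod vs = h"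
      by auto
    then show ?case by (intro exI[of _ "us @ vs"]) (simp add: tree_Aut_def)
  qed
qed

abbreviation grig_length :: "(nat \<Rightarrow> letter) \<Rightarrow> (vertex \<Rightarrow> vertex) \<Rightarrow> nat" where
  "grig_length \<omega> \<equiv> word_length (grigorchuk \<omega>) (grig_gens \<omega>)"

lemma grig_length_le:
  assumes "set ws \<subseteq> grig_gens \<omega>" shows "grig_length \<omega> (word_prod ws) \<le> length ws"
  unfolding word_length_def inv_gens foldr_grigorchuk by (rule Least_le) (use assms in blast)

lemma grig_length_witness:
  assumes "g \<in> carrier (grigorchuk \<omega>)"
  shows "\<exists>ws. length ws = grig_length \<omega> g \<and> set ws \<subseteq> grig_gens \<omega> \<and> word_prod ws = g"
proof -
  have "\<exists>n ws. length ws = n \<and> set ws \<subseteq> grig_gens \<omega> \<and> word_prod ws = g"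
    using grigorchuk_word[OF assms] by blast
  then show ?thesis unfolding word_length_def inv_gens foldr_grigorchuk by (rule LeastI_ex)
qed

lemma grig_length_mult:
  assumes "g \<in> carrier (grigorchuk \<omega>)" "h \<in> carrier (grigorchuk \<omega>)"
  shows "grig_length \<omega> (h \<circ> g) \<le> grig_length \<omega> g + grig_length \<omega> h"
proof -
  obtain us vs where *: "length us = grig_length \<omega> g" "set us \<subseteq> grig_gens \<omega>" "word_prod us = g"
    "length vs = grig_length \<omega> h" "set vs \<subseteq> grig_gens \<omega>" "word_prod vs = h"
    using assms[THEN grig_length_witness] by auto
  then show ?thesis using grig_length_le[of "us @ vs" \<omega>] by simp
qed

lemma word_prod_rev_inverse:
  assumes "set ws \<subseteq> grig_gens \<omega>" shows "word_prod (rev ws) \<circ> word_prod ws = id"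
  using assms
proof (induction ws)
  case (Cons g ws)
  have "word_prod (rev (g # ws)) \<circ> word_prod (g # ws) = g \<circ> (word_prod (rev ws) \<circ> word_prod ws) \<circ> g"
    by (simp add: comp_assoc)
  also have "word_prod (rev ws) \<circ> word_prod ws = id"
    using Cons by (metis insert_subset list.simps(15))
  also have "g \<circ> id \<circ> g = id" using Cons gen_involution[of g \<omega>] by simp
  finally show ?case .
qed simp

lemma inv_word_prod:
  assumes "set ws \<subseteq> grig_gens \<omega>"
  shows "m_inv (grigorchuk \<omega>) (word_prod ws) = word_prod (rev ws)"
proof -
  have "word_prod (rev ws) \<otimes>\<^bsub>grigorchuk \<omega>\<^esub> word_prod ws = \<one>\<^bsub>grigorchuk \<omega>\<^esub>"
    using word_prod_rev_inverse[of "rev ws" \<omega>] assms by simp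
  then show ?thesis
    using group.inv_equality[OF group_grigorchuk] assms word_prod_in_grigorchuk[of ws \<omega>]
      word_prod_in_grigorchuk[of "rev ws" \<omega>] by auto
qed

lemma grig_length_inv:
  assumes "g \<in> carrier (grigorchuk \<omega>)"
  shows "grig_length \<omega> (m_inv (grigorchuk \<omega>) g) \<le> grig_length \<omega> g"
proof -
  obtain ws where "length ws = grig_length \<omega> g" "set ws \<subseteq> grig_gens \<omega>" "word_prod ws = g"
    using grig_length_witness[OF assms] by blast
  then show ?thesis using grig_length_le[of "rev ws" \<omega>] inv_word_prod[of ws \<omega>] by auto
qed

lemma finite_grig_ball: "finite (word_ball (grigorchuk \<omega>) (grig_gens \<omega>) R)"
proof -
  have "word_ball (grigorchuk \<omega>) (grig_gens \<omega>) R
      \<subseteq> word_prod ` {ws. set ws \<subseteq> grig_gens \<omega> \<and> length ws \<le> nat \<lfloor>R\<rfloor>}"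
  proof
    fix g assume "g \<in> word_ball (grigorchuk \<omega>) (grig_gens \<omega>) R"
    then have g: "g \<in> carrier (grigorchuk \<omega>)" "real (grig_length \<omega> g) \<le> R"
      by (auto simp: word_ball_def)
    obtain ws where "length ws = grig_length \<omega> g" "set ws \<subseteq> grig_gens \<omega>" "word_prod ws = g"
      using grig_length_witness[OF g(1)] by blast
    moreover have "grig_length \<omega> g \<le> nat \<lfloor>R\<rfloor>" using g(2) by (simp add: le_nat_floor)
    ultimately show "g \<in> word_prod ` {ws. set ws \<subseteq> grig_gens \<omega> \<and> length ws \<le> nat \<lfloor>R\<rfloor>}"
      by force
  qed
  moreover have "finite (grig_gens \<omega>)" by (simp add: grig_gens_def)
  ultimately show ?thesis
    by (intro finite_surj[where f = word_prod]) (auto intro: finite_lists_length_le)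
qed

lemma semigroup_generated_grigorchuk:
  assumes "grig_gens \<omega> \<subseteq> A" "A \<subseteq> carrier (grigorchuk \<omega>)"
  shows "semigroup_generated (grigorchuk \<omega>) A = carrier (grigorchuk \<omega>)"
proof
  show "semigroup_generated (grigorchuk \<omega>) A \<subseteq> carrier (grigorchuk \<omega>)"
  proof
    fix x assume "x \<in> semigroup_generated (grigorchuk \<omega>) A"
    then show "x \<in> carrier (grigorchuk \<omega>)"
    proof induction
      case (2 x y)
      then show ?case by (intro monoid.m_closed[OF group.is_monoid[OF group_grigorchuk]])
    qed (use assms(2) in blast)
  qed
  have ne: "word_prod ws \<in> semigroup_generated (grigorchuk \<omega>) A" if "set ws \<subseteq> grig_gens \<omega>" "ws \<noteq> []" for ws
    using that
  proof (induction ws)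
    case (Cons g ws)
    have g: "g \<in> semigroup_generated (grigorchuk \<omega>) A"
      using Cons assms(1) by (auto intro: semigroup_generated.intros)
    show ?case
    proof (cases "ws = []")
      case False
      then have "word_prod ws \<in> semigroup_generated (grigorchuk \<omega>) A" using Cons by auto
      from semigroup_generated.intros(2)[OF g this] show ?thesis by (simp only: mult_grigorchuk word_prod_simps)
    qed (use g in simp)
  qed simp
  show "carrier (grigorchuk \<omega>) \<subseteq> semigroup_generated (grigorchuk \<omega>) A"
  proof
    fix g assume "g \<in> carrier (grigorchuk \<omega>)"
    then obtain ws where ws: "set ws \<subseteq> grig_gens \<omega>" "word_prod ws = g" using grigorchuk_word by blast
    have "word_prod (tree_a # tree_a # ws) = g" using ws by (auto simp: fun_eq_iff)
    moreover have "set (tree_a # tree_a # ws) \<subseteq> grig_gens \<omega>" using ws by (auto simp: grig_gens_def)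
    ultimately show "g \<in> semigroup_generated (grigorchuk \<omega>) A" using ne by blast
  qed
qed

section \<open>The action on infinite words\<close>

text \<open>The form in which the tree structure is used below: levels and prefixes are preserved, so the map
  extends to infinite words and has sections.\<close>
definition prefixed :: "(vertex \<Rightarrow> vertex) \<Rightarrow> bool" where
  "prefixed g \<longleftrightarrow> (\<forall>w. length (g w) = length w) \<and> (\<forall>n w. take n (g w) = g (take n w))"

lemma prefixed_id: "prefixed id"
  by (simp add: prefixed_def)

lemma prefixed_comp: "prefixed g \<Longrightarrow> prefixed h \<Longrightarrow> prefixed (h \<circ> g)"
  by (auto simp: prefixed_def)

lemma prefixed_a: "prefixed tree_a"
proof -
  have "length (tree_a w) = length w" "take n (tree_a w) = tree_a (take n w)" for n w
    by (cases w; cases n; auto simp: tree_a_def)+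
  then show ?thesis by (simp add: prefixed_def)
qed

lemma prefixed_letter_hom: "prefixed (letter_hom l x)"
  by (simp add: letter_hom_def prefixed_id prefixed_a)

lemma prefixed_spinal: "prefixed (spinal x \<omega>)"
proof -
  have "length (spinal x \<omega> w) = length w" for w
    by (induction x \<omega> w rule: spinal.induct)
      (use prefixed_letter_hom in \<open>auto simp: prefixed_def\<close>)
  moreover have "take n (spinal x \<omega> w) = spinal x \<omega> (take n w)" for n w
  proof (induction x \<omega> w arbitrary: n rule: spinal.induct)
    case (2 x \<omega> w)
    then show ?case using prefixed_letter_hom[of "\<omega> 0" x] by (cases n) (auto simp: prefixed_def)
  next
    case (3 x \<omega> w)
    then show ?case by (cases n) auto
  qed simp
  ultimately show ?thesis by (simp add: prefixed_def)
qed

lemma prefixed_grigorchuk: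
  assumes "g \<in> carrier (grigorchuk \<omega>)" shows "prefixed g"
proof -
  obtain ws where ws: "set ws \<subseteq> grig_gens \<omega>" "word_prod ws = g" using grigorchuk_word[OF assms] by blast
  have "prefixed (word_prod ws)" using ws(1)
  proof (induction ws)
    case (Cons s ws)
    then have "prefixed s" by (auto simp: grig_gens_def prefixed_a prefixed_spinal)
    then show ?case using Cons prefixed_comp[of s "word_prod ws"] by (simp only: word_prod_simps set_simps insert_subset simp_thms)
  qed (simp only: prefixed_id word_prod_simps)
  then show ?thesis using ws by simp
qed

definition pre :: "nat \<Rightarrow> (nat \<Rightarrow> bool) \<Rightarrow> vertex" where
  "pre n x = map x [0..<n]"

lemma length_pre [simp]: "length (pre n x) = n" by (simp add: pre_def)
lemma nth_pre [simp]: "i < n \<Longrightarrow> pre n x ! i = x i" by (simp add: pre_def)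
lemma take_pre [simp]: "take m (pre n x) = pre (min m n) x"
  by (rule nth_equalityI) (auto simp: pre_def)
lemma pre_0 [simp]: "pre 0 x = []" by (simp add: pre_def)
lemma pre_Suc: "pre (Suc n) x = pre n x @ [x n]" by (simp add: pre_def)

lemma pre_inj: "(\<And>n. pre n x = pre n y) \<Longrightarrow> x = y"
proof
  fix n assume "\<And>n. pre n x = pre n y"
  then have "pre (Suc n) x ! n = pre (Suc n) y ! n" by simp
  then show "x n = y n" by simp
qed

definition act :: "(vertex \<Rightarrow> vertex) \<Rightarrow> (nat \<Rightarrow> bool) \<Rightarrow> nat \<Rightarrow> bool" where
  "act g x n = g (pre (Suc n) x) ! n"

lemma pre_act:
  assumes "prefixed g" shows "pre n (act g x) = g (pre n x)"
proof (rule nth_equalityI)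
  show "length (pre n (act g x)) = length (g (pre n x))" using assms by (simp add: prefixed_def)
  fix i assume "i < length (pre n (act g x))"
  then have i: "i < n" by simp
  then have "pre (Suc i) x = take (Suc i) (pre n x)" by simp
  then have "g (pre (Suc i) x) = take (Suc i) (g (pre n x))" using assms by (metis prefixed_def)
  then show "pre n (act g x) ! i = g (pre n x) ! i" using i by (simp add: act_def)
qed

lemma act_id [simp]: "act id x = x" by (rule ext) (simp add: act_def)

lemma act_comp:
  assumes "prefixed g" "prefixed h" shows "act (h \<circ> g) x = act h (act g x)"
  by (rule pre_inj) (simp add: assms prefixed_comp pre_act)

section \<open>Germs\<close>

definition sec :: "(vertex \<Rightarrow> vertex) \<Rightarrow> vertex \<Rightarrow> vertex \<Rightarrow> vertex" where
  "sec g v w = drop (length v) (g (v @ w))"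

lemma prefixed_append: "prefixed g \<Longrightarrow> g (v @ w) = g v @ sec g v w"
  unfolding prefixed_def sec_def by (metis append_eq_conv_conj append_take_drop_id)

lemma sec_comp:
  assumes "prefixed g" "prefixed h" shows "sec (h \<circ> g) v = sec h (g v) \<circ> sec g v"
proof
  fix w show "sec (h \<circ> g) v w = (sec h (g v) \<circ> sec g v) w"
    using assms(1) by (simp add: sec_def[of "h \<circ> g"] prefixed_append[OF assms(1)])
      (simp add: sec_def[of h] prefixed_def)
qed

lemma sec_id [simp]: "sec id v = id" by (rule ext) (simp add: sec_def)

definition shiftn :: "nat \<Rightarrow> (nat \<Rightarrow> 'a) \<Rightarrow> nat \<Rightarrow> 'a" where
  "shiftn k \<omega> = (\<lambda>n. \<omega> (k + n))"

lemma shiftn_0 [simp]: "shiftn 0 \<omega> = \<omega>" by (simp add: shiftn_def)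
lemma shiftn_Suc: "shiftn (Suc k) \<omega> = shiftn k (shift \<omega>)" by (simp add: shiftn_def shift_def)
text \<open>The group element looks near \<open>x\<close> like the spinal generator \<open>\<kappa>\<close>, transported to \<open>x\<close>.\<close>
definition has_germ :: "(nat \<Rightarrow> letter) \<Rightarrow> (vertex \<Rightarrow> vertex) \<Rightarrow> (nat \<Rightarrow> bool) \<Rightarrow> klein \<Rightarrow> bool" where
  "has_germ \<omega> g x \<kappa> \<longleftrightarrow> (\<forall>\<^sub>F k in sequentially. sec g (pre k x) = spinal \<kappa> (shiftn k \<omega>))"

lemma spinal_Kid [simp]: "spinal Kid \<omega> = id"
proof
  fix w :: vertex show "spinal Kid \<omega> w = id w"
  proof (induction w arbitrary: \<omega>)
    case (Cons i w) then show ?case by (cases i) (auto simp: letter_hom_def)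
  qed simp
qed

lemma letter_hom_mult: "letter_hom l y \<circ> letter_hom l x = letter_hom l (klein_mult x y)"
  by (cases l; cases x; cases y; auto simp: letter_hom_def fun_eq_iff)

lemma spinal_mult: "spinal y \<omega> \<circ> spinal x \<omega> = spinal (klein_mult x y) \<omega>"
proof
  fix w show "(spinal y \<omega> \<circ> spinal x \<omega>) w = spinal (klein_mult x y) \<omega> w"
  proof (induction w arbitrary: \<omega>)
    case (Cons i w) then show ?case
      using letter_hom_mult[of "\<omega> 0" y x] by (cases i) (auto simp: fun_eq_iff)
  qed simp
qed

lemma has_germ_id: "has_germ \<omega> id x Kid" by (simp add: has_germ_def)

lemma has_germ_comp:
  assumes "prefixed g" "prefixed h" "has_germ \<omega> g x \<kappa>" "has_germ \<omega> h (act g x) \<kappa>'"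
  shows "has_germ \<omega> (h \<circ> g) x (klein_mult \<kappa> \<kappa>')"
  using assms(3,4) unfolding has_germ_def
  by eventually_elim (simp add: sec_comp assms pre_act spinal_mult)

lemma pre_Suc_Cons: "pre (Suc k) x = x 0 # pre k (shift x)"
  by (simp add: pre_def shift_def upt_conv_Cons map_Suc_upt[symmetric] del: upt_Suc)

lemma has_germ_a: "has_germ \<omega> tree_a x Kid"
proof -
  have "sec tree_a (pre (Suc m) x) = id" for m
    by (rule ext) (simp only: pre_Suc_Cons, simp add: sec_def tree_a_def)
  then have "\<forall>k\<ge>1. sec tree_a (pre k x) = spinal Kid (shiftn k \<omega>)"
    unfolding spinal_Kid by (metis Suc_le_D One_nat_def)
  then show ?thesis unfolding has_germ_def eventually_sequentially by blast
qed

abbreviation ones :: "nat \<Rightarrow> bool" where "ones \<equiv> (\<lambda>_. True)"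

lemma sec_spinal_True:
  "sec (spinal y \<omega>) (True # v) = sec (spinal y (shift \<omega>)) v"
  by (rule ext) (simp add: sec_def)

lemma sec_letter_hom: "v \<noteq> [] \<Longrightarrow> sec (letter_hom l y) v = id"
  by (cases v) (auto simp: sec_def letter_hom_def fun_eq_iff tree_a_def)

lemma has_germ_spinal_ones: "has_germ \<omega> (spinal y \<omega>) ones y"
proof -
  have "sec (spinal y \<omega>) (pre k ones) = spinal y (shiftn k \<omega>)" for k
  proof (induction k arbitrary: \<omega>)
    case 0 show ?case by (rule ext) (simp add: sec_def)
  next
    case (Suc k)
    then show ?case by (simp add: pre_Suc_Cons sec_spinal_True shiftn_Suc shift_def[of ones])
  qed
  then show ?thesis by (simp add: has_germ_def)
qed

lemma sec_spinal_False:
  "sec (spinal y \<omega>) (False # v) = sec (letter_hom (\<omega> 0) y) v"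
  by (rule ext) (simp add: sec_def)

text \<open>Off the ray \<open>1\<^sup>\<infinity>\<close> a spinal element meets the first digit \<open>0\<close>, flips at most the digit after it, and
  acts trivially from there on.\<close>
lemma has_germ_spinal:
  assumes "x \<noteq> ones" shows "has_germ \<omega> (spinal y \<omega>) x Kid"
proof -
  obtain n where "\<not> x n" using assms by auto
  then have "\<exists>K. \<forall>k\<ge>K. sec (spinal y \<omega>) (pre k x) = id"
  proof (induction n arbitrary: x \<omega>)
    case (Suc n)
    show ?case
    proof (cases "x 0")
      case True
      obtain K where K: "\<And>k. k \<ge> K \<Longrightarrow> sec (spinal y (shift \<omega>)) (pre k (shift x)) = id"
        using Suc.IH[of "shift x" "shift \<omega>"] Suc.prems unfolding shift_def[of x] by metis
      have "sec (spinal y \<omega>) (pre (Suc m) x) = id" if "m \<ge> K" for m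
        unfolding pre_Suc_Cons[of m x] using True K[OF that] by (simp only: sec_spinal_True)
      then show ?thesis by (metis Suc_le_D Suc_le_mono)
    next
      case False
      have "sec (spinal y \<omega>) (pre (Suc m) x) = id" if "m \<ge> 1" for m
        unfolding pre_Suc_Cons[of m x] using False sec_letter_hom[of "pre m (shift x)"] that
        by (simp only: sec_spinal_False) (metis length_pre list.size(3) not_one_le_zero)
      then show ?thesis by (metis Suc_le_D Suc_le_mono)
    qed
  next
    case 0
    have "sec (spinal y \<omega>) (pre (Suc m) x) = id" if "m \<ge> 1" for m
      unfolding pre_Suc_Cons[of m x] using 0 sec_letter_hom[of "pre m (shift x)"] that
      by (simp only: sec_spinal_False) (metis length_pre list.size(3) not_one_le_zero)
    then show ?case by (metis Suc_le_D Suc_le_mono)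
  qed
  then show ?thesis by (auto simp: has_germ_def eventually_sequentially)
qed

lemma has_germ_exists:
  assumes "g \<in> carrier (grigorchuk \<omega>)" shows "\<exists>\<kappa>. has_germ \<omega> g x \<kappa>"
proof -
  obtain ws where ws: "set ws \<subseteq> grig_gens \<omega>" "word_prod ws = g" using grigorchuk_word[OF assms] by blast
  have "\<exists>\<kappa>. has_germ \<omega> (word_prod ws) x \<kappa>" using ws(1)
  proof (induction ws arbitrary: x)
    case Nil show ?case using has_germ_id by (metis word_prod_simps(1))
  next
    case (Cons s ws)
    then obtain \<kappa>' where "has_germ \<omega> (word_prod ws) (act s x) \<kappa>'" by auto
    moreover have "\<exists>\<kappa>. has_germ \<omega> s x \<kappa>"
      using Cons.prems has_germ_a[of \<omega> x] has_germ_spinal[of x \<omega>] has_germ_spinal_ones[of \<omega>]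
      by (cases "x = ones") (auto simp: grig_gens_def)
    moreover have "prefixed s" "prefixed (word_prod ws)"
      using Cons.prems word_prod_in_grigorchuk[of ws \<omega>] gens_in_grigorchuk[of \<omega>]
      by (auto intro!: prefixed_grigorchuk)
    ultimately show ?case using has_germ_comp by (metis word_prod_simps(2))
  qed
  then show ?thesis using ws by simp
qed

text \<open>The letters \<open>1\<close> and \<open>2\<close> vanish on different elements, so together they separate the Klein group. As
  both occur arbitrarily late, no section along the ray loses this information.\<close>
lemma has_germ_unique:
  assumes inf: "\<And>k. \<exists>j\<ge>k. \<omega> j = L1" "\<And>k. \<exists>j\<ge>k. \<omega> j = L2"
    and germ: "has_germ \<omega> g x \<kappa>" "has_germ \<omega> g x \<kappa>'"
  shows "\<kappa> = \<kappa>'"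
proof -
  from germ have "\<forall>\<^sub>F k in sequentially. spinal \<kappa> (shiftn k \<omega>) = spinal \<kappa>' (shiftn k \<omega>)"
    unfolding has_germ_def by eventually_elim simp
  then obtain k where eq: "\<And>w. spinal \<kappa> (shiftn k \<omega>) w = spinal \<kappa>' (shiftn k \<omega>) w"
    unfolding eventually_sequentially by (metis order_refl)
  have val: "spinal y \<psi> (replicate j True @ [False, True])
      = replicate j True @ False # letter_hom (\<psi> j) y [True]" for y j \<psi>
    by (induction j arbitrary: \<psi>) (auto simp: shift_def)
  have same: "letter_hom (\<omega> j) \<kappa> [True] = letter_hom (\<omega> j) \<kappa>' [True]" if "j \<ge> k" for j
    using eq[of "replicate (j - k) True @ [False, True]"] that by (simp add: val shiftn_def)
  obtain i j where "i \<ge> k" "\<omega> i = L1" "j \<ge> k" "\<omega> j = L2" using inf by blast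
  then show ?thesis using same[of i] same[of j]
    by (cases \<kappa>; cases \<kappa>'; simp add: letter_hom_def tree_a_def)
qed

text \<open>The non-trivial class modulo \<open>{id, d}\<close>.\<close>
definition odd_germ :: "(nat \<Rightarrow> letter) \<Rightarrow> (vertex \<Rightarrow> vertex) \<Rightarrow> (nat \<Rightarrow> bool) \<Rightarrow> bool" where
  "odd_germ \<omega> g x \<longleftrightarrow> has_germ \<omega> g x Kb \<or> has_germ \<omega> g x Kc"

lemma odd_germ_iff:
  assumes "\<And>k. \<exists>j\<ge>k. \<omega> j = L1" "\<And>k. \<exists>j\<ge>k. \<omega> j = L2" "has_germ \<omega> g x \<kappa>"
  shows "odd_germ \<omega> g x \<longleftrightarrow> \<kappa> \<in> {Kb, Kc}"
  using has_germ_unique[OF assms(1,2)] assms(3) by (auto simp: odd_germ_def)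

lemma odd_germ_comp:
  assumes inf: "\<And>k. \<exists>j\<ge>k. \<omega> j = L1" "\<And>k. \<exists>j\<ge>k. \<omega> j = L2"
    and G: "g \<in> carrier (grigorchuk \<omega>)" "h \<in> carrier (grigorchuk \<omega>)"
  shows "odd_germ \<omega> (h \<circ> g) x \<longleftrightarrow> odd_germ \<omega> g x \<noteq> odd_germ \<omega> h (act g x)"
proof -
  obtain \<kappa> \<kappa>' where k: "has_germ \<omega> g x \<kappa>" "has_germ \<omega> h (act g x) \<kappa>'"
    using has_germ_exists G by blast
  then have "has_germ \<omega> (h \<circ> g) x (klein_mult \<kappa> \<kappa>')"
    using has_germ_comp prefixed_grigorchuk G by blast
  then show ?thesis using k odd_germ_iff[OF inf]
    by (cases \<kappa>; cases \<kappa>'; auto)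
qed

text \<open>A window of length \<open>2D\<close> contains a complete block of the frequency assumption, and both admissible
  strings \<open>201\<close> and \<open>211\<close> contain the letters \<open>1\<close> and \<open>2\<close>.\<close>
lemma Fr_letters:
  assumes "Fr D \<omega>"
  shows "\<exists>j\<ge>k. j < k + 2 * D \<and> \<omega> j = L1" "\<exists>j\<ge>k. j < k + 2 * D \<and> \<omega> j = L2"
proof -
  have D: "D > 0"
  proof (rule ccontr)
    assume "\<not> D > 0"
    then show False using assms by (auto simp: Fr_def)
  qed
  \<comment> \<open>The first complete block that starts after \<open>k\<close>.\<close>
  define q where "q = k div D + 1"
  have q: "k \<le> q * D" "q * D + D \<le> k + 2 * D"
    unfolding q_def using D dividend_less_div_times[of D k] by (auto simp: algebra_simps)
  have "sublist [L2, L0, L1] (map \<omega> [q * D ..< q * D + D])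
        \<or> sublist [L2, L1, L1] (map \<omega> [q * D ..< q * D + D])"
    using assms by (simp add: Fr_def)
  then have "set [L2, L0, L1] \<subseteq> set (map \<omega> [q * D ..< q * D + D])
      \<or> set [L2, L1, L1] \<subseteq> set (map \<omega> [q * D ..< q * D + D])"
    using set_mono_sublist by blast
  then have block: "L1 \<in> \<omega> ` {q * D ..< q * D + D}" "L2 \<in> \<omega> ` {q * D ..< q * D + D}"
    by auto
  have "\<exists>j\<ge>k. j < k + 2 * D \<and> \<omega> j = l" if l: "l \<in> \<omega> ` {q * D ..< q * D + D}" for l
  proof -
    obtain j where "\<omega> j = l" "q * D \<le> j" "j < q * D + D" using l by auto
    then show ?thesis using q by (intro exI[of _ j]) linarith
  qed
  then show "\<exists>j\<ge>k. j < k + 2 * D \<and> \<omega> j = L1" "\<exists>j\<ge>k. j < k + 2 * D \<and> \<omega> j = L2"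
    using block by blast+
qed

section \<open>Substitutions and flips\<close>

text \<open>The image of the pair \<open>ak\<close> under the substitution that sends words over \<open>\<s>\<omega>\<close> to words over \<open>\<omega>\<close>, where
  \<open>l = \<omega>\<^sub>0\<close>: \<open>ak\<close> becomes \<open>akak\<close>, except that for the vanishing letter \<open>v\<close> it becomes \<open>ayavaz\<close>, with \<open>y, z\<close>
  the two other letters, whose product is \<open>v\<close>.\<close>
definition lift_letter :: "letter \<Rightarrow> klein \<Rightarrow> klein list" where
  "lift_letter l k = (if k = vanishing l
     then (case l of L0 \<Rightarrow> [Kb, Kd, Kc] | L1 \<Rightarrow> [Kb, Kc, Kd] | L2 \<Rightarrow> [Kc, Kb, Kd])
     else [k, k])"

definition lift_word :: "letter \<Rightarrow> klein list \<Rightarrow> klein list" where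
  "lift_word l ks = concat (map (lift_letter l) ks)"

lemma lift_word_simps [simp]: "lift_word l [] = []" "lift_word l (k # ks) = lift_letter l k @ lift_word l ks"
  by (simp_all add: lift_word_def)

text \<open>The product of the pairs \<open>ak\<close> over the list.\<close>
fun alt_prod :: "(nat \<Rightarrow> letter) \<Rightarrow> klein list \<Rightarrow> vertex \<Rightarrow> vertex" where
  "alt_prod \<omega> [] w = w"
| "alt_prod \<omega> (k # ks) w = alt_prod \<omega> ks (spinal k \<omega> (tree_a w))"

lemma alt_prod_append [simp]: "alt_prod \<omega> (ks @ ls) w = alt_prod \<omega> ls (alt_prod \<omega> ks w)"
  by (induction ks arbitrary: w) auto

lemma Kid_notin_lift_word: "Kid \<notin> set ks \<Longrightarrow> Kid \<notin> set (lift_word l ks)"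
  by (induction ks) (auto simp: lift_letter_def split: letter.splits)

text \<open>With \<open>W\<close> the element of the original word, the lifted word is \<open>(aWa, W)\<close> if it contains an even
  number of vanishing letters, and \<open>(aW, Wa)\<epsilon>\<close> otherwise: \<open>akak = (k'a, ak')\<close> with \<open>k'\<close> over \<open>\<s>\<omega>\<close>, while
  \<open>ayavaz = (v', av'a)\<epsilon>\<close>, and these shapes are closed under multiplication.\<close>
lemma alt_prod_lift_word:
  assumes "Kid \<notin> set ks"
  shows "alt_prod \<omega> (lift_word (\<omega> 0) ks) (i # w) =
    (if even (count_list ks (vanishing (\<omega> 0)))
     then i # (if i then alt_prod (shift \<omega>) ks w else tree_a (alt_prod (shift \<omega>) ks (tree_a w)))
     else (\<not> i) # (if i then tree_a (alt_prod (shift \<omega>) ks w) else alt_prod (shift \<omega>) ks (tree_a w)))"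
  using assms
proof (induction ks arbitrary: i w)
  case (Cons k ks)
  have a: "tree_a (j # v) = (\<not> j) # v" for j v by (simp add: tree_a_def)
  have h: "letter_hom l x v = (if x = Kid \<or> x = vanishing l then v else tree_a v)" for l x v
    by (simp add: letter_hom_def)
  have m: "spinal x \<psi> (spinal y \<psi> v) = spinal (klein_mult y x) \<psi> v" for x y \<psi> v
    using spinal_mult[of x \<psi> y] by (auto simp: fun_eq_iff)
  obtain l where l: "\<omega> 0 = l" by simp
  show ?case
    using Cons.prems Cons.IH
    by (cases l; cases k; cases i; simp add: lift_letter_def a h l m)
qed simp

fun iter_lift :: "(nat \<Rightarrow> letter) \<Rightarrow> nat \<Rightarrow> klein list \<Rightarrow> klein list" where
  "iter_lift \<omega> 0 ks = ks"
| "iter_lift \<omega> (Suc n) ks = lift_word (\<omega> 0) (iter_lift (shift \<omega>) n ks)"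

lemma Kid_notin_iter_lift: "Kid \<notin> set ks \<Longrightarrow> Kid \<notin> set (iter_lift \<omega> n ks)"
  by (induction n arbitrary: \<omega>) (auto simp: Kid_notin_lift_word)

text \<open>After one lift all letters have the same parity. Thus one parity condition, at the innermost lift,
  makes all further lifts stabilise the levels.\<close>
lemma even_count_lift_word:
  assumes "Kid \<notin> set ks" "k \<noteq> Kid"
  shows "even (count_list (lift_word l ks) k) \<longleftrightarrow> even (count_list ks (vanishing l))"
  using assms(1)
proof (induction ks)
  case (Cons k' ks)
  then show ?case using assms(2)
    by (cases l; cases k; cases k'; simp add: lift_letter_def)
qed simp

lemma even_count_iter_lift:
  assumes "Kid \<notin> set ks" "k \<noteq> Kid"
  shows "even (count_list (iter_lift \<omega> (Suc n) ks) k) \<longleftrightarrow> even (count_list ks (vanishing (\<omega> n)))"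
  using assms(2)
proof (induction n arbitrary: \<omega> k)
  case 0 then show ?case using even_count_lift_word[OF assms(1)] by simp
next
  case (Suc n)
  have "vanishing (\<omega> 0) \<noteq> Kid" by (cases "\<omega> 0") auto
  from Suc.IH[OF this, of "shift \<omega>"] show ?case
    using even_count_lift_word[OF Kid_notin_iter_lift[OF assms(1)] Suc.prems, of "\<omega> 0" "shift \<omega>" "Suc n"]
    by (simp add: shift_def)
qed

text \<open>Each lift conjugates the section at \<open>0\<close> by \<open>a\<close>. This conjugation swaps the sections one level
  below, so the conjugations accumulate to the parity of the number of digits \<open>0\<close> in \<open>u\<close>.\<close>
lemma alt_prod_iter_lift:
  assumes "Kid \<notin> set ks" "n > 0 \<Longrightarrow> even (count_list ks (vanishing (\<omega> (n - 1))))" "length u = n"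
  shows "alt_prod \<omega> (iter_lift \<omega> n ks) (u @ w) =
    u @ (if even (count_list u False) then alt_prod (shiftn n \<omega>) ks w
         else tree_a (alt_prod (shiftn n \<omega>) ks (tree_a w)))"
  using assms(2,3)
proof (induction n arbitrary: \<omega> u w)
  case (Suc n)
  let ?h = "alt_prod (shift \<omega>) (iter_lift (shift \<omega>) n ks)"
  let ?W = "alt_prod (shiftn (Suc n) \<omega>) ks"
  obtain i v where u: "u = i # v" "length v = n" using Suc.prems(2) by (cases u) auto
  have van: "vanishing (\<omega> 0) \<noteq> Kid" by (cases "\<omega> 0") auto
  have "even (count_list (iter_lift (shift \<omega>) n ks) (vanishing (\<omega> 0)))"
  proof (cases n)
    case 0 then show ?thesis using Suc.prems by simp
  next
    case (Suc m)
    then show ?thesis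
      using even_count_iter_lift[OF assms(1) van, of "shift \<omega>" m] Suc.prems by (simp add: shift_def)
  qed
  then have step: "alt_prod \<omega> (iter_lift \<omega> (Suc n) ks) (u @ w) =
      i # (if i then ?h (v @ w) else tree_a (?h (tree_a (v @ w))))"
    using alt_prod_lift_word[of "iter_lift (shift \<omega>) n ks" \<omega> i "v @ w"] Kid_notin_iter_lift[OF assms(1)]
    by (simp add: u)
  have IH: "?h (v' @ w) = v' @ (if even (count_list v' False) then ?W w else tree_a (?W (tree_a w)))"
    if "length v' = n" for v' w
    using Suc.IH[of "shift \<omega>" v'] Suc.prems(1) that by (cases n) (auto simp: shiftn_Suc shift_def)
  show ?case
  proof (cases i)
    case True then show ?thesis using step IH[OF u(2), of w] by (simp add: u(1))
  next
    case False
    show ?thesis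
    proof (cases v)
      case Nil
      then show ?thesis using step IH[of "[]"] False u by simp
    next
      case (Cons j v')
      have a: "tree_a (j # x) = (\<not> j) # x" for j x by (simp add: tree_a_def)
      show ?thesis using step IH[of "(\<not> j) # v'" w] False u Cons by (cases j) (simp_all add: a)
    qed
  qed
qed simp

subsection \<open>Lengths\<close>

text \<open>The number of pairs in the \<open>n\<close>-fold lift of the single pair \<open>ak\<close>, that is, the column sum of
  \<open>M\<^bsub>\<omega>\<^sub>0\<^esub>\<cdots>M\<^bsub>\<omega>\<^bsub>n-1\<^esub>\<^esub>\<close> at \<open>k\<close>.\<close>
fun lift_length :: "(nat \<Rightarrow> letter) \<Rightarrow> nat \<Rightarrow> klein \<Rightarrow> nat" where
  "lift_length \<omega> 0 k = 1"
| "lift_length \<omega> (Suc n) k =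
    (if k = vanishing (\<omega> n) then lift_length \<omega> n Kb + lift_length \<omega> n Kc + lift_length \<omega> n Kd
     else 2 * lift_length \<omega> n k)"

lemma iter_lift_Suc': "iter_lift \<omega> (Suc n) ks = iter_lift \<omega> n (lift_word (\<omega> n) ks)"
proof (induction n arbitrary: \<omega>)
  case (Suc n)
  then have "iter_lift (shift \<omega>) (Suc n) ks = iter_lift (shift \<omega>) n (lift_word (shift \<omega> n) ks)" .
  then show ?case by (simp add: shift_def[of \<omega>])
qed simp

lemma length_iter_lift:
  assumes "Kid \<notin> set ks"
  shows "length (iter_lift \<omega> n ks) = sum_list (map (lift_length \<omega> n) ks)"
  using assms
proof (induction n arbitrary: ks)
  case 0 show ?case by (induction ks) auto
next
  case (Suc n)
  have "length (iter_lift \<omega> (Suc n) ks) = sum_list (map (lift_length \<omega> n) (lift_word (\<omega> n) ks))"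
    unfolding iter_lift_Suc' using Suc Kid_notin_lift_word by blast
  also have "\<dots> = sum_list (map (lift_length \<omega> (Suc n)) ks)"
    by (induction ks) (auto simp: lift_letter_def split: letter.splits)
  finally show ?case .
qed

lemma row_matrix_word:
  "vector [1, 1, 1] v* matrix_word \<omega> n =
     vector [real (lift_length \<omega> n Kb), real (lift_length \<omega> n Kc), real (lift_length \<omega> n Kd)]"
proof (induction n)
  case 0 show ?case by (simp add: vec_eq_iff forall_3)
next
  case (Suc n)
  have "vector [1, 1, 1] v* matrix_word \<omega> (Suc n)
      = (vector [1, 1, 1] v* matrix_word \<omega> n) v* letter_matrix (\<omega> n)"
    by (simp add: vector_matrix_mul_assoc)
  then show ?case unfolding Suc
    by (cases "\<omega> n") (simp_all add: vec_eq_iff forall_3 vector_matrix_mult_def sum_3)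
qed

lemma grig_L_eq:
  "grig_L \<omega> n = real (lift_length \<omega> n Kb + lift_length \<omega> n Kc + lift_length \<omega> n Kd)"
  by (simp add: grig_L_def row_matrix_word inner_vec_def sum_3)

text \<open>No column sum exceeds the sum of the two others. The matrices preserve this, and it gives
  \<open>L\<^bsub>n+1\<^esub> \<ge> 2L\<^sub>n\<close>.\<close>
lemma lift_length_triangle:
  "k \<noteq> Kid \<Longrightarrow> 2 * lift_length \<omega> n k \<le> lift_length \<omega> n Kb + lift_length \<omega> n Kc + lift_length \<omega> n Kd"
proof (induction n arbitrary: k)
  case 0 then show ?case by simp
next
  case (Suc n)
  show ?case using Suc.IH[of Kb] Suc.IH[of Kc] Suc.IH[of Kd] Suc.prems
    by (cases "\<omega> n"; cases k; simp)
qed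

lemma grig_L_Suc: "2 * grig_L \<omega> n \<le> grig_L \<omega> (Suc n)"
proof -
  have "vanishing (\<omega> n) \<noteq> Kid" by (cases "\<omega> n") auto
  from lift_length_triangle[OF this, of \<omega> n] show ?thesis
    unfolding grig_L_eq by (cases "\<omega> n") (simp_all only: lift_length.simps vanishing.simps, auto)
qed

lemma grig_L_growth: "2 ^ k * grig_L \<omega> n \<le> grig_L \<omega> (n + k)"
proof (induction k)
  case (Suc k) then show ?case using grig_L_Suc[of \<omega> "n + k"] by simp
qed simp

lemma grig_L_ge: "grig_L \<omega> n \<ge> 3"
proof -
  have "grig_L \<omega> 0 = 3" by (simp add: grig_L_eq)
  moreover have "(1::real) \<le> 2 ^ n" by simp
  moreover have "2 ^ n * grig_L \<omega> 0 \<le> grig_L \<omega> n" using grig_L_growth[of n \<omega> 0] by simp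
  ultimately have "2 ^ n * 3 \<le> grig_L \<omega> n" by simp
  then show ?thesis using \<open>1 \<le> 2 ^ n\<close> by linarith
qed

lemma alt_prod_word: "alt_prod \<omega> ks = word_prod (concat (map (\<lambda>k. [tree_a, spinal k \<omega>]) ks))"
proof
  fix w show "alt_prod \<omega> ks w = word_prod (concat (map (\<lambda>k. [tree_a, spinal k \<omega>]) ks)) w"
    by (induction ks arbitrary: w) auto
qed

lemma
  assumes "Kid \<notin> set ks"
  shows alt_prod_in_grigorchuk: "alt_prod \<omega> ks \<in> carrier (grigorchuk \<omega>)"
    and grig_length_alt_prod: "grig_length \<omega> (alt_prod \<omega> ks) \<le> 2 * length ks"
proof -
  let ?ws = "concat (map (\<lambda>k. [tree_a, spinal k \<omega>]) ks)"
  have *: "set ?ws \<subseteq> grig_gens \<omega>"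
  proof -
    have "spinal k \<omega> \<in> grig_gens \<omega>" if "k \<in> set ks" for k
      
    proof -
      have "k \<noteq> Kid" using that assms by auto
      then show ?thesis by (cases k) (auto simp: grig_gens_def)
    qed
    then show ?thesis by (auto simp: grig_gens_def)
  qed
  have "length ?ws = 2 * length ks" by (induction ks) auto
  then show "alt_prod \<omega> ks \<in> carrier (grigorchuk \<omega>)" "grig_length \<omega> (alt_prod \<omega> ks) \<le> 2 * length ks"
    using word_prod_in_grigorchuk[OF *] grig_length_le[OF *] by (simp_all add: alt_prod_word)
qed

subsection \<open>Flips\<close>

text \<open>The letter must not vanish under \<open>l\<close>. Whenever possible it is \<open>d\<close>, whose germ is not odd.\<close>
definition flip_letter :: "letter \<Rightarrow> klein" where
  "flip_letter l = (if l = L0 then Kc else Kd)"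

definition flip :: "(nat \<Rightarrow> letter) \<Rightarrow> nat \<Rightarrow> vertex \<Rightarrow> vertex" where
  "flip \<omega> i = alt_prod \<omega> (iter_lift \<omega> (Suc i) [flip_letter (\<omega> i)])"

lemma flip_letter_neq: "flip_letter l \<noteq> Kid" "flip_letter l \<noteq> vanishing l"
  by (cases l; simp add: flip_letter_def)+

lemma flip_in_grigorchuk: "flip \<omega> i \<in> carrier (grigorchuk \<omega>)"
  unfolding flip_def by (intro alt_prod_in_grigorchuk Kid_notin_iter_lift) (use flip_letter_neq(1)[of "\<omega> i"] in auto)

lemma grig_length_flip: "real (grig_length \<omega> (flip \<omega> i)) \<le> 2 * grig_L \<omega> (Suc i)"
proof -
  have K: "Kid \<notin> set [flip_letter (\<omega> i)]" using flip_letter_neq(1)[of "\<omega> i"] by auto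
  have "grig_length \<omega> (flip \<omega> i) \<le> 2 * lift_length \<omega> (Suc i) (flip_letter (\<omega> i))"
    using grig_length_alt_prod[OF Kid_notin_iter_lift[OF K], of \<omega> \<omega> "Suc i"] length_iter_lift[OF K, of \<omega> "Suc i"]
    unfolding flip_def by simp
  also have "lift_length \<omega> (Suc i) (flip_letter (\<omega> i)) \<le>
      lift_length \<omega> (Suc i) Kb + lift_length \<omega> (Suc i) Kc + lift_length \<omega> (Suc i) Kd"
    using flip_letter_neq(1)[of "\<omega> i"] by (cases "flip_letter (\<omega> i)") auto
  finally show ?thesis unfolding grig_L_eq by linarith
qed

lemma flip_append:
  assumes "length u = Suc i"
  shows "flip \<omega> i (u @ w) = u @
    (let s = spinal (flip_letter (\<omega> i)) (shiftn (Suc i) \<omega>)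
     in if even (count_list u False) then s (tree_a w) else tree_a (s w))"
  using alt_prod_iter_lift[of "[flip_letter (\<omega> i)]" "Suc i" \<omega> u w] flip_letter_neq[of "\<omega> i"] assms
  by (auto simp: flip_def Let_def)

lemma act_flip_low:
  assumes "j \<le> i" shows "act (flip \<omega> i) x j = x j"
proof -
  have p: "prefixed (flip \<omega> i)" using prefixed_grigorchuk flip_in_grigorchuk by blast
  have "pre (Suc i) (act (flip \<omega> i) x) = pre (Suc i) x"
    using pre_act[OF p] flip_append[of "pre (Suc i) x" i \<omega> "[]"] by (simp add: Let_def tree_a_def)
  then have "pre (Suc i) (act (flip \<omega> i) x) ! j = pre (Suc i) x ! j" by simp
  then show ?thesis using assms by simp
qed

lemma act_flip_digit: "act (flip \<omega> i) x (Suc i) = (\<not> x (Suc i))"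
proof -
  have p: "prefixed (flip \<omega> i)" using prefixed_grigorchuk flip_in_grigorchuk by blast
  have s: "spinal k \<psi> [b] = [b]" for k \<psi> b
    by (cases b) (auto simp: letter_hom_def tree_a_def)
  have "pre (Suc (Suc i)) (act (flip \<omega> i) x) = pre (Suc i) x @ [\<not> x (Suc i)]"
    using pre_act[OF p] flip_append[of "pre (Suc i) x" i \<omega> "[x (Suc i)]"]
    by (auto simp: Let_def tree_a_def s pre_Suc[of "Suc i"])
  then have "pre (Suc (Suc i)) (act (flip \<omega> i) x) ! Suc i = (pre (Suc i) x @ [\<not> x (Suc i)]) ! Suc i"
    by simp
  then show ?thesis by (simp add: nth_append)
qed

lemma pre_add: "pre (m + k) x = pre m x @ pre k (shiftn m x)"
  by (induction k) (simp_all add: pre_Suc shiftn_def)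

lemma has_germ_section:
  assumes "\<And>w. g (pre m x @ w) = pre m x @ h w" "has_germ (shiftn m \<omega>) h (shiftn m x) \<kappa>"
  shows "has_germ \<omega> g x \<kappa>"
proof -
  have s: "sec g (pre (m + k) x) = sec h (pre k (shiftn m x))" for k
    by (rule ext) (simp add: sec_def pre_add assms(1))
  obtain K where K: "\<And>k. k \<ge> K \<Longrightarrow> sec h (pre k (shiftn m x)) = spinal \<kappa> (shiftn k (shiftn m \<omega>))"
    using assms(2) by (auto simp: has_germ_def eventually_sequentially)
  have "sec g (pre k x) = spinal \<kappa> (shiftn k \<omega>)" if "k \<ge> m + K" for k
    using s[of "k - m"] K[of "k - m"] that by (simp add: shiftn_def)
  then show ?thesis by (auto simp: has_germ_def eventually_sequentially)
qed

text \<open>The section of the flip at the prefix of length \<open>i + 1\<close> is \<open>ak\<close> or \<open>ka\<close>, with a non-trivial germ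
  only where \<open>k\<close> is applied to \<open>1\<^sup>\<infinity>\<close>; this is \<open>01\<^sup>\<infinity>\<close> or \<open>1\<^sup>\<infinity>\<close>, seen from that prefix.\<close>
lemma has_germ_flip:
  "\<exists>\<kappa>\<in>{Kid, flip_letter (\<omega> i)}. has_germ \<omega> (flip \<omega> i) x \<kappa> \<and>
     (\<kappa> \<noteq> Kid \<longrightarrow> (\<forall>j\<ge>i + 2. x j))"
proof -
  let ?m = "Suc i" and ?k = "flip_letter (\<omega> i)"
  let ?s = "spinal ?k (shiftn ?m \<omega>)" and ?y = "shiftn ?m x"
  define h where "h = (if even (count_list (pre ?m x) False) then ?s \<circ> tree_a else tree_a \<circ> ?s)"
  have sec: "flip \<omega> i (pre ?m x @ w) = pre ?m x @ h w" for w
    by (simp add: flip_append h_def Let_def)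
  define z where "z = (if even (count_list (pre ?m x) False) then act tree_a ?y else ?y)"
  have s: "has_germ (shiftn ?m \<omega>) ?s z (if z = ones then ?k else Kid)"
    using has_germ_spinal has_germ_spinal_ones by auto
  have "has_germ (shiftn ?m \<omega>) h ?y (if z = ones then ?k else Kid)"
  proof (cases "even (count_list (pre ?m x) False)")
    case True
    then show ?thesis
      using has_germ_comp[OF prefixed_a prefixed_spinal has_germ_a, of "shiftn ?m \<omega>" ?k "shiftn ?m \<omega>" ?y] s
      unfolding h_def z_def by (simp only: if_True klein_mult.simps)
  next
    case False
    then have "has_germ (shiftn ?m \<omega>) ?s ?y (if z = ones then ?k else Kid)" using s by (simp add: z_def)
    moreover have "klein_mult \<kappa> Kid = \<kappa>" for \<kappa> by (cases \<kappa>) auto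
    ultimately have "has_germ (shiftn ?m \<omega>) (tree_a \<circ> ?s) ?y (if z = ones then ?k else Kid)"
      using has_germ_comp[OF prefixed_spinal prefixed_a _ has_germ_a] by metis
    moreover have "h = tree_a \<circ> ?s" unfolding h_def using False by (rule if_not_P)
    ultimately show ?thesis by (simp only:)
  qed
  from has_germ_section[OF sec this]
  have g: "has_germ \<omega> (flip \<omega> i) x (if z = ones then ?k else Kid)" .
  have "x j" if z: "z = ones" and j: "j \<ge> i + 2" for j
  proof -
    obtain n where n: "j = Suc i + Suc n" using le_Suc_ex[OF j] by auto
    have "act tree_a y (Suc n) = y (Suc n)" for y
    proof -
      have "act tree_a y (Suc n) = pre (Suc n) (shift y) ! n"
        unfolding act_def pre_Suc_Cons[of "Suc n"] by (simp add: tree_a_def)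
      then show ?thesis by (simp add: shift_def)
    qed
    then have "z (Suc n) = ?y (Suc n)" by (simp add: z_def)
    then show ?thesis using z n by (simp add: shiftn_def)
  qed
  then show ?thesis using g by (cases "z = ones") auto
qed

lemma odd_germ_flip:
  assumes "\<And>k. \<exists>j\<ge>k. \<omega> j = L1" "\<And>k. \<exists>j\<ge>k. \<omega> j = L2" "odd_germ \<omega> (flip \<omega> i) x"
  shows "\<omega> i = L0 \<and> (\<forall>j\<ge>i + 2. x j)"
proof -
  obtain \<kappa> where k: "\<kappa> \<in> {Kid, flip_letter (\<omega> i)}" "has_germ \<omega> (flip \<omega> i) x \<kappa>"
    "\<kappa> \<noteq> Kid \<longrightarrow> (\<forall>j\<ge>i + 2. x j)" using has_germ_flip by blast
  then have "\<kappa> \<in> {Kb, Kc}" using odd_germ_iff[OF assms(1,2) k(2)] assms(3) by blast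
  then show ?thesis using k by (auto simp: flip_letter_def split: if_splits)
qed

lemma finite_eventually_ones:
  "finite {x. \<forall>j\<ge>n. x j}" (is "finite ?A") and card_eventually_ones: "card {x. \<forall>j\<ge>n. x j} \<le> 2 ^ n"
proof -
  have inj: "inj_on (pre n) ?A"
  proof (rule inj_onI, rule ext)
    fix x y j assume "x \<in> ?A" "y \<in> ?A" "pre n x = pre n y"
    then show "x j = y j" by (cases "j < n") (metis nth_pre, simp)
  qed
  have sub: "pre n ` ?A \<subseteq> {w. set w \<subseteq> UNIV \<and> length w = n}" by auto
  have fin: "finite {w :: bool list. set w \<subseteq> UNIV \<and> length w = n}" by (rule finite_lists_length_eq) simp
  show "finite ?A" using inj_on_finite[OF inj sub fin] .
  have "card ?A \<le> card {w :: bool list. set w \<subseteq> UNIV \<and> length w = n}"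
    using card_inj_on_le[OF inj sub fin] .
  then show "card ?A \<le> 2 ^ n" by (simp only: card_lists_length_eq[OF finite] card_UNIV_bool)
qed

section \<open>Random products of flips\<close>

lemma inj_act:
  assumes "g \<in> carrier (grigorchuk \<omega>)" shows "inj (act g)"
proof (rule injI)
  fix x y assume eq: "act g x = act g y"
  let ?h = "m_inv (grigorchuk \<omega>) g"
  have h: "?h \<in> carrier (grigorchuk \<omega>)" using assms group.inv_closed[OF group_grigorchuk] by blast
  have "?h \<circ> g = id" using group.r_inv[OF group_grigorchuk assms] by simp
  then have "act ?h (act g z) = z" for z
    using act_comp[OF prefixed_grigorchuk[OF assms] prefixed_grigorchuk[OF h], of z] by simp
  then show "x = y" using eq by metis
qed

definition germ_set :: "(nat \<Rightarrow> letter) \<Rightarrow> (vertex \<Rightarrow> vertex) \<Rightarrow> (nat \<Rightarrow> bool) set" where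
  "germ_set \<omega> g = {x. odd_germ \<omega> g x}"

text \<open>Multiplied with increasing \<open>i\<close>: later flips do not touch the digits that earlier ones have
  randomised.\<close>
primrec flip_prod :: "(nat \<Rightarrow> letter) \<Rightarrow> nat set \<Rightarrow> nat \<Rightarrow> (vertex \<Rightarrow> vertex) pmf" where
  "flip_prod \<omega> J 0 = return_pmf id"
| "flip_prod \<omega> J (Suc i) = (if i \<in> J
     then map_pmf (\<lambda>(g, b). if b then flip \<omega> i \<circ> g else g) (pair_pmf (flip_prod \<omega> J i) (bernoulli_pmf (1 / 2)))
     else flip_prod \<omega> J i)"

lemma comp_in_grigorchuk:
  "g \<in> carrier (grigorchuk \<omega>) \<Longrightarrow> h \<in> carrier (grigorchuk \<omega>) \<Longrightarrow> h \<circ> g \<in> carrier (grigorchuk \<omega>)"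
  using monoid.m_closed[OF group.is_monoid[OF group_grigorchuk], of g \<omega> h] by (simp only: mult_grigorchuk)

lemma id_in_grigorchuk: "id \<in> carrier (grigorchuk \<omega>)"
  using monoid.one_closed[OF group.is_monoid[OF group_grigorchuk], of \<omega>] by (simp only: one_grigorchuk)

lemma flip_prod_cases:
  assumes "g \<in> set_pmf (flip_prod \<omega> J (Suc i))"
  obtains "g \<in> set_pmf (flip_prod \<omega> J i)"
    | g' where "i \<in> J" "g' \<in> set_pmf (flip_prod \<omega> J i)" "g = flip \<omega> i \<circ> g'"
  using assms by (auto split: if_splits)

lemma flip_prod_carrier: "set_pmf (flip_prod \<omega> J n) \<subseteq> carrier (grigorchuk \<omega>)"
proof (induction n)
  case 0 then show ?case using id_in_grigorchuk by (simp only: flip_prod.simps set_return_pmf) blast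
next
  case (Suc n)
  show ?case
  proof
    fix g assume "g \<in> set_pmf (flip_prod \<omega> J (Suc n))"
    then show "g \<in> carrier (grigorchuk \<omega>)"
    proof (cases rule: flip_prod_cases)
      case 1 then show ?thesis using Suc by blast
    next
      case (2 g') then show ?thesis using Suc comp_in_grigorchuk flip_in_grigorchuk by blast
    qed
  qed
qed

lemma grig_length_flip_prod:
  "g \<in> set_pmf (flip_prod \<omega> J n) \<Longrightarrow> real (grig_length \<omega> g) \<le> 4 * grig_L \<omega> n"
proof (induction n arbitrary: g)
  case 0
  have "grig_length \<omega> (word_prod []) \<le> length ([] :: (vertex \<Rightarrow> vertex) list)" by (rule grig_length_le) simp
  then have "grig_length \<omega> id = 0" by (simp only: word_prod_simps list.size)
  moreover have "g = id" using 0 by (simp only: flip_prod.simps set_return_pmf singleton_iff)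
  ultimately show ?case using grig_L_ge[of \<omega> 0] by (simp only: of_nat_0)
next
  case (Suc n)
  have L: "2 * grig_L \<omega> n \<le> grig_L \<omega> (Suc n)" "grig_L \<omega> n \<ge> 3" using grig_L_Suc grig_L_ge by auto
  from Suc.prems show ?case
  proof (cases rule: flip_prod_cases)
    case 1 then show ?thesis using Suc.IH[OF 1] L by simp
  next
    case (2 g')
    have "grig_length \<omega> g \<le> grig_length \<omega> g' + grig_length \<omega> (flip \<omega> n)"
      unfolding 2(3) by (rule grig_length_mult) (use 2(2) flip_prod_carrier flip_in_grigorchuk in blast)+
    then show ?thesis using Suc.IH[OF 2(2)] grig_length_flip[of \<omega> n] L by linarith
  qed
qed

text \<open>By the cocycle identity an odd germ of the product comes from one of the factors, and \<open>g\<close> acts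
  injectively.\<close>
lemma card_germ_set_comp:
  assumes inf: "\<And>k. \<exists>j\<ge>k. \<omega> j = L1" "\<And>k. \<exists>j\<ge>k. \<omega> j = L2"
    and G: "g \<in> carrier (grigorchuk \<omega>)" "h \<in> carrier (grigorchuk \<omega>)"
    and fin: "finite (germ_set \<omega> g)" "finite (germ_set \<omega> h)"
  shows "finite (germ_set \<omega> (h \<circ> g))" "card (germ_set \<omega> (h \<circ> g)) \<le> card (germ_set \<omega> g) + card (germ_set \<omega> h)"
proof -
  have sub: "germ_set \<omega> (h \<circ> g) \<subseteq> germ_set \<omega> g \<union> act g -` germ_set \<omega> h"
    using odd_germ_comp[OF inf G] by (auto simp: germ_set_def)
  have f2: "finite (act g -` germ_set \<omega> h)" by (rule finite_vimageI[OF fin(2) inj_act[OF G(1)]])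
  show "finite (germ_set \<omega> (h \<circ> g))" by (rule finite_subset[OF sub]) (use fin f2 in auto)
  have "card (germ_set \<omega> (h \<circ> g)) \<le> card (germ_set \<omega> g \<union> act g -` germ_set \<omega> h)"
    by (rule card_mono[OF _ sub]) (use fin f2 in auto)
  also have "\<dots> \<le> card (germ_set \<omega> g) + card (act g -` germ_set \<omega> h)" by (rule card_Un_le)
  also have "card (act g -` germ_set \<omega> h) \<le> card (germ_set \<omega> h)"
    by (rule card_inj_on_le[OF inj_on_subset[OF inj_act[OF G(1)]] _ fin(2)]) auto
  finally show "card (germ_set \<omega> (h \<circ> g)) \<le> card (germ_set \<omega> g) + card (germ_set \<omega> h)" by simp
qed

lemma germ_set_flip:
  assumes inf: "\<And>k. \<exists>j\<ge>k. \<omega> j = L1" "\<And>k. \<exists>j\<ge>k. \<omega> j = L2"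
  shows "finite (germ_set \<omega> (flip \<omega> i))" "card (germ_set \<omega> (flip \<omega> i)) \<le> (if \<omega> i = L0 then 2 ^ (i + 2) else 0)"
proof -
  have sub: "germ_set \<omega> (flip \<omega> i) \<subseteq> (if \<omega> i = L0 then {x. \<forall>j\<ge>i + 2. x j} else {})"
  proof
    fix x assume "x \<in> germ_set \<omega> (flip \<omega> i)"
    then have "\<omega> i = L0 \<and> (\<forall>j\<ge>i + 2. x j)" unfolding germ_set_def mem_Collect_eq by (rule odd_germ_flip[OF inf])
    then show "x \<in> (if \<omega> i = L0 then {x. \<forall>j\<ge>i + 2. x j} else {})" by simp
  qed
  then show fin: "finite (germ_set \<omega> (flip \<omega> i))"
    by (rule finite_subset) (simp add: finite_eventually_ones)
  show "card (germ_set \<omega> (flip \<omega> i)) \<le> (if \<omega> i = L0 then 2 ^ (i + 2) else 0)"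
  proof (cases "\<omega> i = L0")
    case True
    then have "card (germ_set \<omega> (flip \<omega> i)) \<le> card {x. \<forall>j\<ge>i + 2. x j}"
      using sub finite_eventually_ones by (intro card_mono) auto
    then show ?thesis using card_eventually_ones[of "i + 2"] True by simp
  qed (use sub in simp)
qed

text \<open>Only the flips with \<open>\<omega>\<^sub>i = 0\<close> have odd germs, at most \<open>2\<^bsup>i+2\<^esup>\<close> each. The bound proved by induction is
  their geometric sum \<open>2\<^bsup>m+2\<^esup> - 4\<close>.\<close>
lemma germ_set_flip_prod:
  assumes inf: "\<And>k. \<exists>j\<ge>k. \<omega> j = L1" "\<And>k. \<exists>j\<ge>k. \<omega> j = L2"
    and J: "\<And>i. i \<in> J \<Longrightarrow> \<omega> i = L0 \<Longrightarrow> i < m"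
    and g: "g \<in> set_pmf (flip_prod \<omega> J n)"
  shows "finite (germ_set \<omega> g) \<and> card (germ_set \<omega> g) \<le> 2 ^ (m + 2)"
proof -
  have "finite (germ_set \<omega> g) \<and> card (germ_set \<omega> g) \<le> 2 ^ (min m n + 2) - 4"
    using g
  proof (induction n arbitrary: g)
    case 0
    then have "g = id" by (simp only: flip_prod.simps set_return_pmf singleton_iff)
    have "germ_set \<omega> g = {}"
      using odd_germ_iff[OF inf has_germ_id] by (auto simp: germ_set_def \<open>g = id\<close>)
    then show ?case by simp
  next
    case (Suc n)
    have mono: "(2::nat) ^ (min m n + 2) \<le> 2 ^ (min m (Suc n) + 2)" by (intro power_increasing) auto
    from Suc.prems show ?case
    proof (cases rule: flip_prod_cases)
      case 1 then show ?thesis using Suc.IH[OF 1] mono by linarith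
    next
      case (2 g')
      note IH = Suc.IH[OF 2(2)]
      have c: "g' \<in> carrier (grigorchuk \<omega>)" using 2(2) flip_prod_carrier by blast
      note comp = card_germ_set_comp[OF inf c flip_in_grigorchuk _ germ_set_flip(1)[OF inf]]
      show ?thesis
      proof (cases "\<omega> n = L0")
        case True
        then have "n < m" using J 2(1) by blast
        then have "min m n = n" "min m (Suc n) = Suc n" by auto
        moreover have "card (germ_set \<omega> (flip \<omega> n)) \<le> 2 ^ (n + 2)" using germ_set_flip(2)[OF inf, of n] True by simp
        moreover have "(4::nat) \<le> 2 ^ (n + 2)" by simp
        moreover have "card (germ_set \<omega> g') \<le> 2 ^ (n + 2) - 4" using IH \<open>min m n = n\<close> by simp
        moreover have "(2::nat) ^ (Suc n + 2) = 2 ^ (n + 2) + 2 ^ (n + 2)" by simp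
        moreover have "finite (germ_set \<omega> g)" "card (germ_set \<omega> g) \<le> card (germ_set \<omega> g') + card (germ_set \<omega> (flip \<omega> n))"
          using comp IH unfolding 2(3) by blast+
        ultimately show ?thesis unfolding \<open>min m (Suc n) = Suc n\<close> by linarith
      next
        case False
        then have "card (germ_set \<omega> (flip \<omega> n)) = 0" using germ_set_flip(2)[OF inf, of n] by simp
        moreover have "finite (germ_set \<omega> g)" "card (germ_set \<omega> g) \<le> card (germ_set \<omega> g') + card (germ_set \<omega> (flip \<omega> n))"
          using comp IH unfolding 2(3) by blast+
        ultimately show ?thesis using IH mono by linarith
      qed
    qed
  qed
  moreover have "(2::nat) ^ (min m n + 2) \<le> 2 ^ (m + 2)" by (intro power_increasing) auto
  ultimately show ?thesis by linarith
qed

text \<open>Given the image of the first \<open>n + 1\<close> digits, which the flip at \<open>n\<close> preserves, exactly one of the two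
  values of its coin produces the prescribed next digit.\<close>
lemma flip_prod_spread_prefix:
  "measure_pmf.prob (flip_prod \<omega> J n) {g. pre (Suc n) (act g x) = p} \<le> (1 / 2) ^ card (J \<inter> {..<n})"
proof (induction n arbitrary: p)
  case 0 then show ?case by simp
next
  case (Suc n)
  show ?case
  proof (cases "n \<in> J")
    case False
    then have J: "J \<inter> {..<Suc n} = J \<inter> {..<n}" by (auto simp: less_Suc_eq)
    have "measure_pmf.prob (flip_prod \<omega> J (Suc n)) {g. pre (Suc (Suc n)) (act g x) = p}
        \<le> measure_pmf.prob (flip_prod \<omega> J n) {g. pre (Suc n) (act g x) = butlast p}"
      using False by (auto simp: pre_Suc[of "Suc n"] intro!: measure_pmf.finite_measure_mono)
    then show ?thesis using Suc[of "butlast p"] J by simp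
  next
    case True
    then have J: "J \<inter> {..<Suc n} = insert n (J \<inter> {..<n})" by (auto simp: less_Suc_eq)
    let ?Q = "pair_pmf (flip_prod \<omega> J n) (bernoulli_pmf (1 / 2))"
    let ?f = "\<lambda>(g, b). if b then flip \<omega> n \<circ> g else g"
    define A where "A = {g. pre (Suc n) (act g x) = butlast p}"
    have "measure_pmf.prob (flip_prod \<omega> J (Suc n)) {g. pre (Suc (Suc n)) (act g x) = p}
        = measure_pmf.prob ?Q (?f -` {g. pre (Suc (Suc n)) (act g x) = p})"
      using True by simp
    also have "\<dots> \<le> measure_pmf.prob ?Q {(g, b). g \<in> A \<and> b = (act g x (Suc n) \<noteq> last p)}"
    proof (rule prob_mono_support)
      fix z assume z: "z \<in> set_pmf ?Q" "z \<in> ?f -` {g. pre (Suc (Suc n)) (act g x) = p}"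
      obtain g b where gb: "z = (g, b)" by (cases z)
      have g: "prefixed g" using z(1) flip_prod_carrier[of \<omega> J n] prefixed_grigorchuk[of g \<omega>] by (auto simp: gb)
      have f: "prefixed (flip \<omega> n)" using prefixed_grigorchuk flip_in_grigorchuk by blast
      have "act (?f z) x = (if b then act (flip \<omega> n) (act g x) else act g x)"
        by (simp add: gb act_comp[OF g f])
      moreover have "pre (Suc (Suc n)) (act (?f z) x) = p" using z(2) by simp
      ultimately have p: "p = (if b then pre (Suc n) (act (flip \<omega> n) (act g x)) @ [\<not> act g x (Suc n)]
          else pre (Suc n) (act g x) @ [act g x (Suc n)])"
        by (auto simp: pre_Suc[of "Suc n"] act_flip_digit)
      have "pre (Suc n) (act (flip \<omega> n) (act g x)) = pre (Suc n) (act g x)"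
        by (rule nth_equalityI) (auto simp: act_flip_low simp del: nth_append)
      then show "z \<in> {(g, b). g \<in> A \<and> b = (act g x (Suc n) \<noteq> last p)}"
        unfolding gb A_def p by auto
    qed
    also have "\<dots> = measure_pmf.expectation (flip_prod \<omega> J n) (\<lambda>g. indicator A g * (1 / 2))"
      unfolding prob_pair_pmf(1)
    proof (intro integral_cong_AE AE_pmfI)
      fix g
      show "measure_pmf.prob (bernoulli_pmf (1 / 2)) {b. (g, b) \<in> {(g, b). g \<in> A \<and> b = (act g x (Suc n) \<noteq> last p)}}
          = indicator A g * (1 / 2)"
        by (cases "g \<in> A") (simp_all add: measure_pmf_single)
    qed auto
    also have "\<dots> = 1 / 2 * measure_pmf.prob (flip_prod \<omega> J n) A" by simp
    also have "\<dots> \<le> 1 / 2 * (1 / 2) ^ card (J \<inter> {..<n})" using Suc[of "butlast p"] by (simp add: A_def)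
    finally show ?thesis using J by simp
  qed
qed

lemma flip_prod_spread:
  "measure_pmf.prob (flip_prod \<omega> J n) {g. act g x = y} \<le> (1 / 2) ^ card (J \<inter> {..<n})"
  by (rule order_trans[OF measure_pmf.finite_measure_mono flip_prod_spread_prefix[of \<omega> J n x "pre (Suc n) y"]]) auto

lemma pmf_map_ge: "pmf p x \<le> pmf (map_pmf f p) (f x)"
proof -
  have "measure_pmf.prob p {x} \<le> measure_pmf.prob p (f -` {f x})"
    by (intro measure_pmf.finite_measure_mono) auto
  then show ?thesis by (simp only: pmf_map measure_pmf_single)
qed

text \<open>This bounds the logarithms in the entropy of the measure by a multiple of the level.\<close>
lemma pmf_flip_prod_ge:
  "g \<in> set_pmf (flip_prod \<omega> J n) \<Longrightarrow> pmf (flip_prod \<omega> J n) g \<ge> (1 / 2) ^ n"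
proof (induction n arbitrary: g)
  case (Suc n)
  show ?case
  proof (cases "n \<in> J")
    case True
    let ?f = "\<lambda>(g, b). if b then flip \<omega> n \<circ> g else g"
    obtain g' b where g': "g' \<in> set_pmf (flip_prod \<omega> J n)" "g = ?f (g', b)" using Suc.prems True by auto
    have "(1 / 2) ^ Suc n \<le> pmf (flip_prod \<omega> J n) g' * (1 / 2)" using Suc.IH[OF g'(1)] by simp
    also have "\<dots> = pmf (pair_pmf (flip_prod \<omega> J n) (bernoulli_pmf (1 / 2))) (g', b)" by (simp add: pmf_pair)
    also have "\<dots> \<le> pmf (flip_prod \<omega> J (Suc n)) g"
      using pmf_map_ge[of "pair_pmf (flip_prod \<omega> J n) (bernoulli_pmf (1 / 2))" "(g', b)" ?f] True g'(2) by simp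
    finally show ?thesis .
  next
    case False
    then have "(1 / 2) ^ n \<le> pmf (flip_prod \<omega> J (Suc n)) g" using Suc.IH[of g] Suc.prems by simp
    moreover have "(1 / 2 :: real) ^ Suc n \<le> (1 / 2) ^ n" by simp
    ultimately show ?thesis by linarith
  qed
qed simp

subsection \<open>Symmetrisation\<close>

text \<open>Level \<open>0\<close> puts the generators into the support; for \<open>n > 0\<close> the product of flips is inverted with
  probability \<open>1/2\<close>.\<close>
definition level_law :: "(nat \<Rightarrow> letter) \<Rightarrow> (nat \<Rightarrow> nat set) \<Rightarrow> nat \<Rightarrow> (vertex \<Rightarrow> vertex) pmf" where
  "level_law \<omega> J n = (if n = 0 then pmf_of_set (grig_gens \<omega>)
     else map_pmf (\<lambda>(b, g). if b then m_inv (grigorchuk \<omega>) g else g)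
            (pair_pmf (bernoulli_pmf (1 / 2)) (flip_prod \<omega> (J n) n)))"

lemma grig_gens_finite [simp]: "finite (grig_gens \<omega>)" "grig_gens \<omega> \<noteq> {}"
  by (simp_all add: grig_gens_def)

lemma level_law_cases:
  assumes "h \<in> set_pmf (level_law \<omega> J n)"
  obtains "n = 0" "h \<in> grig_gens \<omega>"
    | g where "n > 0" "g \<in> set_pmf (flip_prod \<omega> (J n) n)" "h = g \<or> h = m_inv (grigorchuk \<omega>) g"
  using assms by (cases "n = 0") (auto simp: level_law_def split: if_splits)

lemma level_law_carrier: "set_pmf (level_law \<omega> J n) \<subseteq> carrier (grigorchuk \<omega>)"
proof
  fix h assume "h \<in> set_pmf (level_law \<omega> J n)"
  then show "h \<in> carrier (grigorchuk \<omega>)"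
  proof (cases rule: level_law_cases)
    case 1 then show ?thesis using gens_in_grigorchuk by blast
  next
    case (2 g) then show ?thesis using flip_prod_carrier group.inv_closed[OF group_grigorchuk] by blast
  qed
qed

lemma grig_length_level_law:
  assumes "h \<in> set_pmf (level_law \<omega> J n)" shows "real (grig_length \<omega> h) \<le> 4 * grig_L \<omega> n"
  using assms
proof (cases rule: level_law_cases)
  case 1
  then have "grig_length \<omega> (word_prod [h]) \<le> length [h]" by (intro grig_length_le) simp
  moreover have "word_prod [h] = h" by (simp only: word_prod_simps id_comp)
  ultimately have "grig_length \<omega> h \<le> 1" by simp
  then show ?thesis using grig_L_ge[of \<omega> n] by linarith
next
  case (2 g)
  then have "g \<in> carrier (grigorchuk \<omega>)" using flip_prod_carrier by blast
  then have "grig_length \<omega> h \<le> grig_length \<omega> g" using 2(3) grig_length_inv by auto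
  then show ?thesis using grig_length_flip_prod[OF 2(2)] by linarith
qed

lemma germ_set_inv:
  assumes inf: "\<And>k. \<exists>j\<ge>k. \<omega> j = L1" "\<And>k. \<exists>j\<ge>k. \<omega> j = L2"
    and g: "g \<in> carrier (grigorchuk \<omega>)" and fin: "finite (germ_set \<omega> g)"
  shows "finite (germ_set \<omega> (m_inv (grigorchuk \<omega>) g)) \<and> card (germ_set \<omega> (m_inv (grigorchuk \<omega>) g)) \<le> card (germ_set \<omega> g)"
proof -
  let ?h = "m_inv (grigorchuk \<omega>) g"
  have h: "?h \<in> carrier (grigorchuk \<omega>)" using g group.inv_closed[OF group_grigorchuk] by blast
  have gh: "g \<circ> ?h = id" using group.l_inv[OF group_grigorchuk g] by simp
  have "act ?h y \<in> germ_set \<omega> g" if "y \<in> germ_set \<omega> ?h" for y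
    using odd_germ_comp[OF inf h g, of y] that odd_germ_iff[OF inf has_germ_id, of y] unfolding gh germ_set_def by auto
  then have "germ_set \<omega> ?h \<subseteq> act ?h -` germ_set \<omega> g" by blast
  moreover have f2: "finite (act ?h -` germ_set \<omega> g)" by (rule finite_vimageI[OF fin inj_act[OF h]])
  moreover have "card (act ?h -` germ_set \<omega> g) \<le> card (germ_set \<omega> g)"
    by (rule card_inj_on_le[OF inj_on_subset[OF inj_act[OF h]] _ fin]) auto
  ultimately show ?thesis by (meson card_mono finite_subset le_trans)
qed

lemma germ_set_level_law:
  assumes inf: "\<And>k. \<exists>j\<ge>k. \<omega> j = L1" "\<And>k. \<exists>j\<ge>k. \<omega> j = L2"
    and J: "\<And>i. i \<in> J n \<Longrightarrow> \<omega> i = L0 \<Longrightarrow> i < m n"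
    and h: "h \<in> set_pmf (level_law \<omega> J n)"
  shows "finite (germ_set \<omega> h) \<and> card (germ_set \<omega> h) \<le> 2 ^ (m n + 2)"
  using h
proof (cases rule: level_law_cases)
  case 1
  have "germ_set \<omega> h \<subseteq> {ones}"
  proof
    fix x assume "x \<in> germ_set \<omega> h"
    then have o: "odd_germ \<omega> h x" by (simp add: germ_set_def)
    have "x = ones"
    proof (rule ccontr)
      assume "x \<noteq> ones"
      then have "has_germ \<omega> h x Kid" using 1(2) has_germ_a[of \<omega> x] has_germ_spinal[of x \<omega>] by (auto simp: grig_gens_def)
      then show False using odd_germ_iff[OF inf] o by blast
    qed
    then show "x \<in> {ones}" by simp
  qed
  then have "finite (germ_set \<omega> h)" "card (germ_set \<omega> h) \<le> 1"
    using finite_subset card_mono[of "{ones}"] by auto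
  moreover have "(1::nat) \<le> 2 ^ (m n + 2)" by simp
  ultimately show ?thesis by linarith
next
  case (2 g)
  have g: "finite (germ_set \<omega> g)" "card (germ_set \<omega> g) \<le> 2 ^ (m n + 2)"
    using germ_set_flip_prod[OF inf _ 2(2), of "m n"] J by auto
  have c: "g \<in> carrier (grigorchuk \<omega>)" using 2(2) flip_prod_carrier by blast
  show ?thesis using 2(3) g germ_set_inv[OF inf c g(1)] by auto
qed

lemma level_law_spread:
  assumes "n > 0"
  shows "measure_pmf.prob (level_law \<omega> J n) {g. act g x = y} \<le> (1 / 2) ^ card (J n \<inter> {..<n})"
proof -
  let ?V = "flip_prod \<omega> (J n) n"
  let ?inv = "m_inv (grigorchuk \<omega>)"
  have "measure_pmf.prob (level_law \<omega> J n) {g. act g x = y}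
      = measure_pmf.expectation (bernoulli_pmf (1 / 2)) (\<lambda>b. measure_pmf.prob ?V {g. act (if b then ?inv g else g) x = y})"
    using assms unfolding level_law_def by (simp add: prob_pair_pmf(1) vimage_def del: integral_bernoulli_pmf)
  also have "\<dots> \<le> (1 / 2) ^ card (J n \<inter> {..<n})"
  proof (intro expectation_bounded_le conjI)
    fix b
    show "measure_pmf.prob ?V {g. act (if b then ?inv g else g) x = y} \<le> (1 / 2) ^ card (J n \<inter> {..<n})"
    proof (cases b)
      case True
      have "measure_pmf.prob ?V {g. act (if b then ?inv g else g) x = y} \<le> measure_pmf.prob ?V {g. act g y = x}"
      proof (rule prob_mono_support)
        fix g assume g: "g \<in> set_pmf ?V" "g \<in> {g. act (if b then ?inv g else g) x = y}"
        have c: "g \<in> carrier (grigorchuk \<omega>)" using g(1) flip_prod_carrier by blast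
        have h: "?inv g \<in> carrier (grigorchuk \<omega>)" using c group.inv_closed[OF group_grigorchuk] by blast
        have gh: "g \<circ> ?inv g = id" using group.l_inv[OF group_grigorchuk c] by simp
        have "act g (act (?inv g) x) = x"
          using act_comp[OF prefixed_grigorchuk[OF h] prefixed_grigorchuk[OF c], of x] unfolding gh by simp
        then show "g \<in> {g. act g y = x}" using g(2) True by simp
      qed
      then show ?thesis using flip_prod_spread[of \<omega> "J n" n y x] by linarith
    qed (use flip_prod_spread in simp)
  qed simp
  finally show ?thesis .
qed

lemma pmf_level_law_ge:
  assumes "h \<in> set_pmf (level_law \<omega> J n)" shows "pmf (level_law \<omega> J n) h \<ge> (1 / 2) ^ (n + 2)"
proof (cases "n = 0")
  case True
  have "card (grig_gens \<omega>) \<le> 4" unfolding grig_gens_def by (rule order_trans[OF card_length[of "[_, _, _, _]", simplified]]) simp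
  moreover have "card (grig_gens \<omega>) > 0" by (simp add: card_gt_0_iff)
  ultimately show ?thesis using assms True by (simp add: level_law_def field_simps)
next
  case False
  let ?f = "\<lambda>(b, g). if b then m_inv (grigorchuk \<omega>) g else g"
  let ?Q = "pair_pmf (bernoulli_pmf (1 / 2)) (flip_prod \<omega> (J n) n)"
  obtain b g where g: "g \<in> set_pmf (flip_prod \<omega> (J n) n)" "h = ?f (b, g)"
    using assms False by (auto simp: level_law_def)
  have "(1 / 2) ^ (n + 2) \<le> (1 / 2 :: real) * (1 / 2) ^ n" by simp
  also have "\<dots> \<le> pmf ?Q (b, g)" using pmf_flip_prod_ge[OF g(1)] by (simp add: pmf_pair)
  also have "\<dots> \<le> pmf (level_law \<omega> J n) h"
    using pmf_map_ge[of ?Q "(b, g)" ?f] False g(2) by (simp add: level_law_def)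
  finally show ?thesis .
qed

lemma map_inv_level_law: "map_pmf (m_inv (grigorchuk \<omega>)) (level_law \<omega> J n) = level_law \<omega> J n"
proof (cases "n = 0")
  case True
  have "map_pmf (m_inv (grigorchuk \<omega>)) (pmf_of_set (grig_gens \<omega>)) = map_pmf (\<lambda>g. g) (pmf_of_set (grig_gens \<omega>))"
    by (rule map_pmf_cong) (auto simp: inv_gen)
  then show ?thesis using True by (simp add: level_law_def)
next
  case False
  let ?inv = "m_inv (grigorchuk \<omega>)"
  let ?f = "\<lambda>(b, g). if b then ?inv g else g"
  let ?V = "flip_prod \<omega> (J n) n"
  let ?Q = "pair_pmf (bernoulli_pmf (1 / 2)) ?V"
  have not: "map_pmf Not (bernoulli_pmf (1 / 2)) = bernoulli_pmf (1 / 2)"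
  proof (rule pmf_eqI)
    fix b show "pmf (map_pmf Not (bernoulli_pmf (1 / 2))) b = pmf (bernoulli_pmf (1 / 2)) b"
      using pmf_map_inj'[of Not "bernoulli_pmf (1 / 2)" "\<not> b"] by (simp add: inj_def)
  qed
  have "map_pmf ?inv (map_pmf ?f ?Q) = map_pmf (\<lambda>(b, g). ?f (\<not> b, g)) ?Q"
    unfolding map_pmf_comp
  proof (rule map_pmf_cong)
    fix z assume "z \<in> set_pmf ?Q"
    then have "snd z \<in> carrier (grigorchuk \<omega>)" using flip_prod_carrier[of \<omega> "J n" n] by auto
    then have "?inv (?inv (snd z)) = snd z" by (rule group.inv_inv[OF group_grigorchuk])
    then show "?inv (?f z) = (case z of (b, g) \<Rightarrow> ?f (\<not> b, g))" by (cases z) auto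
  qed simp
  also have "\<dots> = map_pmf ?f (pair_pmf (map_pmf Not (bernoulli_pmf (1 / 2))) ?V)"
    unfolding pair_map_pmf1 map_pmf_comp by (rule map_pmf_cong) auto
  also have "\<dots> = map_pmf ?f ?Q" by (simp only: not)
  finally show ?thesis using False by (simp add: level_law_def)
qed

section \<open>Mixtures over levels\<close>

lemma
  fixes F :: "'b \<Rightarrow> real" and \<phi> :: "nat \<Rightarrow> real"
  assumes F: "\<And>n g. g \<in> set_pmf (\<nu> n) \<Longrightarrow> 0 \<le> F g \<and> F g \<le> \<phi> n"
    and phi: "\<And>n. 0 \<le> \<phi> n" "summable (\<lambda>n. pmf \<rho> n * \<phi> n)"
  shows integrable_mixture: "integrable (measure_pmf (bind_pmf \<rho> \<nu>)) F"
    and expectation_mixture_le: "measure_pmf.expectation (bind_pmf \<rho> \<nu>) F \<le> (\<Sum>n. pmf \<rho> n * \<phi> n)"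
proof -
  have "(\<integral>\<^sup>+g. ennreal (F g) \<partial>measure_pmf (bind_pmf \<rho> \<nu>)) = (\<integral>\<^sup>+n. \<integral>\<^sup>+g. ennreal (F g) \<partial>measure_pmf (\<nu> n) \<partial>measure_pmf \<rho>)"
    by simp
  also have "\<dots> \<le> (\<integral>\<^sup>+n. ennreal (\<phi> n) \<partial>measure_pmf \<rho>)"
  proof (rule nn_integral_mono)
    fix n
    have "(\<integral>\<^sup>+g. ennreal (F g) \<partial>measure_pmf (\<nu> n)) \<le> (\<integral>\<^sup>+g. ennreal (\<phi> n) \<partial>measure_pmf (\<nu> n))"
      by (intro nn_integral_mono_AE AE_pmfI ennreal_leI) (use F in blast)
    then show "(\<integral>\<^sup>+g. ennreal (F g) \<partial>measure_pmf (\<nu> n)) \<le> ennreal (\<phi> n)" by simp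
  qed
  also have "\<dots> = (\<Sum>n. ennreal (pmf \<rho> n * \<phi> n))"
    by (simp add: nn_integral_measure_pmf nn_integral_count_space_nat ennreal_mult phi)
  also have "\<dots> = ennreal (\<Sum>n. pmf \<rho> n * \<phi> n)" by (rule suminf_ennreal2) (use phi in auto)
  finally have le: "(\<integral>\<^sup>+g. ennreal (F g) \<partial>measure_pmf (bind_pmf \<rho> \<nu>)) \<le> ennreal (\<Sum>n. pmf \<rho> n * \<phi> n)" .
  have nonneg: "AE g in measure_pmf (bind_pmf \<rho> \<nu>). 0 \<le> F g" using F by (intro AE_pmfI) auto
  show i: "integrable (measure_pmf (bind_pmf \<rho> \<nu>)) F"
    by (intro integrableI_nonneg nonneg) (use le in \<open>auto intro: le_less_trans simp del: nn_integral_bind_pmf\<close>)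
  have "0 \<le> (\<Sum>n. pmf \<rho> n * \<phi> n)" by (intro suminf_nonneg) (use phi in auto)
  then show "measure_pmf.expectation (bind_pmf \<rho> \<nu>) F \<le> (\<Sum>n. pmf \<rho> n * \<phi> n)"
    using le nn_integral_eq_integral[OF i nonneg] by (simp add: ennreal_le_iff del: nn_integral_bind_pmf)
qed

text \<open>The \<open>l\<close>-th powers of the spreading bounds from \<open>spread_mu\<close>: the first summand bounds the probability
  that a level has not yet been used, the second one the mass of a point after it has been used.\<close>
lemma summable_spread:
  fixes c \<kappa> a l :: real
  assumes "c > 0" "\<kappa> > 0" "a > 0" "l > 0" "a * l > 1"
  shows "summable (\<lambda>N. (exp (- c * real N powr \<kappa>) + 4 * real N powr (- a)) powr l)"
proof (rule summable_comparison_test_ev)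
  have "\<forall>\<^sub>F N in sequentially. exp (- c * real N powr \<kappa>) \<le> real N powr (- a)"
    using assms by real_asymp
  then show "\<forall>\<^sub>F N in sequentially. norm ((exp (- c * real N powr \<kappa>) + 4 * real N powr (- a)) powr l)
      \<le> 5 powr l * real N powr (- (a * l))"
  proof eventually_elim
    case (elim N)
    have "(exp (- c * real N powr \<kappa>) + 4 * real N powr (- a)) powr l \<le> (5 * real N powr (- a)) powr l"
      using elim assms by (intro powr_mono2) auto
    also have "\<dots> = 5 powr l * real N powr (- (a * l))" by (simp add: powr_mult powr_powr)
    finally show ?case by simp
  qed
  show "summable (\<lambda>N. 5 powr l * real N powr (- (a * l)))"
    using assms by (intro summable_mult) (simp add: summable_real_powr_iff)
qed

text \<open>Half of the exponential decay absorbs the polynomial factor.\<close>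
lemma summable_square_geometric:
  fixes r :: real
  assumes "0 < r" "r < 1"
  shows "summable (\<lambda>n. r ^ n * (real n + 1)\<^sup>2)"
proof (rule summable_comparison_test_ev)
  have "\<forall>\<^sub>F n in sequentially. (real n + 1)\<^sup>2 * sqrt r ^ n \<le> 1"
    using assms by real_asymp
  then show "\<forall>\<^sub>F n in sequentially. norm (r ^ n * (real n + 1)\<^sup>2) \<le> sqrt r ^ n"
  proof eventually_elim
    case (elim n)
    have "r ^ n = sqrt r ^ n * sqrt r ^ n" using assms by (simp add: power_mult_distrib[symmetric])
    then have "r ^ n * (real n + 1)\<^sup>2 = sqrt r ^ n * ((real n + 1)\<^sup>2 * sqrt r ^ n)" by simp
    also have "\<dots> \<le> sqrt r ^ n * 1" using elim assms by (intro mult_left_mono) auto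
    finally show ?case using assms by simp
  qed
  show "summable (\<lambda>n. sqrt r ^ n)" using assms by (intro summable_geometric) auto
qed

section \<open>The heavy-tailed measure\<close>

lemma card_nonzero_letters:
  assumes "Fr D \<omega>" shows "card ({i. \<omega> i \<noteq> L0} \<inter> {m..<m + 2 * D * k}) \<ge> k"
proof (induction k)
  case (Suc k)
  obtain j where j: "j \<ge> m + 2 * D * k" "j < m + 2 * D * k + 2 * D" "\<omega> j = L1"
    using Fr_letters(1)[OF assms, of "m + 2 * D * k"] by blast
  let ?A = "{i. \<omega> i \<noteq> L0} \<inter> {m..<m + 2 * D * k}"
  have "insert j ?A \<subseteq> {i. \<omega> i \<noteq> L0} \<inter> {m..<m + 2 * D * Suc k}" using j by auto
  then have "card (insert j ?A) \<le> card ({i. \<omega> i \<noteq> L0} \<inter> {m..<m + 2 * D * Suc k})"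
    by (intro card_mono) auto
  moreover have "card (insert j ?A) = Suc (card ?A)" using j by (intro card_insert_disjoint) auto
  ultimately show ?case using Suc by linarith
qed simp

text \<open>The bound \<open>\<beta> \<ge> 1/2\<close> keeps \<open>\<beta>\<close> away from \<open>0\<close>; smaller exponents follow by monotonicity.\<close>
locale heavy_tail =
  fixes \<omega> :: "nat \<Rightarrow> letter" and D :: nat and \<beta> :: real
  assumes Fr: "Fr D \<omega>" and beta: "1 / 2 \<le> \<beta>" "\<beta> < 1"
begin

definition r :: real where "r = 2 powr (- \<beta>)"

text \<open>The flips used at level \<open>n\<close>. Those at letters \<open>0\<close> have odd germs and stop at \<open>\<lfloor>\<beta>n\<rfloor>\<close>.\<close>
definition J :: "nat \<Rightarrow> nat set" where "J n = {i. \<omega> i \<noteq> L0 \<or> i < nat \<lfloor>\<beta> * real n\<rfloor>}"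

definition \<mu> :: "(vertex \<Rightarrow> vertex) pmf" where "\<mu> = bind_pmf (geometric_pmf (1 - r)) (level_law \<omega> J)"

lemma infinitely_many_L1: "\<exists>j\<ge>k. \<omega> j = L1" and infinitely_many_L2: "\<exists>j\<ge>k. \<omega> j = L2"
  using Fr_letters[OF Fr] by blast+

lemma D_pos: "D > 0"
  using Fr_letters(1)[OF Fr, of 0] by (cases D) auto

lemma r_bounds: "1 / 2 < r" "r < 1"
proof -
  have "2 powr (- 1) < 2 powr (- \<beta>)" using beta by (intro powr_less_mono) auto
  then show "1 / 2 < r" by (simp add: r_def powr_minus_divide)
  have "2 powr (- \<beta>) < 2 powr 0" using beta by (intro powr_less_mono) auto
  then show "r < 1" by (simp add: r_def)
qed

lemma r_power: "r ^ n = (2 ^ n) powr (- \<beta>)"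
  by (simp add: r_def powr_realpow[symmetric] powr_powr mult.commute)

lemma pmf_level: "pmf (geometric_pmf (1 - r)) n = r ^ n * (1 - r)"
  using r_bounds by simp

lemma set_level: "set_pmf (geometric_pmf (1 - r)) = UNIV"
  using r_bounds by (intro set_pmf_geometric) auto

lemma mu_carrier: "set_pmf \<mu> \<subseteq> carrier (grigorchuk \<omega>)"
  unfolding \<mu>_def using level_law_carrier by (auto simp: set_level simp del: set_pmf_geometric)

lemma gens_subset_mu: "grig_gens \<omega> \<subseteq> set_pmf \<mu>"
proof -
  have "set_pmf (level_law \<omega> J 0) = grig_gens \<omega>" by (simp add: level_law_def)
  then show ?thesis unfolding \<mu>_def by (auto simp: set_level simp del: set_pmf_geometric)
qed

lemma nondegenerate_mu: "nondegenerate (grigorchuk \<omega>) \<mu>"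
  unfolding nondegenerate_def by (rule semigroup_generated_grigorchuk[OF gens_subset_mu mu_carrier])

lemma symmetric_mu: "symmetric (grigorchuk \<omega>) \<mu>"
  unfolding symmetric_def
proof
  fix g assume g: "g \<in> carrier (grigorchuk \<omega>)"
  let ?inv = "m_inv (grigorchuk \<omega>)"
  have inv: "map_pmf ?inv \<mu> = \<mu>" unfolding \<mu>_def map_bind_pmf map_inv_level_law ..
  have "pmf \<mu> (?inv g) = measure_pmf.prob \<mu> (?inv -` {?inv g})" by (subst inv[symmetric]) (rule pmf_map)
  also have "\<dots> = measure_pmf.prob \<mu> {g}"
  proof (rule prob_cong_support)
    fix h assume "h \<in> set_pmf \<mu>"
    then have h: "h \<in> carrier (grigorchuk \<omega>)" using mu_carrier by blast
    have "?inv h = ?inv g \<longleftrightarrow> h = g" using g h group.inv_inv[OF group_grigorchuk] by metis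
    then show "h \<in> ?inv -` {?inv g} \<longleftrightarrow> h \<in> {g}" by simp
  qed
  finally show "pmf \<mu> g = pmf \<mu> (?inv g)" by (simp add: measure_pmf_single)
qed

lemma pmf_mu_ge:
  assumes "g \<in> set_pmf (level_law \<omega> J n)" shows "pmf \<mu> g \<ge> r ^ n * (1 - r) * (1 / 2) ^ (n + 2)"
proof -
  have "r ^ n * (1 - r) * (1 / 2) ^ (n + 2) \<le> pmf (geometric_pmf (1 - r)) n * pmf (level_law \<omega> J n) g"
    unfolding pmf_level using pmf_level_law_ge[OF assms] r_bounds by (intro mult_left_mono) auto
  also have "\<dots> = measure_pmf.expectation (geometric_pmf (1 - r)) (\<lambda>k. indicator {n} k * pmf (level_law \<omega> J n) g)"
    by (simp add: measure_pmf_single del: pmf_geometric)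
  also have "\<dots> \<le> measure_pmf.expectation (geometric_pmf (1 - r)) (\<lambda>k. pmf (level_law \<omega> J k) g)"
  proof (intro integral_mono)
    show "integrable (measure_pmf (geometric_pmf (1 - r))) (\<lambda>k. indicator {n} k * pmf (level_law \<omega> J n) g)"
      "integrable (measure_pmf (geometric_pmf (1 - r))) (\<lambda>k. pmf (level_law \<omega> J k) g)"
      by (intro measure_pmf.integrable_const_bound[where B = 1]; auto simp: indicator_def pmf_le_1)+
    show "indicator {n} k * pmf (level_law \<omega> J n) g \<le> pmf (level_law \<omega> J k) g" for k
      by (auto simp: indicator_def)
  qed
  also have "\<dots> = pmf \<mu> g" unfolding \<mu>_def pmf_bind ..
  finally show ?thesis .
qed

lemma ln_pmf_mu_square:
  assumes "g \<in> set_pmf (level_law \<omega> J n)"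
  shows "(ln (pmf \<mu> g))\<^sup>2 \<le> (- ln r - ln (1 - r) + 2)\<^sup>2 * (real n + 1)\<^sup>2"
proof -
  have rr: "0 < r" "0 < 1 - r" using r_bounds by auto
  have "ln (r ^ n * (1 - r) * (1 / 2) ^ (n + 2)) \<le> ln (pmf \<mu> g)"
    using pmf_mu_ge[OF assms] rr by (intro ln_mono) auto
  moreover have "ln (r ^ n * (1 - r) * (1 / 2) ^ (n + 2)) = real n * ln r + ln (1 - r) - (real n + 2) * ln 2"
  proof -
    have "ln (r ^ n * (1 - r) * (1 / 2) ^ (n + 2)) = ln (r ^ n) + ln (1 - r) + ln ((1 / 2) ^ (n + 2))"
      using rr by (subst ln_mult; simp)+
    also have "ln (r ^ n) = real n * ln r" using rr by (simp add: ln_realpow)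
    also have "ln ((1 / 2 :: real) ^ (n + 2)) = - (real n + 2) * ln 2"
      by (subst ln_realpow) (simp_all add: ln_div algebra_simps)
    finally show ?thesis by (simp add: algebra_simps)
  qed
  ultimately have "- ln (pmf \<mu> g) \<le> real n * (- ln r) + (- ln (1 - r)) + (real n + 2) * ln 2" by simp
  also have "\<dots> \<le> (- ln r - ln (1 - r) + 2) * (real n + 1)"
  proof -
    have "ln r \<le> 0" "ln (1 - r) \<le> 0" "ln 2 \<le> (1::real)" "(0::real) \<le> ln 2" using r_bounds ln_2_less_1 by auto
    moreover have "real n * ln (1 - r) \<le> 0" using \<open>ln (1 - r) \<le> 0\<close> by (simp add: mult_nonneg_nonpos)
    moreover have "(real n + 2) * ln 2 \<le> (real n + 2) * 1" using \<open>ln 2 \<le> 1\<close> by (intro mult_left_mono) auto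
    ultimately show ?thesis by (simp add: algebra_simps)
  qed
  finally have "\<bar>ln (pmf \<mu> g)\<bar> \<le> (- ln r - ln (1 - r) + 2) * (real n + 1)"
    using ln_pmf_nonpos[of \<mu> g] by simp
  then have "\<bar>ln (pmf \<mu> g)\<bar>\<^sup>2 \<le> ((- ln r - ln (1 - r) + 2) * (real n + 1))\<^sup>2" by (intro power_mono) auto
  then show ?thesis by (simp add: power_mult_distrib)
qed

lemma integrable_ln_square: "integrable (measure_pmf \<mu>) (\<lambda>g. (ln (pmf \<mu> g))\<^sup>2)"
proof -
  let ?K = "(- ln r - ln (1 - r) + 2)\<^sup>2"
  have "summable (\<lambda>n. r ^ n * (real n + 1)\<^sup>2)" using r_bounds by (intro summable_square_geometric) auto
  then have "summable (\<lambda>n. ((1 - r) * ?K) * (r ^ n * (real n + 1)\<^sup>2))" by (rule summable_mult)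
  then have "summable (\<lambda>n. pmf (geometric_pmf (1 - r)) n * (?K * (real n + 1)\<^sup>2))"
    unfolding pmf_level by (simp add: mult_ac)
  from integrable_mixture[of "level_law \<omega> J" "\<lambda>g. (ln (pmf \<mu> g))\<^sup>2" "\<lambda>n. ?K * (real n + 1)\<^sup>2", OF _ _ this]
  show ?thesis using ln_pmf_mu_square unfolding \<mu>_def[symmetric] by simp
qed

lemma finite_entropy_mu: "finite_entropy (grigorchuk \<omega>) \<mu>"
proof -
  have "integrable (measure_pmf \<mu>) (\<lambda>g. - ln (pmf \<mu> g))"
    using integrable_ln_of_square[OF integrable_ln_square] by simp
  from has_sum_expectation[OF mu_carrier this] show ?thesis
    unfolding finite_entropy_def by (auto simp: summable_on_def mult.commute)
qed

lemma germ_set_mu: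
  assumes "g \<in> set_pmf (level_law \<omega> J n)"
  shows "finite (germ_set \<omega> g)" "real (card (germ_set \<omega> g)) \<le> 4 * 2 powr (\<beta> * real n)"
proof -
  define m where "m = (\<lambda>n::nat. nat \<lfloor>\<beta> * real n\<rfloor>)"
  have *: "finite (germ_set \<omega> g) \<and> card (germ_set \<omega> g) \<le> 2 ^ (m n + 2)"
    by (rule germ_set_level_law[OF infinitely_many_L1 infinitely_many_L2 _ assms]) (auto simp: J_def m_def)
  then show "finite (germ_set \<omega> g)" by simp
  have "real (card (germ_set \<omega> g)) \<le> 2 ^ (m n + 2)" using * of_nat_mono[of _ "2 ^ (m n + 2)"] by fastforce
  also have "\<dots> = 4 * 2 powr real (m n)" by (simp add: powr_realpow)
  also have "\<dots> \<le> 4 * 2 powr (\<beta> * real n)"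
  proof -
    have "real (m n) \<le> \<beta> * real n" using beta by (simp add: m_def)
    then show ?thesis by simp
  qed
  finally show "real (card (germ_set \<omega> g)) \<le> 4 * 2 powr (\<beta> * real n)" .
qed

text \<open>A level \<open>n\<close> of probability \<open>2\<^bsup>-\<beta>n\<^esup>\<close>, up to a constant, has at most \<open>4\<cdot>2\<^bsup>\<beta>n\<^esup>\<close> germs; any exponent \<open>l < 1\<close>
  makes the expectation finite.\<close>
lemma integrable_germ_set:
  assumes "0 < l" "l < 1"
  shows "integrable (measure_pmf \<mu>) (\<lambda>g. real (card (germ_set \<omega> g)) powr l)"
proof -
  define q where "q = 2 powr (- (\<beta> * (1 - l)))"
  have "\<beta> * (1 - l) > 0" using beta assms by simp
  then have q: "0 < q" "q < 1" using powr_less_mono[of "- (\<beta> * (1 - l))" 0 2] by (auto simp: q_def)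
  have eq: "pmf (geometric_pmf (1 - r)) n * (4 * 2 powr (\<beta> * real n)) powr l = (1 - r) * 4 powr l * q ^ n" for n
  proof -
    have "r ^ n * (2 powr (\<beta> * real n)) powr l = q ^ n"
      by (simp add: r_def q_def powr_realpow[symmetric] powr_powr powr_add[symmetric] algebra_simps)
    then show ?thesis by (simp add: pmf_level powr_mult mult_ac)
  qed
  have "summable (\<lambda>n. pmf (geometric_pmf (1 - r)) n * (4 * 2 powr (\<beta> * real n)) powr l)"
    unfolding eq using q by (intro summable_mult summable_geometric) auto
  from integrable_mixture[of "level_law \<omega> J" "\<lambda>g. real (card (germ_set \<omega> g)) powr l" "\<lambda>n. (4 * 2 powr (\<beta> * real n)) powr l", OF _ _ this]
  show ?thesis unfolding \<mu>_def using germ_set_mu(2) assms by (simp add: powr_mono2)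
qed

text \<open>The proportion of digits that level \<open>n\<close> randomises: all of the first \<open>\<beta>n\<close>, and at least one in
  \<open>2D\<close> of the rest.\<close>
definition \<theta> :: real where "\<theta> = \<beta> + (1 - \<beta>) / (2 * real D)"

lemma beta_less_theta: "\<beta> < \<theta>"
  using beta D_pos by (simp add: \<theta>_def)

lemma card_J: "real (card (J n \<inter> {..<n})) \<ge> \<theta> * real n - 2"
proof -
  define m where "m = nat \<lfloor>\<beta> * real n\<rfloor>"
  define k where "k = (n - m) div (2 * D)"
  have bn: "\<beta> * real n \<ge> 0" "\<beta> * real n \<le> real n" using beta by (auto simp: mult_left_le_one_le)
  have m1: "real m \<le> \<beta> * real n" "\<beta> * real n - 1 \<le> real m"
    using bn unfolding m_def by linarith+
  then have mn: "m \<le> n" using bn by linarith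
  have "2 * D * k \<le> n - m" unfolding k_def by simp
  then have "{..<m} \<union> ({i. \<omega> i \<noteq> L0} \<inter> {m..<m + 2 * D * k}) \<subseteq> J n \<inter> {..<n}"
    using mn by (auto simp: J_def m_def[symmetric])
  then have "card ({..<m} \<union> ({i. \<omega> i \<noteq> L0} \<inter> {m..<m + 2 * D * k})) \<le> card (J n \<inter> {..<n})"
    by (intro card_mono) auto
  moreover have "card ({..<m} \<union> ({i. \<omega> i \<noteq> L0} \<inter> {m..<m + 2 * D * k})) = m + card ({i. \<omega> i \<noteq> L0} \<inter> {m..<m + 2 * D * k})"
    by (subst card_Un_disjoint) auto
  ultimately have "m + k \<le> card (J n \<inter> {..<n})" using card_nonzero_letters[OF Fr, of k m] by linarith
  then have c: "real m + real k \<le> real (card (J n \<inter> {..<n}))" by (metis of_nat_add of_nat_le_iff)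
  define d where "d = 2 * real D"
  have d: "d \<ge> 2" using D_pos by (simp add: d_def)
  have "n - m < 2 * D * (k + 1)" unfolding k_def using D_pos dividend_less_times_div[of "2 * D" "n - m"] by (simp add: algebra_simps)
  then have "real (n - m) < real (2 * D * (k + 1))" by (simp only: of_nat_less_iff)
  then have "real n - real m < d * (real k + 1)" using mn by (simp add: of_nat_diff d_def algebra_simps)
  then have k: "real k \<ge> (real n - real m) / d - 1" using d by (simp add: field_simps)
  have "(\<beta> * real n - 1) * (1 - 1 / d) \<le> real m * (1 - 1 / d)" using m1 d by (intro mult_right_mono) auto
  then have "\<beta> * real n - 1 + (real n - (\<beta> * real n - 1)) / d \<le> real m + (real n - real m) / d"
    by (simp add: algebra_simps diff_divide_distrib add_divide_distrib)
  moreover have "\<theta> * real n - 2 \<le> \<beta> * real n - 1 + (real n - (\<beta> * real n - 1)) / d - 1"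
  proof -
    have th: "\<theta> = \<beta> + (1 - \<beta>) / d" by (simp add: \<theta>_def d_def)
    have "1 / d \<ge> 0" using d by simp
    then show ?thesis unfolding th by (simp add: algebra_simps diff_divide_distrib add_divide_distrib)
  qed
  ultimately show ?thesis using c k by linarith
qed

sublocale germ_walk "grigorchuk \<omega>" \<mu> act "odd_germ \<omega>"
proof -
  interpret group "grigorchuk \<omega>" by (rule group_grigorchuk)
  show "germ_walk (grigorchuk \<omega>) \<mu> act (odd_germ \<omega>)"
  proof unfold_locales
    show "set_pmf \<mu> \<subseteq> carrier (grigorchuk \<omega>)" by (rule mu_carrier)
    show "act \<one>\<^bsub>grigorchuk \<omega>\<^esub> x = x" for x by simp
    fix g h x assume gh: "g \<in> carrier (grigorchuk \<omega>)" "h \<in> carrier (grigorchuk \<omega>)"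
    show "act (g \<otimes>\<^bsub>grigorchuk \<omega>\<^esub> h) x = act h (act g x)"
      unfolding mult_grigorchuk by (rule act_comp[OF gh[THEN prefixed_grigorchuk]])
    show "odd_germ \<omega> (g \<otimes>\<^bsub>grigorchuk \<omega>\<^esub> h) x = (odd_germ \<omega> g x \<noteq> odd_germ \<omega> h (act g x))"
      unfolding mult_grigorchuk by (rule odd_germ_comp[OF infinitely_many_L1 infinitely_many_L2 gh])
  qed
qed

text \<open>Apply \<open>walk_spread\<close> to the level \<open>n\<close> with \<open>2\<^bsup>\<beta>n\<^esup>\<close> about \<open>N\<^bsup>1-\<kappa>\<^esup>\<close>: it has been missed by all \<open>N\<close> steps
  only with probability \<open>exp(-cN\<^sup>\<kappa>)\<close>.\<close>
lemma spread_mu: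
  assumes "0 < \<kappa>" "\<kappa> < 1"
  shows "measure_pmf.prob (walk N) {g. act g x = y}
    \<le> exp (- (r * (1 - r)) * real N powr \<kappa>) + 4 * real N powr (- ((1 - \<kappa>) * \<theta> / \<beta>))"
proof (cases "N = 0")
  case True then show ?thesis by (simp add: indicator_def)
next
  case False
  define t where "t = (1 - \<kappa>) * log 2 (real N)"
  have t0: "t \<ge> 0" using False assms by (simp add: t_def)
  define n where "n = Suc (nat \<lfloor>t / \<beta>\<rfloor>)"
  have b0: "\<beta> > 0" using beta by simp
  have n: "real n - 1 \<le> t / \<beta>" "t / \<beta> \<le> real n"
    using t0 b0 divide_nonneg_pos[of t \<beta>] unfolding n_def by linarith+
  have Nt: "2 powr (c * t) = real N powr ((1 - \<kappa>) * c)" for c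
  proof -
    have "2 powr (c * t) = (2 powr log 2 (real N)) powr ((1 - \<kappa>) * c)"
      unfolding t_def powr_powr by (simp add: mult_ac)
    then show ?thesis using False by (simp add: powr_log_cancel)
  qed
  define w where "w = pmf (geometric_pmf (1 - r)) n"
  have "real N powr (- (1 - \<kappa>)) = 2 powr (- t)" using Nt[of "- 1"] by simp
  also have "\<dots> \<le> 2 powr (- (\<beta> * (real n - 1)))" using n(1) b0 by (intro powr_mono) (auto simp: field_simps)
  also have "\<dots> = (2 powr (- \<beta>)) powr (real n - 1)" unfolding powr_powr by simp
  also have "\<dots> = r ^ (n - 1)"
    using r_bounds by (simp add: r_def powr_realpow[symmetric] n_def)
  finally have "r * real N powr (- (1 - \<kappa>)) \<le> r ^ n"
    using r_bounds by (simp add: n_def mult_left_mono)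
  then have "r * real N powr (- (1 - \<kappa>)) * (1 - r) \<le> w"
    unfolding w_def pmf_level using r_bounds by (intro mult_right_mono) auto
  then have "r * real N powr (- (1 - \<kappa>)) * (1 - r) * real N \<le> w * real N" by (intro mult_right_mono) auto
  moreover have "real N powr (- (1 - \<kappa>)) * real N = real N powr \<kappa>"
    using False powr_add[of "real N" "- (1 - \<kappa>)" 1] by simp
  moreover have "r * real N powr (- (1 - \<kappa>)) * (1 - r) * real N = r * (1 - r) * (real N powr (- (1 - \<kappa>)) * real N)"
    by (simp only: mult_ac)
  ultimately have wN: "r * (1 - r) * real N powr \<kappa> \<le> w * real N" by (simp only:)
  have w1: "0 \<le> w" "w \<le> 1" by (auto simp: w_def pmf_le_1 simp del: pmf_geometric)
  have "(1 - w) ^ N \<le> exp (- w) ^ N" using w1 exp_ge_add_one_self[of "- w"] by (intro power_mono) auto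
  also have "\<dots> = exp (- (w * real N))" by (simp add: exp_of_nat_mult[symmetric] mult.commute)
  also have "\<dots> \<le> exp (- (r * (1 - r)) * real N powr \<kappa>)" using wN by simp
  finally have 1: "(1 - w) ^ N \<le> exp (- (r * (1 - r)) * real N powr \<kappa>)" .
  have "(1 / 2 :: real) ^ card (J n \<inter> {..<n}) = 2 powr (- real (card (J n \<inter> {..<n})))"
    by (simp add: powr_minus powr_realpow power_one_over inverse_eq_divide)
  also have "\<dots> \<le> 2 powr (2 - \<theta> / \<beta> * t)"
  proof -
    have "\<theta> * (t / \<beta>) \<le> \<theta> * real n" using n(2) beta_less_theta b0 by (intro mult_left_mono) auto
    then have "- real (card (J n \<inter> {..<n})) \<le> 2 - \<theta> / \<beta> * t" using card_J[of n] by simp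
    then show ?thesis by simp
  qed
  also have "\<dots> = 4 * 2 powr ((- (\<theta> / \<beta>)) * t)" by (simp add: powr_diff powr_minus_divide)
  also have "\<dots> = 4 * real N powr (- ((1 - \<kappa>) * \<theta> / \<beta>))" unfolding Nt by simp
  finally have 2: "(1 / 2 :: real) ^ card (J n \<inter> {..<n}) \<le> 4 * real N powr (- ((1 - \<kappa>) * \<theta> / \<beta>))" .
  have "measure_pmf.prob (walk N) {g. act g x = y} \<le> (1 - w) ^ N + (1 / 2) ^ card (J n \<inter> {..<n})"
    unfolding w_def by (rule walk_spread[OF \<mu>_def]) (auto intro: level_law_spread simp: n_def)
  then show ?thesis using 1 2 by linarith
qed

text \<open>Here the gap \<open>\<beta> < \<theta>\<close> is spent: the exponent \<open>l < 1\<close> is needed both for the germs and for the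
  spreading bound with \<open>\<kappa> = 1 - l\<close>, and \<open>l\<^sup>2\<theta>/\<beta> > 1\<close> makes the resulting series converge.\<close>
theorem limit_mu:
  "\<exists>f. (\<forall>g\<in>carrier (grigorchuk \<omega>). (\<lambda>N. germ_prob ones N g) \<longlonglongrightarrow> f g) \<and> bounded (f ` carrier (grigorchuk \<omega>))
    \<and> harmonic (grigorchuk \<omega>) \<mu> f \<and> \<not> f constant_on carrier (grigorchuk \<omega>)"
proof -
  have b0: "\<beta> > 0" "\<theta> > 0" using beta beta_less_theta by auto
  define q where "q = \<beta> / \<theta>"
  have q: "0 < q" "q < 1" using b0 beta_less_theta by (auto simp: q_def)
  \<comment> \<open>Any \<open>l\<close> with \<open>q < l\<^sup>2 < 1\<close> works.\<close>
  define l where "l = sqrt ((1 + q) / 2)"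
  have l: "0 < l" "l < 1" using q by (auto simp: l_def real_less_lsqrt)
  have l2: "l * l > q" using q by (simp add: l_def)
  define P where "P N = exp (- (r * (1 - r)) * real N powr (1 - l)) + 4 * real N powr (- (l * \<theta> / \<beta>))" for N :: nat
  have spread: "measure_pmf.prob (walk N) {g. act g x = y} \<le> P N" for N x y
    using spread_mu[of "1 - l" N x y] l by (simp add: P_def)
  have "l * \<theta> / \<beta> * l > 1" using l2 b0 by (simp add: q_def field_simps)
  then have sP: "summable (\<lambda>N. P N powr l)"
    unfolding P_def using r_bounds l b0 by (intro summable_spread) auto
  let ?E = "measure_pmf.expectation \<mu> (\<lambda>s. real (card {x. odd_germ \<omega> s x}) powr l)"
  have ch: "change N x \<le> P N powr l * ?E" for N x
  proof (rule change_le)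
    show "measure_pmf.prob (walk N) {g. act g x = y} \<le> P N" for x y by (rule spread)
    show "0 \<le> P N" by (simp add: P_def)
    show "finite {x. odd_germ \<omega> s x}" if "s \<in> set_pmf \<mu>" for s
      using that germ_set_mu(1) unfolding \<mu>_def germ_set_def by (auto simp del: set_pmf_geometric)
    show "integrable (measure_pmf \<mu>) (\<lambda>s. real (card {x. odd_germ \<omega> s x}) powr l)"
      using integrable_germ_set[OF l] by (simp add: germ_set_def)
  qed (use l in auto)
  have act_b: "act (spinal Kb \<omega>) ones = ones"
  proof (rule pre_inj)
    have ones: "spinal k \<psi> (replicate n True) = replicate n True" for k \<psi> n
      by (induction n arbitrary: \<psi>) auto
    have "pre n ones = replicate n True" for n by (rule nth_equalityI) auto
    then show "pre n (act (spinal Kb \<omega>) ones) = pre n ones" for n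
      by (simp add: pre_act[OF prefixed_spinal] ones)
  qed
  show ?thesis
  proof (rule germ_limit[OF summable_mult2[OF sP] ch])
    show "spinal Kb \<omega> \<in> carrier (grigorchuk \<omega>)" using gens_in_grigorchuk by (auto simp: grig_gens_def)
    show "act (spinal Kb \<omega>) ones = ones" by (rule act_b)
    show "odd_germ \<omega> (spinal Kb \<omega>) ones" using has_germ_spinal_ones by (simp add: odd_germ_def)
  qed
qed

abbreviation len :: "(vertex \<Rightarrow> vertex) \<Rightarrow> real" where "len g \<equiv> real (grig_length \<omega> g)"

text \<open>It depends on \<open>\<beta>\<close> only, which makes the constant of the tail bound uniform in \<open>\<omega>\<close>.\<close>
definition tail_const :: real where "tail_const = 4 / (2 * r - 1) + 1"

text \<open>Level \<open>k < n\<close> contributes at most \<open>4\<cdot>2\<^bsup>k-n\<^esup>\<close>, as \<open>L\<^sub>n \<ge> 2\<^bsup>n-k\<^esup>L\<^sub>k\<close>, and the higher levels at most \<open>1\<close>.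
  Because \<open>2r > 1\<close>, the sum is dominated by the levels close to \<open>n\<close>.\<close>
lemma truncated_length_mu:
  "measure_pmf.expectation \<mu> (\<lambda>g. min 1 (len g / grig_L \<omega> n)) \<le> tail_const * r ^ n"
proof -
  define \<phi> where "\<phi> k = (if k < n then 4 * 2 ^ k / 2 ^ n else (1::real))" for k
  have L: "grig_L \<omega> n > 0" using grig_L_ge[of \<omega> n] by linarith
  have phi: "0 \<le> min 1 (len g / grig_L \<omega> n) \<and> min 1 (len g / grig_L \<omega> n) \<le> \<phi> k"
    if "g \<in> set_pmf (level_law \<omega> J k)" for g k
  proof (cases "k < n")
    case True
    have "2 ^ (n - k) * grig_L \<omega> k \<le> grig_L \<omega> n" using grig_L_growth[of "n - k" \<omega> k] True by simp
    then have "2 ^ n * grig_L \<omega> k \<le> 2 ^ k * grig_L \<omega> n"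
      using True by (simp add: power_diff field_simps)
    moreover have "len g \<le> 4 * grig_L \<omega> k" by (rule grig_length_level_law[OF that])
    then have "2 ^ n * len g \<le> 2 ^ n * (4 * grig_L \<omega> k)" by (intro mult_left_mono) auto
    ultimately have "2 ^ n * len g \<le> 4 * (2 ^ k * grig_L \<omega> n)" by linarith
    then have "len g / grig_L \<omega> n \<le> 4 * 2 ^ k / 2 ^ n" using L by (simp add: field_simps)
    then show ?thesis using True L by (auto simp: \<phi>_def min_le_iff_disj)
  qed (use L in \<open>auto simp: \<phi>_def\<close>)
  have phi0: "0 \<le> \<phi> k" for k by (simp add: \<phi>_def)
  let ?f = "\<lambda>k. pmf (geometric_pmf (1 - r)) k * \<phi> k"
  have rr: "1 / 2 < r" "r < 1" by (rule r_bounds)+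
  have shift: "?f (k + n) = (1 - r) * r ^ n * r ^ k" for k
    by (simp add: pmf_level \<phi>_def power_add del: pmf_geometric)
  have ss: "summable (\<lambda>k. ?f (k + n))" unfolding shift using rr by (intro summable_mult summable_geometric) auto
  then have sf: "summable ?f" by (rule summable_iff_shift[THEN iffD1])
  have "measure_pmf.expectation \<mu> (\<lambda>g. min 1 (len g / grig_L \<omega> n)) \<le> suminf ?f"
    unfolding \<mu>_def by (rule expectation_mixture_le[OF phi phi0 sf])
  also have "suminf ?f = (\<Sum>k. ?f (k + n)) + sum ?f {..<n}" by (rule suminf_split_initial_segment[OF sf])
  also have "(\<Sum>k. ?f (k + n)) = r ^ n"
    unfolding shift using rr by (subst suminf_mult) (auto simp: suminf_geometric intro!: summable_geometric)
  also have "sum ?f {..<n} = 4 * (1 - r) / 2 ^ n * (\<Sum>k<n. (2 * r) ^ k)"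
    unfolding sum_distrib_left by (intro sum.cong) (auto simp: pmf_level \<phi>_def power_mult_distrib simp del: pmf_geometric)
  also have "(\<Sum>k<n. (2 * r) ^ k) = ((2 * r) ^ n - 1) / (2 * r - 1)"
    using rr by (intro geometric_sum) auto
  also have "4 * (1 - r) / 2 ^ n * (((2 * r) ^ n - 1) / (2 * r - 1)) \<le> 4 * 1 / 2 ^ n * ((2 * r) ^ n / (2 * r - 1))"
    using rr one_le_power[of "2 * r" n] by (intro mult_mono divide_right_mono) auto
  also have "\<dots> = 4 / (2 * r - 1) * r ^ n" by (simp add: power_mult_distrib)
  finally show ?thesis by (simp add: tail_const_def algebra_simps)
qed

lemma integrable_truncated: "integrable (measure_pmf p) (\<lambda>g. min 1 (len g / grig_L \<omega> n))"
  using grig_L_ge[of \<omega> n] by (intro measure_pmf.integrable_const_bound[where B = 1]) auto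

lemma prob_outside_ball_le:
  assumes "set_pmf p \<subseteq> carrier (grigorchuk \<omega>)"
  shows "measure_pmf.prob p (- word_ball (grigorchuk \<omega>) (grig_gens \<omega>) (grig_L \<omega> n))
    \<le> measure_pmf.expectation p (\<lambda>g. min 1 (len g / grig_L \<omega> n))"
proof -
  let ?A = "- word_ball (grigorchuk \<omega>) (grig_gens \<omega>) (grig_L \<omega> n)"
  have L: "grig_L \<omega> n > 0" using grig_L_ge[of \<omega> n] by linarith
  have "measure_pmf.prob p ?A = measure_pmf.expectation p (indicator ?A)" by simp
  also have "\<dots> \<le> measure_pmf.expectation p (\<lambda>g. min 1 (len g / grig_L \<omega> n))"
  proof (intro integral_mono_AE AE_pmfI integrable_truncated)
    show "integrable (measure_pmf p) (indicator ?A :: _ \<Rightarrow> real)"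
      by (intro measure_pmf.integrable_const_bound[where B = 1]) (auto simp: indicator_def)
    fix g assume "g \<in> set_pmf p"
    then show "indicator ?A g \<le> min 1 (len g / grig_L \<omega> n)"
      using assms L by (auto simp: indicator_def word_ball_def field_simps)
  qed
  finally show ?thesis .
qed

lemma tail_mu:
  "measure_pmf.prob \<mu> (carrier (grigorchuk \<omega>) - word_ball (grigorchuk \<omega>) (grig_gens \<omega>) (grig_L \<omega> n))
    \<le> tail_const * r ^ n"
proof -
  have "measure_pmf.prob \<mu> (carrier (grigorchuk \<omega>) - word_ball (grigorchuk \<omega>) (grig_gens \<omega>) (grig_L \<omega> n))
      \<le> measure_pmf.prob \<mu> (- word_ball (grigorchuk \<omega>) (grig_gens \<omega>) (grig_L \<omega> n))"
    by (intro measure_pmf.finite_measure_mono) auto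
  then show ?thesis using prob_outside_ball_le[OF mu_carrier] truncated_length_mu by (meson order_trans)
qed

text \<open>The truncated length is subadditive, so its expectation grows at most linearly with the number of
  steps. It equals \<open>1\<close> outside the ball of radius \<open>L\<^sub>n\<close>, and thus bounds the exit probability without a
  separate treatment of large jumps.\<close>
lemma truncated_length_walk:
  "measure_pmf.expectation (walk N) (\<lambda>g. min 1 (len g / grig_L \<omega> n)) \<le> real N * (tail_const * r ^ n)"
proof (induction N)
  case 0
  have "grig_length \<omega> (word_prod []) \<le> length ([] :: (vertex \<Rightarrow> vertex) list)" by (rule grig_length_le) simp
  then have "grig_length \<omega> id = 0" by (simp only: word_prod_simps list.size)
  then show ?case by simp
next
  case (Suc N)
  let ?\<psi> = "\<lambda>g. min 1 (len g / grig_L \<omega> n)"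
  let ?Q = "pair_pmf \<mu> (walk N)"
  have L: "grig_L \<omega> n > 0" using grig_L_ge[of \<omega> n] by linarith
  have i1: "integrable (measure_pmf ?Q) (\<lambda>z. ?\<psi> (fst z))" and i2: "integrable (measure_pmf ?Q) (\<lambda>z. ?\<psi> (snd z))"
    and i3: "integrable (measure_pmf ?Q) (\<lambda>z. ?\<psi> (snd z \<circ> fst z))"
    using L by (intro measure_pmf.integrable_const_bound[where B = 1]; simp)+
  have "measure_pmf.expectation (walk (Suc N)) ?\<psi> = measure_pmf.expectation ?Q (\<lambda>z. ?\<psi> (snd z \<circ> fst z))"
    by (simp add: case_prod_beta)
  also have "\<dots> \<le> measure_pmf.expectation ?Q (\<lambda>z. ?\<psi> (fst z) + ?\<psi> (snd z))"
  proof (intro integral_mono_AE AE_pmfI i3 Bochner_Integration.integrable_add i1 i2)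
    fix z assume "z \<in> set_pmf ?Q"
    then have "fst z \<in> carrier (grigorchuk \<omega>)" "snd z \<in> carrier (grigorchuk \<omega>)"
      using mu_carrier set_walk[of N] by auto
    from grig_length_mult[OF this] have "len (snd z \<circ> fst z) \<le> len (fst z) + len (snd z)" by linarith
    then have "len (snd z \<circ> fst z) / grig_L \<omega> n \<le> (len (fst z) + len (snd z)) / grig_L \<omega> n"
      using L by (intro divide_right_mono) auto
    then have "len (snd z \<circ> fst z) / grig_L \<omega> n \<le> len (fst z) / grig_L \<omega> n + len (snd z) / grig_L \<omega> n"
      by (simp add: add_divide_distrib)
    moreover have "0 \<le> len (fst z) / grig_L \<omega> n" "0 \<le> len (snd z) / grig_L \<omega> n" using L by auto
    ultimately show "?\<psi> (snd z \<circ> fst z) \<le> ?\<psi> (fst z) + ?\<psi> (snd z)" by (auto simp: min_def)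
  qed
  also have "\<dots> = measure_pmf.expectation \<mu> ?\<psi> + measure_pmf.expectation (walk N) ?\<psi>"
    using i1 i2 expectation_pair_pmf_fst[of \<mu> "walk N" ?\<psi>] expectation_pair_pmf_snd[of \<mu> "walk N" ?\<psi>] by simp
  also have "\<dots> \<le> tail_const * r ^ n + real N * (tail_const * r ^ n)" using truncated_length_mu Suc by (intro add_mono)
  finally show ?case by (simp add: algebra_simps)
qed

text \<open>With \<open>N\<close> a small multiple of \<open>2\<^bsup>\<beta>n\<^esup>\<close>, the ball carries almost all the mass of \<open>W\<^sub>N\<close>. For the finitely
  many \<open>n\<close> where the resulting bound is void, the ball still contains \<open>id\<close> and \<open>a\<close>.\<close>
theorem growth_lower:
  "\<exists>c>0. \<forall>n. real (growth (grigorchuk \<omega>) (grig_gens \<omega>) (grig_L \<omega> n)) \<ge> exp (c * (2 ^ n) powr \<beta>)"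
proof -
  let ?B = "\<lambda>n. word_ball (grigorchuk \<omega>) (grig_gens \<omega>) (grig_L \<omega> n)"
  obtain f where "\<And>g. g \<in> carrier (grigorchuk \<omega>) \<Longrightarrow> (\<lambda>N. germ_prob ones N g) \<longlonglongrightarrow> f g"
    "\<not> f constant_on carrier (grigorchuk \<omega>)" using limit_mu by blast
  from exponential_support[OF integrable_ln_square nondegenerate_mu this]
  obtain \<eta> c C where eta: "\<eta> > 0" "c > 0" and
    sup: "\<And>N A. finite A \<Longrightarrow> A \<noteq> {} \<Longrightarrow> measure_pmf.prob (walk N) (- A) \<le> \<eta> \<Longrightarrow> ln (card A) \<ge> c * real N - C"
    by metis
  have two: "card (?B n) \<ge> 2" for n
  proof -
    have "grig_length \<omega> (word_prod []) \<le> length ([] :: (vertex \<Rightarrow> vertex) list)" by (rule grig_length_le) simp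
    moreover have "grig_length \<omega> (word_prod [tree_a]) \<le> length [tree_a]" by (rule grig_length_le) (simp add: grig_gens_def)
    ultimately have "grig_length \<omega> id \<le> 0" "grig_length \<omega> tree_a \<le> 1" by (simp_all only: word_prod_simps id_comp list.size)
    moreover have "tree_a \<in> carrier (grigorchuk \<omega>)" using gens_in_grigorchuk by (auto simp: grig_gens_def)
    ultimately have "{id, tree_a} \<subseteq> ?B n" using grig_L_ge[of \<omega> n] id_in_grigorchuk by (auto simp: word_ball_def)
    moreover have "tree_a [True] \<noteq> id [True]" by (simp add: tree_a_def)
    then have "card {id, tree_a} = 2" by (metis card_2_iff)
    ultimately show ?thesis using card_mono[OF finite_grig_ball] by metis
  qed
  have ne: "?B n \<noteq> {}" for n using two[of n] by force
  have tc: "tail_const > 0" using r_bounds by (simp add: tail_const_def add_pos_pos)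
  define c1 where "c1 = c * \<eta> / tail_const"
  define C1 where "C1 = max 1 (c + C)"
  have c1: "c1 > 0" using eta tc by (simp add: c1_def)
  have lnB: "ln (card (?B n)) \<ge> c1 * (2 ^ n) powr \<beta> - C1" for n
  proof -
    define N where "N = nat \<lfloor>\<eta> / (tail_const * r ^ n)\<rfloor>"
    have rn: "r ^ n > 0" using r_bounds by simp
    have x0: "\<eta> / (tail_const * r ^ n) \<ge> 0" using eta tc rn by simp
    have N: "real N \<le> \<eta> / (tail_const * r ^ n)" "\<eta> / (tail_const * r ^ n) - 1 \<le> real N"
      using x0 unfolding N_def by linarith+
    have "measure_pmf.prob (walk N) (- ?B n) \<le> real N * (tail_const * r ^ n)"
      using prob_outside_ball_le[OF set_walk, of N n] truncated_length_walk[of N n] by linarith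
    also have "\<dots> \<le> \<eta>" using N(1) tc rn by (simp add: field_simps)
    finally have "ln (card (?B n)) \<ge> c * real N - C" by (rule sup[OF finite_grig_ball ne])
    moreover have "c * (\<eta> / (tail_const * r ^ n) - 1) \<le> c * real N" using N(2) eta by (intro mult_left_mono) auto
    moreover have "c * (\<eta> / (tail_const * r ^ n) - 1) = c1 * (2 ^ n) powr \<beta> - c"
      unfolding r_power by (simp add: c1_def powr_minus_divide algebra_simps)
    ultimately show ?thesis unfolding C1_def by linarith
  qed
  define c2 where "c2 = min (c1 / 2) (ln 2 * c1 / (2 * C1))"
  have C1: "C1 \<ge> 1" by (simp add: C1_def)
  have c2: "c2 > 0" using c1 C1 by (simp add: c2_def)
  have "c2 * (2 ^ n) powr \<beta> \<le> ln (card (?B n))" for n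
  proof (cases "c1 * (2 ^ n) powr \<beta> \<ge> 2 * C1")
    case True
    have "c2 * (2 ^ n) powr \<beta> \<le> c1 / 2 * (2 ^ n) powr \<beta>" by (intro mult_right_mono) (auto simp: c2_def)
    then show ?thesis using lnB[of n] True by linarith
  next
    case False
    have "c2 * (2 ^ n) powr \<beta> \<le> ln 2 * c1 / (2 * C1) * (2 ^ n) powr \<beta>" by (intro mult_right_mono) (auto simp: c2_def)
    also have "\<dots> = ln 2 / (2 * C1) * (c1 * (2 ^ n) powr \<beta>)" by simp
    also have "\<dots> \<le> ln 2 / (2 * C1) * (2 * C1)" using False C1 by (intro mult_left_mono) auto
    also have "\<dots> = ln 2" using C1 by simp
    also have "\<dots> \<le> ln (card (?B n))" using two[of n] by (intro ln_mono) auto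
    finally show ?thesis .
  qed
  then have "exp (c2 * (2 ^ n) powr \<beta>) \<le> real (growth (grigorchuk \<omega>) (grig_gens \<omega>) (grig_L \<omega> n))" for n
  proof -
    have "exp (c2 * (2 ^ n) powr \<beta>) \<le> exp (ln (card (?B n)))" using \<open>c2 * (2 ^ n) powr \<beta> \<le> ln (card (?B n))\<close> by simp
    then show ?thesis using two[of n] by (simp add: growth_def)
  qed
  then show ?thesis using c2 by blast
qed

end

theorem theorem8p3:
  fixes D :: nat and \<epsilon> :: real
  assumes "\<epsilon> > 0"
  shows "\<exists>C>0. \<forall>\<omega>. Fr D \<omega> \<longrightarrow>
    (\<exists>\<mu>. prob_on (grigorchuk \<omega>) \<mu>
        \<and> nondegenerate (grigorchuk \<omega>) \<mu>
        \<and> symmetric (grigorchuk \<omega>) \<mu>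
        \<and> finite_entropy (grigorchuk \<omega>) \<mu>
        \<and> nontrivial_Poisson_boundary (grigorchuk \<omega>) \<mu>
        \<and> (\<forall>n\<ge>1. measure_pmf.prob \<mu>
              (carrier (grigorchuk \<omega>) - word_ball (grigorchuk \<omega>) (grig_gens \<omega>) (grig_L \<omega> n))
              \<le> C * (2 ^ n) powr (- 1 + \<epsilon>)))
    \<and> (\<exists>c>0. \<forall>n\<ge>1. real (growth (grigorchuk \<omega>) (grig_gens \<omega>) (grig_L \<omega> n))
              \<ge> exp (c * (2 ^ n) powr (1 - \<epsilon>)))"
proof -
  define \<beta> where "\<beta> = 1 - min \<epsilon> (1 / 2)"
  have b: "1 / 2 \<le> \<beta>" "\<beta> < 1" "1 - \<epsilon> \<le> \<beta>" using assms by (auto simp: \<beta>_def)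
  define C where "C = 4 / (2 * 2 powr (- \<beta>) - 1) + 1"
  have half: "2 powr (- \<beta>) > (1 / 2 :: real)"
  proof -
    have "2 powr (- 1) < (2::real) powr (- \<beta>)" using b by (intro powr_less_mono) auto
    then show ?thesis by (simp add: powr_minus_divide)
  qed
  have "C > 0" using half by (simp add: C_def add_pos_pos)
  moreover have "(\<exists>\<mu>. prob_on (grigorchuk \<omega>) \<mu>
        \<and> nondegenerate (grigorchuk \<omega>) \<mu>
        \<and> symmetric (grigorchuk \<omega>) \<mu>
        \<and> finite_entropy (grigorchuk \<omega>) \<mu>
        \<and> nontrivial_Poisson_boundary (grigorchuk \<omega>) \<mu>
        \<and> (\<forall>n\<ge>1. measure_pmf.prob \<mu>
              (carrier (grigorchuk \<omega>) - word_ball (grigorchuk \<omega>) (grig_gens \<omega>) (grig_L \<omega> n))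
              \<le> C * (2 ^ n) powr (- 1 + \<epsilon>)))
    \<and> (\<exists>c>0. \<forall>n\<ge>1. real (growth (grigorchuk \<omega>) (grig_gens \<omega>) (grig_L \<omega> n))
              \<ge> exp (c * (2 ^ n) powr (1 - \<epsilon>)))" if Fr: "Fr D \<omega>" for \<omega>
  proof -
    interpret heavy_tail \<omega> D \<beta> by unfold_locales (use Fr b in auto)
    have "nontrivial_Poisson_boundary (grigorchuk \<omega>) \<mu>"
      unfolding nontrivial_Poisson_boundary_def using limit_mu by blast
    moreover have "measure_pmf.prob \<mu> (carrier (grigorchuk \<omega>) - word_ball (grigorchuk \<omega>) (grig_gens \<omega>) (grig_L \<omega> n))
        \<le> C * (2 ^ n) powr (- 1 + \<epsilon>)" for n
    proof -
      have "tail_const * r ^ n = C * (2 ^ n) powr (- \<beta>)" 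
        unfolding tail_const_def C_def r_power by (simp add: r_def)
      also have "\<dots> \<le> C * (2 ^ n) powr (- 1 + \<epsilon>)" using \<open>C > 0\<close> b(3) by (intro mult_left_mono powr_mono) auto
      finally show ?thesis using tail_mu[of n] by linarith
    qed
    moreover have "prob_on (grigorchuk \<omega>) \<mu>" unfolding prob_on_def by (rule mu_carrier)
    moreover have "\<exists>c>0. \<forall>n\<ge>1. real (growth (grigorchuk \<omega>) (grig_gens \<omega>) (grig_L \<omega> n)) \<ge> exp (c * (2 ^ n) powr (1 - \<epsilon>))"
    proof -
      obtain c where c: "c > 0" and grow: "\<And>n. exp (c * (2 ^ n) powr \<beta>) \<le> real (growth (grigorchuk \<omega>) (grig_gens \<omega>) (grig_L \<omega> n))"
        using growth_lower by blast
      have "exp (c * (2 ^ n) powr (1 - \<epsilon>)) \<le> exp (c * (2 ^ n) powr \<beta>)" for n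
        using c b by (auto intro!: powr_mono)
      then show ?thesis using c grow by (meson order_trans)
    qed
    ultimately show ?thesis using nondegenerate_mu symmetric_mu finite_entropy_mu by blast
  qed
  ultimately show ?thesis by blast
qed

end
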